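(* Let $n\ge 1$, let $\Omega\subset\mathbb{R}^n$ be a bounded Lipschitz domain with $\operatorname{meas}(\Omega)=1$, and let $s\in(0,1)$. For $\varepsilon>0$ and admissible $q>2$ let $\mathcal{I}^{\varepsilon}_{s,q}$ be the functional defined in the context. Uniqueness of a minimizer is understood up to multiplication by a nonzero constant. 1. For any $q\in(2,2^*_s]$ (for any $q\in(2,\infty)$ if $n=1$ and $s\ge\frac12$) there exists $\check{\varepsilon}(q)>0$ such that for all $\varepsilon\in(0,\check{\varepsilon}(q))$ the constant function $\mathbf{1}$ is the unique global minimizer of $\mathcal{I}^{\varepsilon}_{s,q}$. 2. For any $\varepsilon>0$ there exists $\check{q}(\varepsilon)\in(2,2^*_s]$ ($\check{q}(\varepsilon)\in(2,\infty)$ if $n=1$ and $s\ge\frac12$) such that for all $q\in(2,\check{q}(\varepsilon))$ the constant function $\mathbf{1}$ is the unique global minimizer of $\mathcal{I}^{\varepsilon}_{s,q}$. 3. Let $\varepsilon_0>0$ and let $q_0>2$ be admissible, and suppose that the constant function $\mathbf{1}$ is not a global minimizer of $\mathcal{I}^{\varepsilon_0}_{s,q_0}$. Then for any $\varepsilon\ge\varepsilon_0$ and any admissible $q\ge q_0$ the constant function $\mathbf{1}$ is not a global minimizer of $\mathcal{I}^{\varepsilon}_{s,q}$ either.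
   Context: All functions are real-valued. A domain is a connected open set. Let $0=\lambda_0<\lambda_1\le\lambda_2\le\dots$ be the eigenvalues of the Neumann Laplacian in $\Omega$ (repeated according to multiplicity), with eigenfunctions $\phi_0,\phi_1,\phi_2,\dots$ forming an orthonormal basis of $L_2(\Omega)$; $\phi_0$ is constant. The quadratic form of the spectral Neumann fractional Laplacian is $$\langle(-\Delta)^s_{Sp}u,u\rangle:=\sum_{j=1}^\infty \lambda_j^s\,(u,\phi_j)_{L_2(\Omega)}^2 .$$ Its domain, i.e. the set of $u\in L_2(\Omega)$ for which this sum is finite, coincides with the Sobolev--Slobodetskii space $\mathcal{H}^s(\Omega)$, which is equipped with the norm $\|u\|^2_{\mathcal{H}^s(\Omega)}:=\langle(-\Delta)^s_{Sp}u,u\rangle+\|u\|^2_{L_2(\Omega)}$ (equivalent to the standard one). Admissible exponents: $q\in[1,2^*_s]$ with $2^*_s:=2n/(n-2s)$ if $n\ge2$, or if $n=1$ and $s<\tfrac12$; $q\in[1,\infty)$ if $n=1$, $s=\tfrac12$; $q\in[1,\infty]$ if $n=1$, $s>\tfrac12$. For admissible $q$ the embedding $\mathcal{H}^s(\Omega)\hookrightarrow L_q(\Omega)$ is continuous. For $\varepsilon>0$ and $u\in\mathcal{H}^s(\Omega)$, $u\ne0$, $$\mathcal{I}^{\varepsilon}_{s,q}[u]:=\frac{\langle(-\Delta)^s_{Sp}u,u\rangle+\varepsilon^{2s}\|u\|^2_{L_2(\Omega)}}{\|u\|^2_{L_q(\Omega)}} .$$ (Up to a power of $\varepsilon$, this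 is the quotient $\|\cdot\|^2_{\mathcal{H}^s}/\|\cdot\|^2_{L_q}$ on the dilated domain $\varepsilon\Omega$.) It is invariant under multiplication of $u$ by nonzero constants. The function $\mathbf{1}$ is identically equal to one, and $\mathcal{I}^{\varepsilon}_{s,q}[\mathbf{1}]=\varepsilon^{2s}$. A function $v$ is a global minimizer of $\mathcal{I}^{\varepsilon}_{s,q}$ if $\mathcal{I}^{\varepsilon}_{s,q}[v]\le\mathcal{I}^{\varepsilon}_{s,q}[u]$ for all nonzero $u\in\mathcal{H}^s(\Omega)$. *)

theory Defs
  imports "HOL-Analysis.Analysis" "HOL-Probability.Essential_Supremum"
begin

text \<open>
  Functions on \<open>\<Omega>\<close> are represented by total functions on \<open>real ^ 'n\<close>; only their values on \<open>\<Omega>\<close>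
  matter, because all integrals and almost-everywhere statements refer to the Lebesgue measure
  \<open>lebesgue_on \<Omega>\<close>. In particular ``\<open>u \<noteq> 0\<close>'' is always meant almost everywhere.
\<close>

subsection \<open>Lipschitz domains\<close>

text \<open>
  Near every boundary point, \<open>\<Omega>\<close> is the strict epigraph, in some direction \<open>e\<close>, of a Lipschitz
  function on the hyperplane orthogonal to \<open>e\<close>. For \<open>n = 1\<close> the hyperplane is a point, so \<open>\<Omega>\<close> lies
  locally on one side of each boundary point.
\<close>

definition lipschitz_domain :: "(real ^ 'n) set \<Rightarrow> bool" where
  "lipschitz_domain \<Omega> \<longleftrightarrow> open \<Omega> \<and> connected \<Omega> \<and>
     (\<forall>x0\<in>frontier \<Omega>. \<exists>r>0. \<exists>e \<gamma> L. norm e = 1 \<and> L-lipschitz_on {y. y \<bullet> e = 0} \<gamma> \<and>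
        \<Omega> \<inter> ball x0 r = {y \<in> ball x0 r. \<gamma> (y - (y \<bullet> e) *\<^sub>R e) < y \<bullet> e})"

subsection \<open>Lebesgue spaces\<close>

definition in_L2 :: "'a measure \<Rightarrow> ('a \<Rightarrow> 'b::real_inner) \<Rightarrow> bool" where
  "in_L2 M u \<longleftrightarrow> u \<in> borel_measurable M \<and> integrable M (\<lambda>x. (norm (u x))\<^sup>2)"

definition L2_inner :: "'a measure \<Rightarrow> ('a \<Rightarrow> real) \<Rightarrow> ('a \<Rightarrow> real) \<Rightarrow> real" where
  "L2_inner M u v = (\<integral>x. u x * v x \<partial>M)"

text \<open>
  The norm takes values in \<open>[0, \<infinity>]\<close>, so that it is \<open>\<infinity>\<close> (and not a dummy value) for measurable
  functions outside the space. It is meant for \<open>1 \<le> q \<le> \<infinity>\<close>.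
\<close>

definition Lq_norm :: "'a measure \<Rightarrow> ennreal \<Rightarrow> ('a \<Rightarrow> real) \<Rightarrow> ennreal" where
  "Lq_norm M q u =
     (if q = \<infinity> then esssup M (\<lambda>x. ennreal \<bar>u x\<bar>)
      else let I = (\<integral>\<^sup>+x. ennreal (\<bar>u x\<bar> powr enn2real q) \<partial>M)
           in if I = \<infinity> then \<infinity> else ennreal (enn2real I powr (1 / enn2real q)))"

subsection \<open>The Neumann Laplacian\<close>

text \<open>
  Weak derivatives are tested with compactly supported \<open>C\<^sup>1\<close> functions; by mollification this is
  equivalent to testing with \<open>C\<^sup>\<infinity>\<close> functions.
\<close>

definition C1c_with_gradient ::
    "(real ^ 'n) set \<Rightarrow> (real ^ 'n \<Rightarrow> real) \<Rightarrow> (real ^ 'n \<Rightarrow> real ^ 'n) \<Rightarrow> bool" where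
  "C1c_with_gradient \<Omega> \<psi> d\<psi> \<longleftrightarrow>
     (\<forall>x. GDERIV \<psi> x :> d\<psi> x) \<and> continuous_on UNIV d\<psi> \<and>
     compact (closure {x. \<psi> x \<noteq> 0}) \<and> closure {x. \<psi> x \<noteq> 0} \<subseteq> \<Omega>"

text \<open>\<open>H1_with_gradient \<Omega> u g\<close>: \<open>u \<in> H\<^sup>1(\<Omega>)\<close>, and \<open>g\<close> is the weak gradient of \<open>u\<close>.\<close>

definition H1_with_gradient ::
    "(real ^ 'n) set \<Rightarrow> (real ^ 'n \<Rightarrow> real) \<Rightarrow> (real ^ 'n \<Rightarrow> real ^ 'n) \<Rightarrow> bool" where
  "H1_with_gradient \<Omega> u g \<longleftrightarrow>
     in_L2 (lebesgue_on \<Omega>) u \<and> in_L2 (lebesgue_on \<Omega>) g \<and>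
     (\<forall>\<psi> d\<psi>. C1c_with_gradient \<Omega> \<psi> d\<psi> \<longrightarrow>
        (\<integral>x. u x *\<^sub>R d\<psi> x \<partial>lebesgue_on \<Omega>) = - (\<integral>x. \<psi> x *\<^sub>R g x \<partial>lebesgue_on \<Omega>))"

text \<open>
  The Neumann Laplacian is the self-adjoint operator of the form \<open>\<integral>\<nabla>u \<bullet> \<nabla>v\<close> on all of \<open>H\<^sup>1(\<Omega>)\<close>;
  the Neumann boundary condition is encoded in the absence of a boundary condition on \<open>v\<close>.
\<close>

definition neumann_eigenfunction ::
    "(real ^ 'n) set \<Rightarrow> real \<Rightarrow> (real ^ 'n \<Rightarrow> real) \<Rightarrow> bool" where
  "neumann_eigenfunction \<Omega> \<mu> u \<longleftrightarrow>
     \<not> (AE x in lebesgue_on \<Omega>. u x = 0) \<and>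
     (\<exists>g. H1_with_gradient \<Omega> u g \<and>
        (\<forall>v h. H1_with_gradient \<Omega> v h \<longrightarrow>
           (\<integral>x. g x \<bullet> h x \<partial>lebesgue_on \<Omega>) = \<mu> * L2_inner (lebesgue_on \<Omega>) u v))"

definition L2_orthonormal_basis :: "'a measure \<Rightarrow> (nat \<Rightarrow> 'a \<Rightarrow> real) \<Rightarrow> bool" where
  "L2_orthonormal_basis M \<phi> \<longleftrightarrow>
     (\<forall>j. in_L2 M (\<phi> j)) \<and>
     (\<forall>i j. L2_inner M (\<phi> i) (\<phi> j) = (if i = j then 1 else 0)) \<and>
     (\<forall>u. in_L2 M u \<longrightarrow>
        (\<lambda>N. \<integral>x. (u x - (\<Sum>j<N. L2_inner M u (\<phi> j) * \<phi> j x))\<^sup>2 \<partial>M) \<longlonglongrightarrow> 0)"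

text \<open>
  Since the \<open>\<phi> j\<close> form a basis, \<open>\<lambda>\<close> lists all eigenvalues, repeated according to multiplicity.
\<close>

definition neumann_eigensystem ::
    "(real ^ 'n) set \<Rightarrow> (nat \<Rightarrow> real) \<Rightarrow> (nat \<Rightarrow> real ^ 'n \<Rightarrow> real) \<Rightarrow> bool" where
  "neumann_eigensystem \<Omega> lam \<phi> \<longleftrightarrow>
     lam 0 = 0 \<and> 0 < lam 1 \<and> incseq lam \<and>
     (\<forall>j. neumann_eigenfunction \<Omega> (lam j) (\<phi> j)) \<and>
     L2_orthonormal_basis (lebesgue_on \<Omega>) \<phi>"

subsection \<open>The spectral fractional Laplacian and its quotient\<close>

definition fractional_form ::
    "(real ^ 'n) set \<Rightarrow> (nat \<Rightarrow> real) \<Rightarrow> (nat \<Rightarrow> real ^ 'n \<Rightarrow> real) \<Rightarrow> real \<Rightarrow>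
     (real ^ 'n \<Rightarrow> real) \<Rightarrow> real" where
  "fractional_form \<Omega> lam \<phi> s u =
     (\<Sum>j. lam (Suc j) powr s * (L2_inner (lebesgue_on \<Omega>) u (\<phi> (Suc j)))\<^sup>2)"

definition in_Hs ::
    "(real ^ 'n) set \<Rightarrow> (nat \<Rightarrow> real) \<Rightarrow> (nat \<Rightarrow> real ^ 'n \<Rightarrow> real) \<Rightarrow> real \<Rightarrow>
     (real ^ 'n \<Rightarrow> real) \<Rightarrow> bool" where
  "in_Hs \<Omega> lam \<phi> s u \<longleftrightarrow>
     in_L2 (lebesgue_on \<Omega>) u \<and>
     summable (\<lambda>j. lam (Suc j) powr s * (L2_inner (lebesgue_on \<Omega>) u (\<phi> (Suc j)))\<^sup>2)"

definition quotient_functional ::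
    "(real ^ 'n) set \<Rightarrow> (nat \<Rightarrow> real) \<Rightarrow> (nat \<Rightarrow> real ^ 'n \<Rightarrow> real) \<Rightarrow> real \<Rightarrow> ennreal \<Rightarrow> real \<Rightarrow>
     (real ^ 'n \<Rightarrow> real) \<Rightarrow> ennreal" where
  "quotient_functional \<Omega> lam \<phi> s q \<epsilon> u =
     (ennreal (fractional_form \<Omega> lam \<phi> s u)
        + ennreal (\<epsilon> powr (2 * s)) * (Lq_norm (lebesgue_on \<Omega>) 2 u)\<^sup>2)
     / (Lq_norm (lebesgue_on \<Omega>) q u)\<^sup>2"

definition nonzero_Hs ::
    "(real ^ 'n) set \<Rightarrow> (nat \<Rightarrow> real) \<Rightarrow> (nat \<Rightarrow> real ^ 'n \<Rightarrow> real) \<Rightarrow> real \<Rightarrow>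
     (real ^ 'n \<Rightarrow> real) \<Rightarrow> bool" where
  "nonzero_Hs \<Omega> lam \<phi> s u \<longleftrightarrow> in_Hs \<Omega> lam \<phi> s u \<and> \<not> (AE x in lebesgue_on \<Omega>. u x = 0)"

definition global_minimizer ::
    "(real ^ 'n) set \<Rightarrow> (nat \<Rightarrow> real) \<Rightarrow> (nat \<Rightarrow> real ^ 'n \<Rightarrow> real) \<Rightarrow> real \<Rightarrow> ennreal \<Rightarrow> real \<Rightarrow>
     (real ^ 'n \<Rightarrow> real) \<Rightarrow> bool" where
  "global_minimizer \<Omega> lam \<phi> s q \<epsilon> v \<longleftrightarrow>
     nonzero_Hs \<Omega> lam \<phi> s v \<and>
     (\<forall>u. nonzero_Hs \<Omega> lam \<phi> s u \<longrightarrow>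
        quotient_functional \<Omega> lam \<phi> s q \<epsilon> v \<le> quotient_functional \<Omega> lam \<phi> s q \<epsilon> u)"

definition unique_global_minimizer ::
    "(real ^ 'n) set \<Rightarrow> (nat \<Rightarrow> real) \<Rightarrow> (nat \<Rightarrow> real ^ 'n \<Rightarrow> real) \<Rightarrow> real \<Rightarrow> ennreal \<Rightarrow> real \<Rightarrow>
     (real ^ 'n \<Rightarrow> real) \<Rightarrow> bool" where
  "unique_global_minimizer \<Omega> lam \<phi> s q \<epsilon> v \<longleftrightarrow>
     global_minimizer \<Omega> lam \<phi> s q \<epsilon> v \<and>
     (\<forall>w. global_minimizer \<Omega> lam \<phi> s q \<epsilon> w \<longrightarrow>
        (\<exists>c. c \<noteq> 0 \<and> (AE x in lebesgue_on \<Omega>. w x = c * v x)))"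

subsection \<open>Exponents\<close>

text \<open>Only meaningful for \<open>2 * s < n\<close>.\<close>

definition critical_exponent :: "nat \<Rightarrow> real \<Rightarrow> ennreal" where
  "critical_exponent n s = ennreal (2 * real n / (real n - 2 * s))"

definition admissible_exponents :: "nat \<Rightarrow> real \<Rightarrow> ennreal set" where
  "admissible_exponents n s =
     (if n \<ge> 2 \<or> s < 1/2 then {1..critical_exponent n s}
      else if s = 1/2 then {1..<\<infinity>}
      else {1..\<infinity>})"

definition exponent_range :: "nat \<Rightarrow> real \<Rightarrow> ennreal set" where
  "exponent_range n s =
     (if n = 1 \<and> s \<ge> 1/2 then {2<..<\<infinity>} else {2<..critical_exponent n s})"

end

theory Submission
  imports Defs "HOL-Probability.Probability_Measure"
begin

text \<open>
  Everything rests on the inequality \<open>\<parallel>u\<parallel>\<^sub>p\<^sup>2 - \<parallel>u\<parallel>\<^sub>2\<^sup>2 \<le> K \<langle>u\<rangle>\<close>, where \<open>\<langle>u\<rangle>\<close> is the fractional form. It gives the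
  first claim as soon as \<open>\<epsilon>\<^bsup>2s\<^esup> K < 1\<close>, and the second one by interpolation: for \<open>2 < q < p\<close> it improves to
  \<open>\<parallel>u\<parallel>\<^sub>q\<^sup>2 - \<parallel>u\<parallel>\<^sub>2\<^sup>2 \<le> \<theta> K \<langle>u\<rangle>\<close> with \<open>\<theta> \<rightarrow> 0\<close> as \<open>q \<rightarrow> 2\<close>. The third claim only needs that the \<open>L\<^sub>q\<close> norm is
  increasing in \<open>q\<close> on a probability space.

  To prove the inequality, split \<open>u = c + v\<close> with \<open>v\<close> of mean zero. A Taylor expansion of \<open>\<bar>1 + x\<bar>\<^sup>p\<close> gives
  \<open>\<parallel>c + v\<parallel>\<^sub>p\<^sup>2 \<le> c\<^sup>2 + K' \<parallel>v\<parallel>\<^sub>p\<^sup>2\<close>, so a Poincare-Sobolev inequality \<open>\<parallel>v\<parallel>\<^sub>p\<^sup>2 \<le> C \<langle>v\<rangle>\<close> is enough. For it, let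
  \<open>A\<^sub>a u\<close> be the average of \<open>u\<close> at scale \<open>1/a\<close> over a bump that points into a cone contained in \<open>\<Omega>\<close> and put
  \<open>D\<^sub>l = A\<^bsub>2^l\<^esub> u\<close>. Cutting the eigenfunction expansion at frequency \<open>4\<^sup>l\<close> yields
  \<open>\<bar>D\<^sub>l\<bar> \<le> B 2\<^bsup>l(n/2 - s)\<^esup> T\<close> pointwise and \<open>\<Sum>\<^sub>l 4\<^bsup>ls\<^esup> \<parallel>u - D\<^sub>l\<parallel>\<^sub>2\<^sup>2 \<le> C T\<^sup>2\<close>, where \<open>T\<close> is the norm of \<open>u\<close> in
  \<open>H\<^sup>s\<close>. If \<open>l\<close> is the first index with \<open>\<bar>u x\<bar> \<le> 2 B 2\<^bsup>l(n/2 - s)\<^esup> T\<close>, then \<open>\<bar>u x\<bar> \<le> 2 \<bar>u x - D\<^bsub>l-1\<^esub> x\<bar>\<close>, and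
  this bounds \<open>\<bar>u x\<bar>\<^sup>p\<close> for the critical exponent \<open>p\<close> by a sum that integrates to \<open>C T\<^sup>p\<close>.
\<close>

section \<open>Integral inequalities\<close>

text \<open>Only an eigensystem and a local graph condition are given, so the embedding is proved
  inside the domain, without extending functions across the boundary: averages over bumps that point
  inwards see only points of the domain, and their derivative in the scale is a divergence, hence
  controlled by the weak gradient. The condition 0 < s < 1 is what makes the cut at 4^l affordable
  on both sides: s > 0 sums the cost of the modes above the cut, s < 1 that of the gradients below
  it.

  Only real p with n/2 - n/p \<le> s enter the norm inequality. Each of them is the critical
  exponent of the possibly smaller order s' = n/2 - n/p, which treats subcritical exponents and the
  case n = 1, s \<ge> 1/2 at once.

  With e = \<epsilon>^(2s), the constant is not beaten by u exactly if e (|u|_p^2 - |u|_2^2) is at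
  most the fractional form. Hence the coefficient of |u|_2^2 must be exactly 1. The triangle
  inequality would spoil it; the Taylor expansion keeps it, because its linear term vanishes on
  functions of mean zero. Uniqueness comes from the strict inequality e K < 1, which forces the form
  of a minimizer to vanish.\<close>

lemma Hoelder_integral:
  fixes F G :: "'a \<Rightarrow> real"
  assumes F: "integrable M F" "\<And>x. 0 \<le> F x" and G: "integrable M G" "\<And>x. 0 \<le> G x"
    and \<mu>: "0 \<le> \<mu>" "\<mu> \<le> 1"
  shows "integrable M (\<lambda>x. F x powr (1 - \<mu>) * G x powr \<mu>)"
    and "(\<integral>x. F x powr (1 - \<mu>) * G x powr \<mu> \<partial>M) \<le> (\<integral>x. F x \<partial>M) powr (1 - \<mu>) * (\<integral>x. G x \<partial>M) powr \<mu>"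
proof -
  have [measurable]: "F \<in> borel_measurable M" "G \<in> borel_measurable M" using F G by auto
  have young: "a powr (1 - \<mu>) * b powr \<mu> \<le> (1 - \<mu>) * a + \<mu> * b" if "0 \<le> a" "0 \<le> b" for a b :: real
  proof (cases "a = 0 \<or> b = 0")
    case True
    then show ?thesis using that \<mu> by auto
  next
    case False
    then show ?thesis using that \<mu> by (intro Youngs_inequality_0) auto
  qed
  show int: "integrable M (\<lambda>x. F x powr (1 - \<mu>) * G x powr \<mu>)"
  proof (rule Bochner_Integration.integrable_bound)
    show "integrable M (\<lambda>x. (1 - \<mu>) * F x + \<mu> * G x)" using F G by simp
    show "AE x in M. norm (F x powr (1 - \<mu>) * G x powr \<mu>) \<le> norm ((1 - \<mu>) * F x + \<mu> * G x)"
      using young[OF F(2) G(2)] by (intro AE_I2) (simp add: abs_mult order_trans[OF _ abs_ge_self])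
  qed measurable
  define A where "A = (\<integral>x. F x \<partial>M)"
  define B where "B = (\<integral>x. G x \<partial>M)"
  have AB: "0 \<le> A" "0 \<le> B" unfolding A_def B_def using F G by (auto intro!: Bochner_Integration.integral_nonneg)
  have "(\<integral>x. F x powr (1 - \<mu>) * G x powr \<mu> \<partial>M) \<le> A powr (1 - \<mu>) * B powr \<mu>"
  proof (cases "A = 0 \<or> B = 0")
    case True
    then have "(AE x in M. F x = 0) \<or> (AE x in M. G x = 0)"
      unfolding A_def B_def using F G integral_nonneg_eq_0_iff_AE[of M F] integral_nonneg_eq_0_iff_AE[of M G] by auto
    \<comment> \<open>The convention \<open>0 powr 0 = 0\<close> makes the product vanish also for
      \<mu> = 0 and \<mu> = 1.\<close>
    then have "AE x in M. F x powr (1 - \<mu>) * G x powr \<mu> = 0" by (auto elim!: eventually_mono)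
    then have "(\<integral>x. F x powr (1 - \<mu>) * G x powr \<mu> \<partial>M) = 0" by (rule integral_eq_zero_AE)
    then show ?thesis by simp
  next
    case False
    then have pos: "0 < A" "0 < B" using AB by auto
    \<comment> \<open>Young's inequality is applied to F / A and G / B, which have integral 1, so
      that the convex combination integrates to exactly 1.\<close>
    have pt: "F x powr (1 - \<mu>) * G x powr \<mu> \<le> A powr (1 - \<mu>) * B powr \<mu> * ((1 - \<mu>) * (F x / A) + \<mu> * (G x / B))" for x
    proof -
      have "F x powr (1 - \<mu>) * G x powr \<mu> = A powr (1 - \<mu>) * B powr \<mu> * ((F x / A) powr (1 - \<mu>) * (G x / B) powr \<mu>)"
        using pos F(2)[of x] G(2)[of x] by (simp add: powr_divide)
      also have "\<dots> \<le> A powr (1 - \<mu>) * B powr \<mu> * ((1 - \<mu>) * (F x / A) + \<mu> * (G x / B))"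
        using pos F(2)[of x] G(2)[of x] by (intro mult_left_mono young) auto
      finally show ?thesis .
    qed
    have "(\<integral>x. F x powr (1 - \<mu>) * G x powr \<mu> \<partial>M) \<le> (\<integral>x. A powr (1 - \<mu>) * B powr \<mu> * ((1 - \<mu>) * (F x / A) + \<mu> * (G x / B)) \<partial>M)"
      using F G by (intro Bochner_Integration.integral_mono int pt) auto
    also have "\<dots> = A powr (1 - \<mu>) * B powr \<mu> * ((1 - \<mu>) * (A / A) + \<mu> * (B / B))"
      using F G by (simp add: A_def B_def)
    also have "\<dots> = A powr (1 - \<mu>) * B powr \<mu>" using pos by simp
    finally show ?thesis .
  qed
  then show "(\<integral>x. F x powr (1 - \<mu>) * G x powr \<mu> \<partial>M) \<le> (\<integral>x. F x \<partial>M) powr (1 - \<mu>) * (\<integral>x. G x \<partial>M) powr \<mu>"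
    by (simp add: A_def B_def)
qed

text \<open>Hoelder against the constant 1, whose integral over a probability space is 1; the
  comparison therefore holds with constant 1.\<close>

lemma (in prob_space) powr_integral_mono:
  fixes u :: "'a \<Rightarrow> real" and p q :: real
  assumes [measurable]: "u \<in> borel_measurable M" and i: "integrable M (\<lambda>x. \<bar>u x\<bar> powr p)" and q: "0 < q" "q \<le> p"
  shows "integrable M (\<lambda>x. \<bar>u x\<bar> powr q)"
    and "(\<integral>x. \<bar>u x\<bar> powr q \<partial>M) powr (1 / q) \<le> (\<integral>x. \<bar>u x\<bar> powr p \<partial>M) powr (1 / p)"
proof -
  have eq: "1 powr (1 - q / p) * (\<bar>u x\<bar> powr p) powr (q / p) = \<bar>u x\<bar> powr q" for x
    using q by (simp add: powr_powr)
  have \<mu>: "0 \<le> q / p" "q / p \<le> 1" using q by auto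
  have one: "integrable M (\<lambda>x. 1 :: real)" by simp
  note H = Hoelder_integral[OF one _ i _ \<mu>, simplified eq]
  show "integrable M (\<lambda>x. \<bar>u x\<bar> powr q)" using H(1) by simp
  have "(\<integral>x. \<bar>u x\<bar> powr q \<partial>M) \<le> (\<integral>x. \<bar>u x\<bar> powr p \<partial>M) powr (q / p)" using H(2) by (simp add: prob_space)
  then have "(\<integral>x. \<bar>u x\<bar> powr q \<partial>M) powr (1 / q) \<le> ((\<integral>x. \<bar>u x\<bar> powr p \<partial>M) powr (q / p)) powr (1 / q)"
    using q by (intro powr_mono2) (auto intro!: Bochner_Integration.integral_nonneg)
  then show "(\<integral>x. \<bar>u x\<bar> powr q \<partial>M) powr (1 / q) \<le> (\<integral>x. \<bar>u x\<bar> powr p \<partial>M) powr (1 / p)"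
    using q by (simp add: powr_powr)
qed

text \<open>Here 1/q = (1 - \<theta>)/2 + \<theta>/p. Hoelder gives the geometric mean of the two
  squared norms, and Young's inequality turns it into the arithmetic one. The weights add up to 1,
  so the excess over the squared L_2 norm is multiplied by \<theta>, which tends to 0 as q tends to
  2.\<close>

lemma interpolation_square:
  fixes u :: "'a \<Rightarrow> real" and p q :: real
  assumes [measurable]: "u \<in> borel_measurable M" and p: "2 < q" "q < p"
    and i2: "integrable M (\<lambda>x. (u x)\<^sup>2)" and ip: "integrable M (\<lambda>x. \<bar>u x\<bar> powr p)"
  defines "\<theta> \<equiv> p * (q - 2) / (q * (p - 2))"
  shows "integrable M (\<lambda>x. \<bar>u x\<bar> powr q)"
    and "(\<integral>x. \<bar>u x\<bar> powr q \<partial>M) powr (2 / q) \<le> (1 - \<theta>) * (\<integral>x. (u x)\<^sup>2 \<partial>M) + \<theta> * (\<integral>x. \<bar>u x\<bar> powr p \<partial>M) powr (2 / p)"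
proof -
  define \<mu> where "\<mu> = (q - 2) / (p - 2)"
  have \<mu>: "0 \<le> \<mu>" "\<mu> \<le> 1" using p by (auto simp: \<mu>_def)
  have q\<mu>: "2 * (1 - \<mu>) + p * \<mu> = q"
  proof -
    have "\<mu> * (p - 2) = q - 2" using p by (simp add: \<mu>_def)
    then show ?thesis by (simp add: algebra_simps)
  qed
  have \<theta>: "\<theta> = p * \<mu> / q" by (simp add: \<theta>_def \<mu>_def)
  have \<theta>1: "1 - \<theta> = 2 * (1 - \<mu>) / q" using p q\<mu> by (simp add: \<theta> field_simps)
  have \<theta>01: "0 \<le> \<theta>" "0 \<le> 1 - \<theta>" using p \<mu> by (simp_all add: \<theta> \<theta>1[unfolded \<theta>])
  have eq: "((u x)\<^sup>2) powr (1 - \<mu>) * (\<bar>u x\<bar> powr p) powr \<mu> = \<bar>u x\<bar> powr q" for x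
  proof (cases "u x = 0")
    case False
    then have "(u x)\<^sup>2 = \<bar>u x\<bar> powr 2" by (simp add: powr_numeral)
    then show ?thesis by (simp only: powr_powr powr_add[symmetric] q\<mu>)
  qed simp
  note H = Hoelder_integral[OF i2 _ ip _ \<mu>, simplified eq]
  show "integrable M (\<lambda>x. \<bar>u x\<bar> powr q)" using H(1) by simp
  define A where "A = (\<integral>x. (u x)\<^sup>2 \<partial>M)"
  define B where "B = (\<integral>x. \<bar>u x\<bar> powr p \<partial>M)"
  have AB: "0 \<le> A" "0 \<le> B" unfolding A_def B_def by (auto intro!: Bochner_Integration.integral_nonneg)
  have "(\<integral>x. \<bar>u x\<bar> powr q \<partial>M) powr (2 / q) \<le> (A powr (1 - \<mu>) * B powr \<mu>) powr (2 / q)"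
    using H(2) p by (intro powr_mono2) (auto simp: A_def B_def intro!: Bochner_Integration.integral_nonneg)
  also have "\<dots> = A powr (1 - \<theta>) * (B powr (2 / p)) powr \<theta>"
    using AB p by (simp add: powr_mult powr_powr \<theta>1) (simp add: \<theta> mult.commute)
  also have "\<dots> \<le> (1 - \<theta>) * A + \<theta> * B powr (2 / p)"
  proof (cases "A = 0 \<or> B = 0")
    case True
    then show ?thesis using AB \<theta>01 by auto
  next
    case False
    then show ?thesis using AB \<theta>01 by (intro Youngs_inequality_0) auto
  qed
  finally show "(\<integral>x. \<bar>u x\<bar> powr q \<partial>M) powr (2 / q) \<le> (1 - \<theta>) * (\<integral>x. (u x)\<^sup>2 \<partial>M) + \<theta> * (\<integral>x. \<bar>u x\<bar> powr p \<partial>M) powr (2 / p)"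
    by (simp add: A_def B_def)
qed

section \<open>Perturbation of a constant in L_p\<close>

text \<open>The linear term stays explicit because it will be integrated against a function of mean
  zero; the remainder is of order 2 near 0 and of order p far away.\<close>

lemma powr_one_plus_le:
  fixes p :: real
  assumes p: "2 \<le> p"
  obtains K where "1 \<le> K" "\<And>x::real. \<bar>1 + x\<bar> powr p \<le> 1 + p * x + K * (x\<^sup>2 + \<bar>x\<bar> powr p)"
proof -
  \<comment> \<open>\<open>K1\<close> bounds half the second derivative of (1 + x)^p for |x| \<le>
    1/2. For larger |x|, \<open>3 powr p\<close> comes from |1 + x| \<le> 3 |x|, and
    \<open>2 * p\<close> compensates a negative linear term through |x| \<le> 2 x^2.\<close>
  define K1 where "K1 = p * (p - 1) * 2 powr (p - 2) / 2"
  define K where "K = K1 + 3 powr p + 2 * p + 1"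
  have K1: "0 \<le> K1" using p by (simp add: K1_def)
  show thesis
  proof (rule that[of K])
    show "1 \<le> K" using p K1 by (simp add: K_def)
    fix x :: real
    show "\<bar>1 + x\<bar> powr p \<le> 1 + p * x + K * (x\<^sup>2 + \<bar>x\<bar> powr p)"
    proof (cases "\<bar>x\<bar> \<le> 1 / 2")
      case small: True
      have "(1 + x) powr p \<le> 1 + p * x + K1 * x\<^sup>2"
      proof (cases "x = 0")
        case False
        define D where "D = (\<lambda>m::nat. if m = 0 then (\<lambda>x::real. (1 + x) powr p) else if m = 1 then (\<lambda>x. p * (1 + x) powr (p - 1)) else (\<lambda>x. p * (p - 1) * (1 + x) powr (p - 2)))"
        have "\<exists>t. (if x < 0 then x < t \<and> t < 0 else 0 < t \<and> t < x) \<and>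
          (1 + x) powr p = (\<Sum>m<2. D m 0 / fact m * (x - 0) ^ m) + D 2 t / fact 2 * (x - 0) ^ 2"
        proof (rule Taylor[where a="-1/2" and b="1/2"])
          show "\<forall>m t. m < 2 \<and> - 1 / 2 \<le> t \<and> t \<le> 1 / 2 \<longrightarrow> (D m has_real_derivative D (Suc m) t) (at t)"
          proof (intro allI impI)
            fix m :: nat and t :: real assume a: "m < 2 \<and> - 1 / 2 \<le> t \<and> t \<le> 1 / 2"
            then have t: "0 < 1 + t" by linarith
            have "m = 0 \<or> m = 1" using a by auto
            then show "(D m has_real_derivative D (Suc m) t) (at t)"
              using t by (auto simp: D_def intro!: derivative_eq_intros)
          qed
        qed (use small False in \<open>auto simp: D_def\<close>)
        then obtain t where t: "if x < 0 then x < t \<and> t < 0 else 0 < t \<and> t < x"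
          and eq: "(1 + x) powr p = 1 + p * x + p * (p - 1) * (1 + t) powr (p - 2) / 2 * x\<^sup>2"
          by (auto simp: D_def numeral_2_eq_2)
        have "0 \<le> 1 + t" "1 + t \<le> 2" using t small by (auto split: if_splits)
        then have "(1 + t) powr (p - 2) \<le> 2 powr (p - 2)" using p by (intro powr_mono2) auto
        then have "p * (p - 1) * (1 + t) powr (p - 2) / 2 * x\<^sup>2 \<le> K1 * x\<^sup>2"
          unfolding K1_def using p by (intro mult_right_mono divide_right_mono mult_left_mono) auto
        then show ?thesis using eq by simp
      qed simp
      also have "K1 * x\<^sup>2 \<le> K * (x\<^sup>2 + \<bar>x\<bar> powr p)"
        using p K1 by (intro mult_mono) (auto simp: K_def)
      finally show ?thesis using small by simp
    next
      case False
      then have x: "1 \<le> 2 * \<bar>x\<bar>" by simp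
      have "\<bar>1 + x\<bar> \<le> 3 * \<bar>x\<bar>" using x by linarith
      then have "\<bar>1 + x\<bar> powr p \<le> (3 * \<bar>x\<bar>) powr p" using p by (intro powr_mono2) auto
      also have "\<dots> = 3 powr p * \<bar>x\<bar> powr p" by (simp add: powr_mult)
      finally have 1: "\<bar>1 + x\<bar> powr p \<le> 3 powr p * \<bar>x\<bar> powr p" .
      have "1 * \<bar>x\<bar> \<le> 2 * \<bar>x\<bar> * \<bar>x\<bar>" using x by (intro mult_right_mono) auto
      then have "\<bar>x\<bar> \<le> 2 * x\<^sup>2" by (simp add: power2_eq_square mult.assoc)
      then have "p * \<bar>x\<bar> \<le> p * (2 * x\<^sup>2)" using p by (intro mult_left_mono) auto
      moreover have "- (p * x) \<le> p * \<bar>x\<bar>" using p mult_left_mono[of "- x" "\<bar>x\<bar>" p] by simp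
      ultimately have 2: "0 \<le> 1 + p * x + 2 * p * x\<^sup>2" by simp
      have "3 powr p * \<bar>x\<bar> powr p + 2 * p * x\<^sup>2 \<le> K * \<bar>x\<bar> powr p + K * x\<^sup>2"
        using p K1 by (intro add_mono mult_right_mono) (auto simp: K_def)
      then show ?thesis using 1 2 by (simp add: distrib_left)
    qed
  qed
qed

text \<open>Both parts factor t^r as t^(r - 1) t and use monotonicity of the first factor. They
  absorb error terms into a single r-th power, so that taking the root afterwards leaves the leading
  coefficient 1 untouched.\<close>

lemma powr_add_superadditive:
  fixes x y r :: real
  assumes "0 \<le> x" "0 \<le> y" "1 \<le> r"
  shows "x powr r + y powr r \<le> (x + y) powr r" "x powr r + x powr (r - 1) * y \<le> (x + y) powr r"
proof -
  have split: "t powr r = t powr (r - 1) * t" if "0 \<le> t" for t :: real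
    using that by (cases "t = 0") (auto simp: powr_diff)
  have "x powr r + y powr r = x powr (r - 1) * x + y powr (r - 1) * y" using assms split by simp
  also have "\<dots> \<le> (x + y) powr (r - 1) * x + (x + y) powr (r - 1) * y"
    using assms by (intro add_mono mult_right_mono powr_mono2) auto
  also have "\<dots> = (x + y) powr r" using split[of "x + y"] assms by (simp add: distrib_left)
  finally show "x powr r + y powr r \<le> (x + y) powr r" .
  have "x powr r + x powr (r - 1) * y = x powr (r - 1) * (x + y)" using assms split by (simp add: distrib_left)
  also have "\<dots> \<le> (x + y) powr (r - 1) * (x + y)"
    using assms by (intro mult_right_mono powr_mono2) auto
  also have "\<dots> = (x + y) powr r" using split[of "x + y"] assms by simp
  finally show "x powr r + x powr (r - 1) * y \<le> (x + y) powr r" .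
qed

text \<open>After scaling the expansion of |1 + x|^p by c, the linear term integrates to 0 and the
  quadratic one is bounded by the L_p norm, because the measure is a probability. What remains is at
  most the power p/2 of c^2 plus a multiple of the squared L_p norm of v.\<close>

lemma (in prob_space) mean_zero_perturbation:
  fixes p :: real
  assumes p: "2 \<le> p"
  obtains K where "0 \<le> K" "\<And>(c::real) v. v \<in> borel_measurable M \<Longrightarrow> integrable M (\<lambda>x. \<bar>v x\<bar> powr p) \<Longrightarrow> (\<integral>x. v x \<partial>M) = 0 \<Longrightarrow>
     integrable M (\<lambda>x. \<bar>c + v x\<bar> powr p) \<and>
     (\<integral>x. \<bar>c + v x\<bar> powr p \<partial>M) powr (2 / p) \<le> c\<^sup>2 + K * (\<integral>x. \<bar>v x\<bar> powr p \<partial>M) powr (2 / p)"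
proof -
  obtain K where K: "1 \<le> K" "\<And>x::real. \<bar>1 + x\<bar> powr p \<le> 1 + p * x + K * (x\<^sup>2 + \<bar>x\<bar> powr p)"
    by (rule powr_one_plus_le[OF p]) (rule that)
  have K2: "1 \<le> 2 * K" using K by simp
  have pos: "integrable M (\<lambda>x. \<bar>c + v x\<bar> powr p) \<and>
     (\<integral>x. \<bar>c + v x\<bar> powr p \<partial>M) powr (2 / p) \<le> c\<^sup>2 + 2 * K * (\<integral>x. \<bar>v x\<bar> powr p \<partial>M) powr (2 / p)"
    if v[measurable]: "v \<in> borel_measurable M" and vp: "integrable M (\<lambda>x. \<bar>v x\<bar> powr p)" and v0: "(\<integral>x. v x \<partial>M) = 0"
      and c: "0 \<le> c" for c :: real and v
  proof (cases "c = 0")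
    case True
    \<comment> \<open>For c = 0 there is nothing to scale by; \<open>K2\<close> alone is
      enough.\<close>
    have "1 * (\<integral>x. \<bar>v x\<bar> powr p \<partial>M) powr (2 / p) \<le> 2 * K * (\<integral>x. \<bar>v x\<bar> powr p \<partial>M) powr (2 / p)"
      using K2 by (intro mult_right_mono) auto
    then show ?thesis using True vp by simp
  next
    case False
    then have c: "0 < c" using c by simp
    have v1: "integrable M v"
    proof -
      have "integrable M (\<lambda>x. \<bar>v x\<bar> powr 1)" using p by (intro powr_integral_mono(1)[OF v vp]) auto
      then have "integrable M (\<lambda>x. \<bar>v x\<bar>)" by simp
      then show ?thesis by (subst (asm) integrable_abs_iff) auto
    qed
    have abs2: "\<bar>t\<bar> powr 2 = t\<^sup>2" for t :: real by (cases "t = 0") (auto simp: powr_numeral)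
    have v2: "integrable M (\<lambda>x. (v x)\<^sup>2)" and v2p: "(\<integral>x. (v x)\<^sup>2 \<partial>M) \<le> (\<integral>x. \<bar>v x\<bar> powr p \<partial>M) powr (2 / p)"
    proof -
      show "integrable M (\<lambda>x. (v x)\<^sup>2)" using powr_integral_mono(1)[OF v vp, of 2] p by (simp add: abs2)
      have "(\<integral>x. (v x)\<^sup>2 \<partial>M) powr (1 / 2) \<le> (\<integral>x. \<bar>v x\<bar> powr p \<partial>M) powr (1 / p)"
        using powr_integral_mono(2)[OF v vp, of 2] p by (simp add: abs2)
      then have "((\<integral>x. (v x)\<^sup>2 \<partial>M) powr (1 / 2)) powr 2 \<le> ((\<integral>x. \<bar>v x\<bar> powr p \<partial>M) powr (1 / p)) powr 2"
        by (intro powr_mono2) auto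
      then show "(\<integral>x. (v x)\<^sup>2 \<partial>M) \<le> (\<integral>x. \<bar>v x\<bar> powr p \<partial>M) powr (2 / p)"
        by (simp add: powr_powr Bochner_Integration.integral_nonneg)
    qed
    have pt: "\<bar>c + v x\<bar> powr p \<le> c powr p + p * c powr (p - 1) * v x + K * (c powr (p - 2) * (v x)\<^sup>2 + \<bar>v x\<bar> powr p)" for x
    proof -
      have "c + v x = c * (1 + v x / c)" using c by (simp add: field_simps)
      then have "\<bar>c + v x\<bar> = c * \<bar>1 + v x / c\<bar>" using c by (simp only: abs_mult abs_of_pos)
      then have "\<bar>c + v x\<bar> powr p = c powr p * \<bar>1 + v x / c\<bar> powr p" using c by (simp add: powr_mult)
      also have "\<dots> \<le> c powr p * (1 + p * (v x / c) + K * ((v x / c)\<^sup>2 + \<bar>v x / c\<bar> powr p))"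
        by (intro mult_left_mono K) auto
      also have "\<dots> = c powr p + p * c powr (p - 1) * v x + K * (c powr (p - 2) * (v x)\<^sup>2 + \<bar>v x\<bar> powr p)"
      proof -
        have e: "c powr p * (p * (v x / c)) = p * c powr (p - 1) * v x" "c powr p * (v x / c)\<^sup>2 = c powr (p - 2) * (v x)\<^sup>2"
          "c powr p * \<bar>v x / c\<bar> powr p = \<bar>v x\<bar> powr p"
          using c by (simp_all add: powr_diff powr_numeral power_divide abs_div_pos[symmetric] powr_divide)
        have "c powr p * (1 + p * (v x / c) + K * (Q + Z)) = c powr p + c powr p * (p * (v x / c)) + K * (c powr p * Q + c powr p * Z)" for Q Z
          by (simp add: algebra_simps)
        then show ?thesis by (simp only: e)
      qed
      finally show ?thesis .
    qed
    have Rint: "integrable M (\<lambda>x. c powr p + p * c powr (p - 1) * v x + K * (c powr (p - 2) * (v x)\<^sup>2 + \<bar>v x\<bar> powr p))"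
      using v1 v2 vp by simp
    have cint: "integrable M (\<lambda>x. \<bar>c + v x\<bar> powr p)"
    proof (rule Bochner_Integration.integrable_bound[OF Rint])
      show "AE x in M. norm (\<bar>c + v x\<bar> powr p) \<le> norm (c powr p + p * c powr (p - 1) * v x + K * (c powr (p - 2) * (v x)\<^sup>2 + \<bar>v x\<bar> powr p))"
        using pt by (intro AE_I2) (metis abs_ge_self order_trans powr_ge_zero real_norm_def abs_of_nonneg)
    qed measurable
    define b where "b = (\<integral>x. \<bar>v x\<bar> powr p \<partial>M) powr (2 / p)"
    have b: "0 \<le> b" by (simp add: b_def)
    have bp: "(\<integral>x. \<bar>v x\<bar> powr p \<partial>M) = b powr (p / 2)"
      using p by (simp add: b_def powr_powr Bochner_Integration.integral_nonneg)
    have "(\<integral>x. \<bar>c + v x\<bar> powr p \<partial>M) \<le> (\<integral>x. c powr p + p * c powr (p - 1) * v x + K * (c powr (p - 2) * (v x)\<^sup>2 + \<bar>v x\<bar> powr p) \<partial>M)"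
      by (intro Bochner_Integration.integral_mono cint Rint pt)
    also have "\<dots> = c powr p + K * (c powr (p - 2) * (\<integral>x. (v x)\<^sup>2 \<partial>M) + b powr (p / 2))"
      using v1 v2 vp by (simp add: v0 prob_space bp)
    also have "\<dots> \<le> c powr p + K * (c powr (p - 2) * b + b powr (p / 2))"
      using v2p K by (intro add_left_mono mult_left_mono add_right_mono) (auto simp: b_def)
    also have "\<dots> \<le> (c\<^sup>2 + 2 * K * b) powr (p / 2)"
    proof -
      define r where "r = p / 2"
      have r: "1 \<le> r" using p by (simp add: r_def)
      have cr: "c powr p = (c\<^sup>2) powr r" "c powr (p - 2) = (c\<^sup>2) powr (r - 1)"
      proof -
        have c2: "c\<^sup>2 = c powr 2" using c by (simp add: powr_numeral)
        show "c powr p = (c\<^sup>2) powr r" "c powr (p - 2) = (c\<^sup>2) powr (r - 1)"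
          unfolding c2 powr_powr by (simp_all add: r_def algebra_simps)
      qed
      \<comment> \<open>This uses K \<ge> 1 and r \<ge> 1. The mixed term and the pure term are then
        absorbed one after the other, each at the price of one \<open>K * b\<close>; this is where
        the final factor 2 K comes from.\<close>
      have "K * b powr r \<le> (K * b) powr r"
      proof -
        have "K powr 1 \<le> K powr r" using K r by (intro powr_mono) auto
        then show ?thesis using K b by (simp add: powr_mult mult_right_mono)
      qed
      then have "c powr p + K * (c powr (p - 2) * b + b powr r) \<le> ((c\<^sup>2) powr r + (c\<^sup>2) powr (r - 1) * (K * b)) + (K * b) powr r"
        by (simp add: cr algebra_simps)
      also have "\<dots> \<le> (c\<^sup>2 + K * b) powr r + (K * b) powr r"
        using K b r by (intro add_right_mono powr_add_superadditive) auto
      also have "\<dots> \<le> (c\<^sup>2 + K * b + K * b) powr r"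
        using K b r by (intro powr_add_superadditive) auto
      finally show ?thesis by (simp add: r_def algebra_simps)
    qed
    finally have "(\<integral>x. \<bar>c + v x\<bar> powr p \<partial>M) powr (2 / p) \<le> ((c\<^sup>2 + 2 * K * b) powr (p / 2)) powr (2 / p)"
      using p by (intro powr_mono2) (auto intro!: Bochner_Integration.integral_nonneg)
    also have "\<dots> = c\<^sup>2 + 2 * K * b" using p K b by (simp add: powr_powr)
    finally show ?thesis using cint by (simp add: b_def)
  qed
  show thesis
  proof (rule that[of "2 * K"])
    fix c :: real and v assume v: "v \<in> borel_measurable M" "integrable M (\<lambda>x. \<bar>v x\<bar> powr p)" "(\<integral>x. v x \<partial>M) = 0"
    show "integrable M (\<lambda>x. \<bar>c + v x\<bar> powr p) \<and>
     (\<integral>x. \<bar>c + v x\<bar> powr p \<partial>M) powr (2 / p) \<le> c\<^sup>2 + 2 * K * (\<integral>x. \<bar>v x\<bar> powr p \<partial>M) powr (2 / p)"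
    proof (cases "0 \<le> c")
      case True
      then show ?thesis by (intro pos v)
    next
      case False
      \<comment> \<open>For negative c the sign of the whole function is flipped; the mean of v
        stays 0.\<close>
      have "\<bar>- c + - v x\<bar> = \<bar>c + v x\<bar>" for x using abs_minus_cancel[of "c + v x"] by simp
      then show ?thesis using pos[of "\<lambda>x. - v x" "- c"] v False by simp
    qed
  qed (use K in auto)
qed

section \<open>Averaging operators\<close>

text \<open>\<open>S\<close> plays the role of a ball of directions: for x in a suitable patch the
  points x + z / a with z in \<open>S\<close> and a \<ge> 1 lie in the domain. \<open>K\<close> is
  the height of the bump and \<open>R\<close> bounds the distance of its support from the
  origin.\<close>

locale averaging_kernel =
  fixes \<rho> :: "real ^ 'n \<Rightarrow> real" and d\<rho> :: "real ^ 'n \<Rightarrow> real ^ 'n"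
    and S :: "(real ^ 'n) set" and R K :: real
  assumes gderiv: "GDERIV \<rho> z :> d\<rho> z"
    and cont_d: "continuous_on UNIV d\<rho>"
    and nonneg: "0 \<le> \<rho> z"
    and le_K: "\<rho> z \<le> K"
    and compact_S: "compact S"
    and supp: "\<rho> z \<noteq> 0 \<Longrightarrow> z \<in> S"
    and S_R: "z \<in> S \<Longrightarrow> norm z \<le> R"
    and mass: "(\<integral>\<^sup>+z. ennreal (\<rho> z) \<partial>lborel) = 1"
begin

lemma cont: "continuous_on UNIV \<rho>"
  by (meson gderiv continuous_at_imp_continuous_on has_derivative_continuous gderiv_def)

lemma K_nonneg: "0 \<le> K"
  using nonneg[of 0] le_K[of 0] by simp

lemma R_nonneg: "0 \<le> R"
proof -
  have "\<exists>z. \<rho> z \<noteq> 0"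
  proof (rule ccontr)
    assume "\<nexists>z. \<rho> z \<noteq> 0"
    then have "(\<integral>\<^sup>+z. ennreal (\<rho> z) \<partial>lborel) = 0" by simp
    with mass show False by simp
  qed
  then show ?thesis using supp S_R norm_ge_zero order_trans by blast
qed

definition ker :: "real \<Rightarrow> real ^ 'n \<Rightarrow> real" where
  "ker a w = a ^ CARD('n) * \<rho> (a *\<^sub>R w)"

lemma meas_rho[measurable]: "\<rho> \<in> borel_measurable borel"
  by (rule borel_measurable_continuous_onI[OF cont])

lemma meas_drho[measurable]: "d\<rho> \<in> borel_measurable borel"
  by (rule borel_measurable_continuous_onI[OF cont_d])

lemma meas_ker[measurable]:
  assumes [measurable]: "f \<in> borel_measurable M" "g \<in> borel_measurable M"
  shows "(\<lambda>x. ker (f x) (g x)) \<in> borel_measurable M"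
  unfolding ker_def by measurable

lemma ker_nonneg: "0 \<le> a \<Longrightarrow> 0 \<le> ker a w"
  by (simp add: ker_def nonneg)

lemma ker_le: "0 \<le> a \<Longrightarrow> ker a w \<le> K * a ^ CARD('n)"
  using mult_right_mono[OF le_K, of "a ^ CARD('n)" "a *\<^sub>R w"] by (simp add: ker_def mult.commute)

lemma ker_supp: "0 < a \<Longrightarrow> ker a w \<noteq> 0 \<Longrightarrow> norm w \<le> R / a"
  using supp[of "a *\<^sub>R w"] S_R[of "a *\<^sub>R w"] by (auto simp: ker_def field_simps)

lemma nn_integral_ker:
  assumes "0 < a"
  shows "(\<integral>\<^sup>+y. ennreal (ker a (y - x)) \<partial>lborel) = 1"
proof -
  have "(\<integral>\<^sup>+z. ennreal (\<rho> z) \<partial>lborel)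
      = (\<integral>\<^sup>+z. ennreal (\<rho> z) \<partial>density (distr lborel borel (\<lambda>y. - a *\<^sub>R x + a *\<^sub>R y)) (\<lambda>_. ennreal (\<bar>a\<bar> ^ CARD('n))))"
    using lborel_affine[of a "- a *\<^sub>R x"] assms by simp
  also have "\<dots> = (\<integral>\<^sup>+y. ennreal (\<bar>a\<bar> ^ CARD('n)) * ennreal (\<rho> (- a *\<^sub>R x + a *\<^sub>R y)) \<partial>lborel)"
    by (subst nn_integral_density) (auto simp: nn_integral_distr)
  also have "\<dots> = (\<integral>\<^sup>+y. ennreal (ker a (y - x)) \<partial>lborel)"
    using assms by (auto simp: ker_def ennreal_mult nonneg algebra_simps intro!: nn_integral_cong)
  finally show ?thesis using mass by simp
qed

text \<open>The integration variable is now the centre x, not the point y. The previous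
  normalisation makes each average a probability mean; this one, through Fubini, makes averaging a
  contraction of L_1 and L_2.\<close>

lemma nn_integral_ker':
  assumes "0 < a"
  shows "(\<integral>\<^sup>+x. ennreal (ker a (y - x)) \<partial>lborel) = 1"
proof -
  have "(\<integral>\<^sup>+z. ennreal (\<rho> z) \<partial>lborel)
      = (\<integral>\<^sup>+z. ennreal (\<rho> z) \<partial>density (distr lborel borel (\<lambda>x. a *\<^sub>R y + (-a) *\<^sub>R x)) (\<lambda>_. ennreal (\<bar>-a\<bar> ^ CARD('n))))"
    using lborel_affine[of "-a" "a *\<^sub>R y"] assms by simp
  also have "\<dots> = (\<integral>\<^sup>+x. ennreal (\<bar>-a\<bar> ^ CARD('n)) * ennreal (\<rho> (a *\<^sub>R y + (-a) *\<^sub>R x)) \<partial>lborel)"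
    by (subst nn_integral_density) (auto simp: nn_integral_distr)
  also have "\<dots> = (\<integral>\<^sup>+x. ennreal (ker a (y - x)) \<partial>lborel)"
    using assms by (auto simp: ker_def ennreal_mult nonneg algebra_simps intro!: nn_integral_cong)
  finally show ?thesis using mass by simp
qed

text \<open>Averages of nonnegative functions take values in \<open>ennreal\<close>, so the norm
  estimates carry no integrability conditions; the real averages are dominated by these.\<close>

definition navg :: "real \<Rightarrow> (real ^ 'n \<Rightarrow> ennreal) \<Rightarrow> real ^ 'n \<Rightarrow> ennreal" where
  "navg a h x = (\<integral>\<^sup>+y. ennreal (ker a (y - x)) * h y \<partial>lborel)"

lemma meas_navg[measurable]:
  assumes [measurable]: "h \<in> borel_measurable borel" "f \<in> borel_measurable M" "g \<in> borel_measurable M"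
  shows "(\<lambda>x. navg (f x) h (g x)) \<in> borel_measurable M"
proof -
  have "(\<lambda>p. \<integral>\<^sup>+y. ennreal (ker (fst p) (y - snd p)) * h y \<partial>lborel)
      \<in> borel_measurable (borel \<Otimes>\<^sub>M borel)"
    by measurable
  from measurable_compose[OF _ this, of "\<lambda>x. (f x, g x)" M] show ?thesis
    unfolding navg_def by simp
qed

lemma nn_integral_navg:
  assumes "0 < a" and [measurable]: "h \<in> borel_measurable borel"
  shows "(\<integral>\<^sup>+x. navg a h x \<partial>lborel) = (\<integral>\<^sup>+y. h y \<partial>lborel)"
proof -
  have "(\<integral>\<^sup>+x. navg a h x \<partial>lborel)
      = (\<integral>\<^sup>+y. (\<integral>\<^sup>+x. ennreal (ker a (y - x)) * h y \<partial>lborel) \<partial>lborel)"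
    unfolding navg_def by (rule lborel_pair.Fubini') measurable
  also have "\<dots> = (\<integral>\<^sup>+y. h y \<partial>lborel)"
    by (subst nn_integral_multc) (auto simp: nn_integral_ker' assms)
  finally show ?thesis .
qed

lemma navg_le:
  assumes "0 < a" and [measurable]: "h \<in> borel_measurable borel"
  shows "navg a h x \<le> ennreal (K * a ^ CARD('n)) * (\<integral>\<^sup>+y. h y \<partial>lborel)"
proof -
  have "navg a h x \<le> (\<integral>\<^sup>+y. ennreal (K * a ^ CARD('n)) * h y \<partial>lborel)"
    unfolding navg_def using ker_le[of a] assms
    by (intro nn_integral_mono mult_right_mono ennreal_leI) auto
  also have "\<dots> = ennreal (K * a ^ CARD('n)) * (\<integral>\<^sup>+y. h y \<partial>lborel)"
    by (rule nn_integral_cmult) auto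
  finally show ?thesis .
qed

text \<open>Jensen's inequality for the probability density y \<mapsto> ker a (y - x), proved by
  Cauchy-Schwarz with the weight split into two square roots.\<close>

lemma navg_square_le:
  assumes "0 < a" and [measurable]: "h \<in> borel_measurable borel"
  shows "(navg a h x)\<^sup>2 \<le> navg a (\<lambda>y. (h y)\<^sup>2) x"
proof -
  have eq: "ennreal (sqrt (ker a w)) * ennreal (sqrt (ker a w)) = ennreal (ker a w)" for w
    using ker_nonneg[of a w] assms by (simp flip: ennreal_mult)
  have "(navg a h x)\<^sup>2 = (\<integral>\<^sup>+y. ennreal (sqrt (ker a (y - x))) * (ennreal (sqrt (ker a (y - x))) * h y) \<partial>lborel)\<^sup>2"
    unfolding navg_def by (simp add: eq flip: mult.assoc)
  also have "\<dots> \<le> (\<integral>\<^sup>+y. (ennreal (sqrt (ker a (y - x))))\<^sup>2 \<partial>lborel) *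
      (\<integral>\<^sup>+y. (ennreal (sqrt (ker a (y - x))) * h y)\<^sup>2 \<partial>lborel)"
    by (rule Cauchy_Schwarz_nn_integral) auto
  also have "\<dots> = navg a (\<lambda>y. (h y)\<^sup>2) x"
    using nn_integral_ker[OF assms(1)] by (simp add: power2_eq_square eq navg_def mult_ac flip: mult.assoc)
  finally show ?thesis .
qed

text \<open>Jensen combined with the height K a^n of the kernel: an average at scale 1/a maps L_2 to
  bounded functions, with a norm that grows like a^(n/2).\<close>

lemma navg_square_sup:
  assumes "0 < a" and [measurable]: "h \<in> borel_measurable borel"
  shows "(navg a h x)\<^sup>2 \<le> ennreal (K * a ^ CARD('n)) * (\<integral>\<^sup>+y. (h y)\<^sup>2 \<partial>lborel)"
  by (rule order_trans[OF navg_square_le navg_le]) (use assms in auto)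

lemma navg_square_L2:
  assumes "0 < a" and [measurable]: "h \<in> borel_measurable borel"
  shows "(\<integral>\<^sup>+x. (navg a h x)\<^sup>2 \<partial>lborel) \<le> (\<integral>\<^sup>+y. (h y)\<^sup>2 \<partial>lborel)"
proof -
  have "(\<integral>\<^sup>+x. (navg a h x)\<^sup>2 \<partial>lborel) \<le> (\<integral>\<^sup>+x. navg a (\<lambda>y. (h y)\<^sup>2) x \<partial>lborel)"
    using assms by (intro nn_integral_mono navg_square_le) auto
  also have "\<dots> = (\<integral>\<^sup>+y. (h y)\<^sup>2 \<partial>lborel)"
    using assms by (intro nn_integral_navg) auto
  finally show ?thesis .
qed

definition avg :: "real \<Rightarrow> (real ^ 'n \<Rightarrow> real) \<Rightarrow> real ^ 'n \<Rightarrow> real" where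
  "avg a f x = (\<integral>y. ker a (y - x) * f y \<partial>lborel)"

lemma meas_avg[measurable]:
  assumes [measurable]: "f \<in> borel_measurable borel"
  shows "avg a f \<in> borel_measurable borel"
proof -
  have "(\<lambda>x. avg a f x) \<in> borel_measurable lborel"
    unfolding avg_def by measurable
  then show ?thesis by simp
qed

lemma avg_abs_le:
  assumes "0 < a"
  shows "ennreal \<bar>avg a f x\<bar> \<le> navg a (\<lambda>y. ennreal \<bar>f y\<bar>) x"
proof -
  \<comment> \<open>If the product is not integrable, the Bochner integral is 0 by default and the
    bound is trivial.\<close>
  have "ennreal \<bar>avg a f x\<bar> \<le> (\<integral>\<^sup>+y. norm (ker a (y - x) * f y) \<partial>lborel)"
    unfolding avg_def using integral_norm_bound_ennreal[of lborel "\<lambda>y. ker a (y - x) * f y"]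
    by (cases "integrable lborel (\<lambda>y. ker a (y - x) * f y)") (auto simp: not_integrable_integral_eq)
  also have "\<dots> = navg a (\<lambda>y. ennreal \<bar>f y\<bar>) x"
    using assms ker_nonneg[of a] by (simp add: navg_def abs_mult ennreal_mult)
  finally show ?thesis .
qed

lemma ker_integrable:
  assumes "0 < a" shows "integrable lborel (\<lambda>y. ker a (y - x))"
  using nn_integral_ker[OF assms, of x] ker_nonneg[of a] assms
  by (intro integrableI_nonneg) auto

lemma ker_mult_integrable:
  assumes "0 < a" and [measurable]: "f \<in> borel_measurable borel"
    and "integrable lborel (\<lambda>y. (f y)\<^sup>2)"
  shows "integrable lborel (\<lambda>y. ker a (y - x) * f y)"
proof (rule Bochner_Integration.integrable_bound)
  show "integrable lborel (\<lambda>y. ker a (y - x) + K * a ^ CARD('n) * (f y)\<^sup>2)"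
    by (intro Bochner_Integration.integrable_add ker_integrable integrable_mult_right assms)
  have "\<bar>ker a (y - x) * f y\<bar> \<le> ker a (y - x) + K * a ^ CARD('n) * (f y)\<^sup>2" for y
  proof -
    have "\<bar>f y\<bar> \<le> 1 + (f y)\<^sup>2"
      using zero_le_power2[of "\<bar>f y\<bar> - 1/2"] by (simp add: power2_eq_square algebra_simps)
    then have "ker a (y - x) * \<bar>f y\<bar> \<le> ker a (y - x) * (1 + (f y)\<^sup>2)"
      using ker_nonneg[of a "y - x"] assms by (intro mult_left_mono) auto
    also have "\<dots> \<le> ker a (y - x) + K * a ^ CARD('n) * (f y)\<^sup>2"
      using mult_right_mono[OF ker_le[of a "y - x"], of "(f y)\<^sup>2"] assms by (simp add: algebra_simps)
    finally show ?thesis using ker_nonneg[of a "y - x"] assms by (simp add: abs_mult)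
  qed
  then show "AE y in lborel. norm (ker a (y - x) * f y) \<le> norm (ker a (y - x) + K * a ^ CARD('n) * (f y)\<^sup>2)"
    by (intro AE_I2) (metis abs_le_D1 abs_ge_self order_trans real_norm_def)
qed measurable

lemma avg_add:
  assumes "0 < a" "f \<in> borel_measurable borel" "integrable lborel (\<lambda>y. (f y)\<^sup>2)"
    "g \<in> borel_measurable borel" "integrable lborel (\<lambda>y. (g y)\<^sup>2)"
  shows "avg a (\<lambda>y. f y + g y) x = avg a f x + avg a g x"
  unfolding avg_def using ker_mult_integrable[OF assms(1,2,3)] ker_mult_integrable[OF assms(1,4,5)]
  by (simp add: distrib_left)

end

text \<open>
  The functions live on the whole space and are Borel measurable, because Lebesgue measurability is
  lost under the substitutions in Fubini arguments.
\<close>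

definition borel_H1 :: "(real ^ 'n) set \<Rightarrow> (real ^ 'n \<Rightarrow> real) \<Rightarrow> (real ^ 'n \<Rightarrow> real ^ 'n) \<Rightarrow> bool" where
  "borel_H1 \<Omega> f g \<longleftrightarrow> f \<in> borel_measurable borel \<and> g \<in> borel_measurable borel \<and>
     integrable lborel (\<lambda>x. (f x)\<^sup>2) \<and> integrable lborel (\<lambda>x. (norm (g x))\<^sup>2) \<and>
     (\<forall>\<psi> d\<psi>. C1c_with_gradient \<Omega> \<psi> d\<psi> \<longrightarrow>
        (\<integral>x. f x *\<^sub>R d\<psi> x \<partial>lborel) = - (\<integral>x. \<psi> x *\<^sub>R g x \<partial>lborel))"

section \<open>Integrability criteria and the calculus of weak gradients\<close>

lemma nn_weighted_square_le:
  fixes w :: "'a \<Rightarrow> real" and h :: "'a \<Rightarrow> ennreal"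
  assumes [measurable]: "w \<in> borel_measurable M" "h \<in> borel_measurable M" and w: "\<And>x. 0 \<le> w x"
  shows "(\<integral>\<^sup>+x. ennreal (w x) * h x \<partial>M)\<^sup>2 \<le> (\<integral>\<^sup>+x. ennreal (w x) \<partial>M) * (\<integral>\<^sup>+x. ennreal (w x) * (h x)\<^sup>2 \<partial>M)"
proof -
  have eq: "ennreal (sqrt (w x)) * ennreal (sqrt (w x)) = ennreal (w x)" for x
    using w[of x] by (simp flip: ennreal_mult)
  have "(\<integral>\<^sup>+x. ennreal (w x) * h x \<partial>M)\<^sup>2 = (\<integral>\<^sup>+x. ennreal (sqrt (w x)) * (ennreal (sqrt (w x)) * h x) \<partial>M)\<^sup>2"
    by (simp add: eq flip: mult.assoc)
  also have "\<dots> \<le> (\<integral>\<^sup>+x. (ennreal (sqrt (w x)))\<^sup>2 \<partial>M) * (\<integral>\<^sup>+x. (ennreal (sqrt (w x)) * h x)\<^sup>2 \<partial>M)"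
    by (rule Cauchy_Schwarz_nn_integral) auto
  also have "\<dots> = (\<integral>\<^sup>+x. ennreal (w x) \<partial>M) * (\<integral>\<^sup>+x. ennreal (w x) * (h x)\<^sup>2 \<partial>M)"
    by (simp only: power_mult_distrib power2_eq_square[of "ennreal (sqrt _)"] eq)
  finally show ?thesis .
qed

text \<open>The Fubini condition for the two places where the fundamental theorem of calculus is
  applied under an integral: in the scale of an average, and along a coordinate direction for a test
  function.\<close>

lemma integrable_product_Icc:
  fixes F :: "real ^ 'n \<Rightarrow> real \<Rightarrow> real"
  assumes [measurable]: "case_prod F \<in> borel_measurable (lborel \<Otimes>\<^sub>M lborel)"
    and h: "integrable lborel h" and F: "\<And>y t. \<bar>F y t\<bar> \<le> h y * indicator {a..b} t" and ab: "a \<le> b"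
  shows "integrable (lborel \<Otimes>\<^sub>M lborel) (case_prod F)"
proof (rule lborel_pair.Fubini_integrable)
  have iI: "integrable lborel (\<lambda>t::real. h y * indicator {a..b} t)" for y
    by (intro integrable_mult_right integrable_real_indicator) (auto simp: emeasure_lborel_Icc_eq)
  have Fb: "\<bar>F y t\<bar> \<le> \<bar>h y * indicator {a..b} t\<bar>" for y t using F[of y t] by linarith
  have [measurable]: "F y \<in> borel_measurable lborel" for y
    using measurable_compose[OF measurable_Pair1' assms(1), of y] by simp
  have iF: "integrable lborel (F y)" for y
    by (rule Bochner_Integration.integrable_bound[OF iI[of y]]) (use Fb[of y] in auto)
  then show "AE y in lborel. integrable lborel (\<lambda>t. case_prod F (y, t))" by simp
  show "integrable lborel (\<lambda>y. \<integral>t. norm (case_prod F (y, t)) \<partial>lborel)"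
  proof (rule Bochner_Integration.integrable_bound)
    show "integrable lborel (\<lambda>y. h y * (b - a))" using h by simp
    have "(\<integral>t. \<bar>F y t\<bar> \<partial>lborel) \<le> \<bar>h y * (b - a)\<bar>" for y
    proof -
      have "(\<integral>t. \<bar>F y t\<bar> \<partial>lborel) \<le> (\<integral>t. h y * indicator {a..b} t \<partial>lborel)"
        using F[of y] by (intro Bochner_Integration.integral_mono integrable_abs iF iI) auto
      then show ?thesis using ab by simp
    qed
    then show "AE y in lborel. norm (\<integral>t. norm (case_prod F (y, t)) \<partial>lborel) \<le> norm (h y * (b - a))" by simp
  qed measurable
qed measurable

text \<open>On a set of finite measure L_2 is contained in L_1, by |f| \<le> 1 + |f|^2.\<close>

lemma integrable_bounded_support_mult:
  fixes f :: "real ^ 'n \<Rightarrow> 'c::euclidean_space" and h :: "real ^ 'n \<Rightarrow> 'b::euclidean_space"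
    and p :: "real ^ 'n \<Rightarrow> 'd::euclidean_space"
  assumes [measurable]: "f \<in> borel_measurable borel" "p \<in> borel_measurable borel"
    and f2: "integrable lborel (\<lambda>x. (norm (f x))\<^sup>2)"
    and C: "C \<in> sets borel" "emeasure lborel C < \<infinity>"
    and bd: "\<And>y. norm (p y) \<le> B * norm (f y)"
    and z: "\<And>y. y \<notin> C \<Longrightarrow> p y = 0" and B: "0 \<le> B"
  shows "integrable lborel p"
proof (rule Bochner_Integration.integrable_bound)
  show "integrable lborel (\<lambda>y. B * (indicator C y + (norm (f y))\<^sup>2))"
    using f2 C by (intro integrable_mult_right Bochner_Integration.integrable_add) (auto intro!: integrable_real_indicator)
  have "norm (p y) \<le> B * (indicator C y + (norm (f y))\<^sup>2)" for y
  proof (cases "y \<in> C")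
    case True
    have "norm (f y) \<le> 1 + (norm (f y))\<^sup>2"
      using zero_le_power2[of "norm (f y) - 1/2"] by (simp add: power2_eq_square algebra_simps)
    then show ?thesis using bd[of y] B True mult_left_mono[of "norm (f y)" "1 + (norm (f y))\<^sup>2" B]
      by simp
  qed (use z B in auto)
  then show "AE y in lborel. norm (p y) \<le> norm (B * (indicator C y + (norm (f y))\<^sup>2))"
    by (intro AE_I2) (metis abs_ge_self order_trans real_norm_def)
qed measurable

text \<open>The function vanishes on the whole open complement of its support, so its derivative
  there is that of the zero function.\<close>

lemma C1c_gradient_zero:
  assumes "C1c_with_gradient \<Omega> \<psi> d\<psi>" "x \<notin> closure {x. \<psi> x \<noteq> 0}"
  shows "\<psi> x = 0" "d\<psi> x = 0"
proof -
  have z: "\<psi> y = 0" if "y \<notin> closure {x. \<psi> x \<noteq> 0}" for y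
    using that closure_subset[of "{x. \<psi> x \<noteq> 0}"] by blast
  show "\<psi> x = 0" by (rule z[OF assms(2)])
  have "((\<lambda>_. 0) has_derivative (\<lambda>h. h \<bullet> d\<psi> x)) (at x)"
  proof (rule has_derivative_transform_within_open)
    show "(\<psi> has_derivative (\<lambda>h. h \<bullet> d\<psi> x)) (at x)"
      using assms(1) by (simp add: C1c_with_gradient_def gderiv_def)
    show "open (- closure {x. \<psi> x \<noteq> 0})" by (intro open_Compl closed_closure)
    show "x \<in> - closure {x. \<psi> x \<noteq> 0}" using assms(2) by (simp only: Compl_iff not_False_eq_True)
    show "\<psi> y = 0" if "y \<in> - closure {x. \<psi> x \<noteq> 0}" for y using that unfolding Compl_iff by (rule z)
  qed
  then have "(\<lambda>h. h \<bullet> d\<psi> x) = (\<lambda>h. 0)"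
    by (rule has_derivative_unique) (rule has_derivative_const)
  then have "d\<psi> x \<bullet> d\<psi> x = 0" by metis
  then show "d\<psi> x = 0" by simp
qed

lemma C1c_facts:
  assumes "C1c_with_gradient \<Omega> \<psi> d\<psi>"
  obtains C B where "C \<subseteq> \<Omega>" "C \<in> sets borel" "emeasure lborel C < \<infinity>" "bounded C" "0 \<le> B"
    "\<And>x. \<bar>\<psi> x\<bar> \<le> B" "\<And>x. norm (d\<psi> x) \<le> B" "\<And>x. x \<notin> C \<Longrightarrow> \<psi> x = 0 \<and> d\<psi> x = 0"
    "\<psi> \<in> borel_measurable borel" "d\<psi> \<in> borel_measurable borel" "continuous_on UNIV \<psi>"
proof -
  define C where "C = closure {x. \<psi> x \<noteq> 0}"
  have cC: "compact C" and CO: "C \<subseteq> \<Omega>" and cd: "continuous_on UNIV d\<psi>"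
    using assms by (auto simp: C1c_with_gradient_def C_def)
  have c\<psi>: "continuous_on UNIV \<psi>"
    using assms by (auto simp: C1c_with_gradient_def gderiv_def intro!: continuous_at_imp_continuous_on has_derivative_continuous)
  have z: "\<psi> x = 0 \<and> d\<psi> x = 0" if "x \<notin> C" for x
    using C1c_gradient_zero[OF assms that[unfolded C_def]] by (intro conjI)
  have "bounded (\<psi> ` C)" "bounded (d\<psi> ` C)"
    using cC by (auto intro!: compact_imp_bounded compact_continuous_image continuous_on_subset[OF cd] continuous_on_subset[OF c\<psi>])
  then obtain B1 B2 where B: "\<forall>v\<in>\<psi> ` C. norm v \<le> B1" "\<forall>v\<in>d\<psi> ` C. norm v \<le> B2"
    unfolding bounded_iff by blast
  have 1: "\<bar>\<psi> x\<bar> \<le> max 0 (max B1 B2)" for x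
    using B(1) z[of x] by (cases "x \<in> C") (auto simp: le_max_iff_disj)
  have 2: "norm (d\<psi> x) \<le> max 0 (max B1 B2)" for x
    using B(2) z[of x] by (cases "x \<in> C") (auto simp: le_max_iff_disj)
  show thesis
  proof (rule that[OF CO _ _ compact_imp_bounded[OF cC] _ 1 2])
    show "C \<in> sets borel" using compact_imp_closed[OF cC] by (rule borel_closed)
    show "emeasure lborel C < \<infinity>" by (rule emeasure_bounded_finite[OF compact_imp_bounded[OF cC]])
    show "\<psi> \<in> borel_measurable borel" "d\<psi> \<in> borel_measurable borel"
      by (intro borel_measurable_continuous_onI c\<psi> cd)+
    show "\<psi> x = 0 \<and> d\<psi> x = 0" if "x \<notin> C" for x by (rule z[OF that])
  qed (simp_all add: c\<psi>)
qed

lemma borel_H1_integrable_test: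
  assumes H: "borel_H1 \<Omega> f g" and C1: "C1c_with_gradient \<Omega> \<psi> d\<psi>"
  shows "integrable lborel (\<lambda>x. f x *\<^sub>R d\<psi> x)" "integrable lborel (\<lambda>x. \<psi> x *\<^sub>R g x)"
proof -
  obtain C B where C: "C \<in> sets borel" "emeasure lborel C < \<infinity>" "0 \<le> B"
    "\<And>x. \<bar>\<psi> x\<bar> \<le> B" "\<And>x. norm (d\<psi> x) \<le> B" "\<And>x. x \<notin> C \<Longrightarrow> \<psi> x = 0 \<and> d\<psi> x = 0"
    and [measurable]: "\<psi> \<in> borel_measurable borel" "d\<psi> \<in> borel_measurable borel"
    using C1c_facts[OF C1] by metis
  have [measurable]: "f \<in> borel_measurable borel" "g \<in> borel_measurable borel"
    and f2: "integrable lborel (\<lambda>x. (f x)\<^sup>2)" and g2: "integrable lborel (\<lambda>x. (norm (g x))\<^sup>2)"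
    using H by (auto simp: borel_H1_def)
  show "integrable lborel (\<lambda>x. f x *\<^sub>R d\<psi> x)"
    by (rule integrable_bounded_support_mult[where f=f and B=B and C=C])
      (use f2 C in \<open>auto simp: mult.commute[of B] intro!: mult_left_mono\<close>)
  show "integrable lborel (\<lambda>x. \<psi> x *\<^sub>R g x)"
    by (rule integrable_bounded_support_mult[where f=g and B=B and C=C])
      (use g2 C in \<open>auto intro!: mult_right_mono\<close>)
qed

lemma integrable_norm_add_square:
  fixes f g :: "'a \<Rightarrow> 'b::{banach, second_countable_topology}"
  assumes [measurable]: "f \<in> borel_measurable M" "g \<in> borel_measurable M"
    and "integrable M (\<lambda>x. (norm (f x))\<^sup>2)" "integrable M (\<lambda>x. (norm (g x))\<^sup>2)"
  shows "integrable M (\<lambda>x. (norm (f x + g x))\<^sup>2)"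
proof (rule Bochner_Integration.integrable_bound)
  show "integrable M (\<lambda>x. 2 * (norm (f x))\<^sup>2 + 2 * (norm (g x))\<^sup>2)" using assms by simp
  have "(norm (f x + g x))\<^sup>2 \<le> 2 * (norm (f x))\<^sup>2 + 2 * (norm (g x))\<^sup>2" for x
  proof -
    have "(norm (f x + g x))\<^sup>2 \<le> (norm (f x) + norm (g x))\<^sup>2" by (intro power_mono norm_triangle_ineq) auto
    also have "\<dots> \<le> 2 * (norm (f x))\<^sup>2 + 2 * (norm (g x))\<^sup>2"
      using sum_squares_bound[of "norm (f x)" "norm (g x)"] by (simp add: power2_sum)
    finally show ?thesis .
  qed
  then show "AE x in M. norm ((norm (f x + g x))\<^sup>2) \<le> norm (2 * (norm (f x))\<^sup>2 + 2 * (norm (g x))\<^sup>2)" by simp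
qed measurable

lemma borel_H1_zero: "borel_H1 \<Omega> (\<lambda>x. 0) (\<lambda>x. 0)"
  by (simp add: borel_H1_def)

lemma borel_H1_cmult: "borel_H1 \<Omega> f g \<Longrightarrow> borel_H1 \<Omega> (\<lambda>x. c * f x) (\<lambda>x. c *\<^sub>R g x)"
  by (auto simp: borel_H1_def power_mult_distrib mult.assoc scaleR_left_commute simp flip: scaleR_scaleR)

lemma borel_H1_add:
  assumes "borel_H1 \<Omega> f g" "borel_H1 \<Omega> f' g'"
  shows "borel_H1 \<Omega> (\<lambda>x. f x + f' x) (\<lambda>x. g x + g' x)"
  unfolding borel_H1_def
proof (intro conjI allI impI)
  show "integrable lborel (\<lambda>x. (f x + f' x)\<^sup>2)"
    using integrable_norm_add_square[of f lborel f'] assms by (simp add: borel_H1_def)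
  show "integrable lborel (\<lambda>x. (norm (g x + g' x))\<^sup>2)"
    using integrable_norm_add_square[of g lborel g'] assms by (simp add: borel_H1_def)
  fix \<psi> d\<psi> assume C: "C1c_with_gradient \<Omega> \<psi> d\<psi>"
  show "(\<integral>x. (f x + f' x) *\<^sub>R d\<psi> x \<partial>lborel) = - (\<integral>x. \<psi> x *\<^sub>R (g x + g' x) \<partial>lborel)"
    using borel_H1_integrable_test[OF assms(1) C] borel_H1_integrable_test[OF assms(2) C] assms C
    by (simp add: scaleR_add_left scaleR_add_right borel_H1_def)
qed (use assms in \<open>auto simp: borel_H1_def\<close>)

lemma borel_H1_sum:
  assumes "finite J" "\<And>j. j \<in> J \<Longrightarrow> borel_H1 \<Omega> (f j) (g j)"
  shows "borel_H1 \<Omega> (\<lambda>x. \<Sum>j\<in>J. a j * f j x) (\<lambda>x. \<Sum>j\<in>J. a j *\<^sub>R g j x)"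
  using assms
proof (induction J rule: finite_induct)
  case empty
  then show ?case by (simp add: borel_H1_zero)
next
  case (insert j J)
  then show ?case using borel_H1_add[OF borel_H1_cmult[of \<Omega> "f j" "g j" "a j"]] by simp
qed

section \<open>Derivative of the averages in the scale\<close>

context averaging_kernel begin

lemma d\<rho>_zero: "z \<notin> S \<Longrightarrow> d\<rho> z = 0"
proof -
  assume z: "z \<notin> S"
  have "open (- S)" using compact_S compact_imp_closed by blast
  have "((\<lambda>_. 0) has_derivative (\<lambda>h. h \<bullet> d\<rho> z)) (at z)"
  proof (rule has_derivative_transform_within_open)
    show "(\<rho> has_derivative (\<lambda>h. h \<bullet> d\<rho> z)) (at z)" using gderiv[of z] by (simp add: gderiv_def)
    show "open (- S)" by fact
    show "z \<in> - S" using z by simp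
  qed (use supp in auto)
  then have "(\<lambda>h. h \<bullet> d\<rho> z) = (\<lambda>h. 0)"
    by (rule has_derivative_unique) (rule has_derivative_const)
  then have "d\<rho> z \<bullet> d\<rho> z = 0" by metis
  then show ?thesis by simp
qed

text \<open>The derivative of \<open>ker a w\<close> with respect to the scale parameter a, with w
  fixed.\<close>

definition dker :: "real \<Rightarrow> real ^ 'n \<Rightarrow> real" where
  "dker a w = real CARD('n) * a ^ (CARD('n) - 1) * \<rho> (a *\<^sub>R w) + a ^ CARD('n) * (d\<rho> (a *\<^sub>R w) \<bullet> w)"

lemma meas_dker[measurable]:
  assumes [measurable]: "f \<in> borel_measurable M" "g \<in> borel_measurable M"
  shows "(\<lambda>x. dker (f x) (g x)) \<in> borel_measurable M"
  unfolding dker_def by measurable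

lemma ker_deriv: "((\<lambda>a. ker a w) has_real_derivative dker a w) (at a)"
proof -
  have "((\<lambda>a. \<rho> (a *\<^sub>R w)) has_derivative (\<lambda>h. (h *\<^sub>R w) \<bullet> d\<rho> (a *\<^sub>R w))) (at a)"
  proof (rule has_derivative_compose[of "\<lambda>a. a *\<^sub>R w" "\<lambda>h. h *\<^sub>R w"])
    show "((\<lambda>a. a *\<^sub>R w) has_derivative (\<lambda>h. h *\<^sub>R w)) (at a)"
      by (auto intro!: derivative_eq_intros)
    show "(\<rho> has_derivative (\<lambda>h. h \<bullet> d\<rho> (a *\<^sub>R w))) (at (a *\<^sub>R w))"
      using gderiv by (simp add: gderiv_def)
  qed
  then have "((\<lambda>a. \<rho> (a *\<^sub>R w)) has_real_derivative (d\<rho> (a *\<^sub>R w) \<bullet> w)) (at a)"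
    by (simp add: has_field_derivative_def inner_commute mult_commute_abs)
  from DERIV_mult[OF DERIV_pow[of "CARD('n)" a] this] show ?thesis
    unfolding ker_def dker_def by (simp add: algebra_simps)
qed

lemma cont_dker: "continuous_on UNIV (\<lambda>p. dker (fst p) (snd p))"
proof -
  have 1: "continuous_on UNIV (\<lambda>p::real \<times> (real^'n). \<rho> (fst p *\<^sub>R snd p))"
    by (rule continuous_on_compose2[OF cont]) (auto intro!: continuous_intros)
  have 2: "continuous_on UNIV (\<lambda>p::real \<times> (real^'n). d\<rho> (fst p *\<^sub>R snd p))"
    by (rule continuous_on_compose2[OF cont_d]) (auto intro!: continuous_intros)
  show ?thesis unfolding dker_def by (intro continuous_intros 1 2)
qed

lemma dker_zero: "0 < a \<Longrightarrow> R / a < norm w \<Longrightarrow> dker a w = 0"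
proof -
  assume a: "0 < a" "R / a < norm w"
  then have "a *\<^sub>R w \<notin> S" using S_R[of "a *\<^sub>R w"] by (auto simp: field_simps)
  then show ?thesis using supp d\<rho>_zero by (auto simp: dker_def)
qed

text \<open>The supports shrink as the scale parameter grows, so the ball belonging to the smallest
  parameter a serves the whole interval.\<close>

lemma dker_bounded:
  assumes "0 < a"
  obtains B where "0 \<le> B" "\<And>\<alpha> w. \<alpha> \<in> {a..b} \<Longrightarrow> \<bar>dker \<alpha> w\<bar> \<le> B * indicator (cball 0 (R / a)) w"
proof -
  have "compact ((\<lambda>p. dker (fst p) (snd p)) ` ({a..b} \<times> cball 0 (R / a)))"
    by (intro compact_continuous_image continuous_on_subset[OF cont_dker] compact_Times) auto
  then have "bounded ((\<lambda>p. dker (fst p) (snd p)) ` ({a..b} \<times> cball 0 (R / a)))"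
    by (rule compact_imp_bounded)
  then obtain B where B: "0 < B" "\<And>v. v \<in> (\<lambda>p. dker (fst p) (snd p)) ` ({a..b} \<times> cball 0 (R / a)) \<Longrightarrow> norm v \<le> B"
    unfolding bounded_pos by blast
  show thesis
  proof (rule that[of B])
    fix \<alpha> w assume \<alpha>: "\<alpha> \<in> {a..b}"
    show "\<bar>dker \<alpha> w\<bar> \<le> B * indicator (cball 0 (R / a)) w"
    proof (cases "w \<in> cball 0 (R / a)")
      case True
      then show ?thesis using B(2)[of "dker \<alpha> w"] \<alpha> by force
    next
      case False
      have "R / \<alpha> \<le> R / a" using \<alpha> assms R_nonneg by (auto intro!: divide_left_mono)
      then have "R / \<alpha> < norm w" using False by simp
      then show ?thesis using dker_zero[of \<alpha> w] \<alpha> assms False by simp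
    qed
  qed (use B in auto)
qed

text \<open>
  The weak gradient enters through the identity
  \<open>\<partial>\<^sub>a (a\<^sup>n \<rho>(a w)) = div (a\<^bsup>n-1\<^esup> \<rho>(a w) w)\<close>, whose right-hand side is an admissible test field.
\<close>

lemma weak_identity:
  assumes H: "borel_H1 \<Omega> f g" and a: "0 < a"
    and cone: "\<And>z. z \<in> S \<Longrightarrow> x + (1 / a) *\<^sub>R z \<in> \<Omega>"
  shows "(\<integral>y. f y * dker a (y - x) \<partial>lborel) =
    - (\<integral>y. a ^ (CARD('n) - 1) * \<rho> (a *\<^sub>R (y - x)) * ((y - x) \<bullet> g y) \<partial>lborel)"
proof -
  have [measurable]: "f \<in> borel_measurable borel" "g \<in> borel_measurable borel"
    and f2: "integrable lborel (\<lambda>x. (f x)\<^sup>2)" and g2: "integrable lborel (\<lambda>x. (norm (g x))\<^sup>2)"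
    using H by (auto simp: borel_H1_def)
  \<comment> \<open>The support of the kernel as seen from x. The cone condition puts this compact
    set inside \<Omega>, which makes the functions defined next admissible in the weak
    identity.\<close>
  define C where "C = (\<lambda>z. x + (1 / a) *\<^sub>R z) ` S"
  have cC: "compact C" unfolding C_def by (intro compact_continuous_image continuous_intros compact_S)
  have CO: "C \<subseteq> \<Omega>" using cone by (auto simp: C_def)
  have inC: "y \<in> C" if "a *\<^sub>R (y - x) \<in> S" for y
    unfolding C_def using a by (intro image_eqI[OF _ that]) (simp add: algebra_simps)
  have Cf: "C \<in> sets borel" "emeasure lborel C < \<infinity>"
    using emeasure_bounded_finite[OF compact_imp_bounded[OF cC]] compact_imp_closed[OF cC] by (auto simp: borel_closed)
  \<comment> \<open>The i-th component of the field \<rho>(a w) w with w = y - x. Each component is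
    tested separately, and only the i-th entry of its gradient is used; these entries add up to the
    divergence.\<close>
  define \<psi> where "\<psi> i y = \<rho> (a *\<^sub>R (y - x)) * ((y - x) \<bullet> i)" for i y
  define d\<psi> where "d\<psi> i y = \<rho> (a *\<^sub>R (y - x)) *\<^sub>R i + ((y - x) \<bullet> i) *\<^sub>R (a *\<^sub>R d\<rho> (a *\<^sub>R (y - x)))" for i y
  have z: "\<psi> i y = 0" "d\<psi> i y = 0" if "y \<notin> C" for i y
    using inC[of y] that supp[of "a *\<^sub>R (y - x)"] d\<rho>_zero[of "a *\<^sub>R (y - x)"] by (fastforce simp: \<psi>_def d\<psi>_def)+
  have c\<rho>: "continuous_on UNIV (\<lambda>y. \<rho> (a *\<^sub>R (y - x)))"
    by (rule continuous_on_compose2[OF cont]) (auto intro!: continuous_intros)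
  have cd: "continuous_on UNIV (d\<psi> i)" for i
    unfolding d\<psi>_def by (intro continuous_intros c\<rho> continuous_on_compose2[OF cont_d]) auto
  have c\<psi>: "continuous_on UNIV (\<psi> i)" for i
    unfolding \<psi>_def by (intro continuous_intros c\<rho>)
  have gd: "GDERIV (\<psi> i) y :> d\<psi> i y" for i y
  proof -
    have "((\<lambda>y. \<rho> (a *\<^sub>R (y - x))) has_derivative (\<lambda>h. (a *\<^sub>R h) \<bullet> d\<rho> (a *\<^sub>R (y - x)))) (at y)"
    proof (rule has_derivative_compose[of "\<lambda>y. a *\<^sub>R (y - x)" "\<lambda>h. a *\<^sub>R h"])
      show "((\<lambda>y. a *\<^sub>R (y - x)) has_derivative (\<lambda>h. a *\<^sub>R h)) (at y)"
        by (auto intro!: derivative_eq_intros)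
      show "(\<rho> has_derivative (\<lambda>h. h \<bullet> d\<rho> (a *\<^sub>R (y - x)))) (at (a *\<^sub>R (y - x)))"
        using gderiv by (simp add: gderiv_def)
    qed
    then have "GDERIV (\<lambda>y. \<rho> (a *\<^sub>R (y - x))) y :> a *\<^sub>R d\<rho> (a *\<^sub>R (y - x))"
      by (simp add: gderiv_def)
    moreover have "GDERIV (\<lambda>y. (y - x) \<bullet> i) y :> i"
      unfolding gderiv_def by (auto intro!: derivative_eq_intros)
    ultimately show ?thesis unfolding \<psi>_def d\<psi>_def by (rule GDERIV_mult)
  qed
  have C1: "C1c_with_gradient \<Omega> (\<psi> i) (d\<psi> i)" for i
  proof -
    have "closure {y. \<psi> i y \<noteq> 0} \<subseteq> C"
      using z cC compact_imp_closed by (intro closure_minimal) auto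
    moreover from this have "compact (closure {y. \<psi> i y \<noteq> 0})"
      using cC compact_Int_closed[of C "closure {y. \<psi> i y \<noteq> 0}"] by (simp add: inf_absorb2)
    ultimately show ?thesis using gd cd CO by (auto simp: C1c_with_gradient_def)
  qed
  note i1 = borel_H1_integrable_test(1)[OF H C1] and i2 = borel_H1_integrable_test(2)[OF H C1]
  have comp: "(\<integral>y. f y * (d\<psi> i y \<bullet> i) \<partial>lborel) = - (\<integral>y. \<psi> i y * (g y \<bullet> i) \<partial>lborel)" if i: "i \<in> Basis" for i
  proof -
    have "(\<integral>y. f y *\<^sub>R d\<psi> i y \<partial>lborel) \<bullet> i = - (\<integral>y. \<psi> i y *\<^sub>R g y \<partial>lborel) \<bullet> i"
      using H C1[of i] by (simp add: borel_H1_def)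
    then show ?thesis using i1[of i] i2[of i]
      by (simp flip: integral_inner_left)
  qed
  have i1': "integrable lborel (\<lambda>y. f y * (d\<psi> i y \<bullet> i))" for i
    using integrable_inner_left[OF i1[of i], of i] by simp
  have i2': "integrable lborel (\<lambda>y. \<psi> i y * (g y \<bullet> i))" for i
    using integrable_inner_left[OF i2[of i], of i] by simp
  have an: "a ^ CARD('n) = a ^ (CARD('n) - 1) * a"
    using power_minus_mult[of "CARD('n)" a] by simp
  have div: "dker a (y - x) = a ^ (CARD('n) - 1) * (\<Sum>i\<in>Basis. d\<psi> i y \<bullet> i)" for y
  proof -
    have "(\<Sum>i\<in>Basis. d\<psi> i y \<bullet> i) = real CARD('n) * \<rho> (a *\<^sub>R (y - x)) + a * (d\<rho> (a *\<^sub>R (y - x)) \<bullet> (y - x))"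
      unfolding d\<psi>_def euclidean_inner[of "d\<rho> (a *\<^sub>R (y - x))" "y - x"]
      by (simp add: inner_add_left sum.distrib sum_distrib_left inner_same_Basis mult_ac cong: sum.cong)
    then show ?thesis by (simp only: dker_def an) (simp add: algebra_simps)
  qed
  have "(\<integral>y. f y * dker a (y - x) \<partial>lborel) = (\<integral>y. a ^ (CARD('n) - 1) * (\<Sum>i\<in>Basis. f y * (d\<psi> i y \<bullet> i)) \<partial>lborel)"
    by (simp add: div sum_distrib_left mult_ac)
  also have "\<dots> = a ^ (CARD('n) - 1) * (\<Sum>i\<in>Basis. (\<integral>y. f y * (d\<psi> i y \<bullet> i) \<partial>lborel))"
    using i1' by (simp add: Bochner_Integration.integral_sum)
  also have "\<dots> = - (a ^ (CARD('n) - 1) * (\<Sum>i\<in>Basis. (\<integral>y. \<psi> i y * (g y \<bullet> i) \<partial>lborel)))"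
    by (simp add: comp sum_negf)
  also have "\<dots> = - (\<integral>y. a ^ (CARD('n) - 1) * (\<Sum>i\<in>Basis. \<psi> i y * (g y \<bullet> i)) \<partial>lborel)"
    using i2' by (simp add: Bochner_Integration.integral_sum)
  also have "(\<lambda>y. a ^ (CARD('n) - 1) * (\<Sum>i\<in>Basis. \<psi> i y * (g y \<bullet> i))) =
     (\<lambda>y. a ^ (CARD('n) - 1) * \<rho> (a *\<^sub>R (y - x)) * ((y - x) \<bullet> g y))"
    by (rule ext, subst euclidean_inner) (simp add: \<psi>_def sum_distrib_left mult_ac)
  finally show ?thesis .
qed

text \<open>The difference is the integral of the scale derivative over [a, b]. After Fubini, the
  weak identity replaces that derivative at \<alpha> by an average of the gradient against the field
  (w / \<alpha>) times the kernel; on the support |w| \<le> R / \<alpha>, which produces the weight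
  R / \<alpha>^2.\<close>

lemma avg_diff_le:
  assumes H: "borel_H1 \<Omega> f g" and a: "0 < a" "a \<le> b"
    and cone: "\<And>z \<alpha>. z \<in> S \<Longrightarrow> a \<le> \<alpha> \<Longrightarrow> x + (1 / \<alpha>) *\<^sub>R z \<in> \<Omega>"
  shows "ennreal \<bar>avg b f x - avg a f x\<bar> \<le>
    (\<integral>\<^sup>+\<alpha>. ennreal (R * indicator {a..b} \<alpha> / \<alpha>\<^sup>2) * navg \<alpha> (\<lambda>y. ennreal (norm (g y))) x \<partial>lborel)"
proof -
  have [measurable]: "f \<in> borel_measurable borel" "g \<in> borel_measurable borel"
    and f2: "integrable lborel (\<lambda>x. (f x)\<^sup>2)" and g2: "integrable lborel (\<lambda>x. (norm (g x))\<^sup>2)"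
    using H by (auto simp: borel_H1_def)
  obtain B where B: "0 \<le> B" "\<And>\<alpha> w. \<alpha> \<in> {a..b} \<Longrightarrow> \<bar>dker \<alpha> w\<bar> \<le> B * indicator (cball 0 (R / a)) w"
    using dker_bounded[OF a(1)] by blast
  define F where "F y \<alpha> = indicator {a..b} \<alpha> * (f y * dker \<alpha> (y - x))" for y \<alpha>
  define C where "C = cball x (R / a)"
  have Cf: "C \<in> sets borel" "emeasure lborel C < \<infinity>"
    unfolding C_def using emeasure_bounded_finite[of C] by (auto simp: C_def emeasure_lborel_cball_finite)
  have fC: "integrable lborel (\<lambda>y. B * \<bar>f y * indicator C y\<bar>)"
  proof (intro integrable_mult_right integrable_abs)
    show "integrable lborel (\<lambda>y. f y * indicator C y)"
      by (rule integrable_bounded_support_mult[where f=f and B=1 and C=C])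
        (use f2 Cf in \<open>auto split: split_indicator\<close>)
  qed
  have meas[measurable]: "case_prod F \<in> borel_measurable (lborel \<Otimes>\<^sub>M lborel)"
    unfolding F_def by measurable
  have Fb: "\<bar>F y \<alpha>\<bar> \<le> (B * \<bar>f y * indicator C y\<bar>) * indicator {a..b} \<alpha>" for y \<alpha>
  proof (cases "\<alpha> \<in> {a..b}")
    case True
    have "indicator (cball 0 (R / a)) (y - x) = (indicator C y :: real)"
      by (auto simp: C_def dist_norm norm_minus_commute split: split_indicator)
    then show ?thesis using B(2)[OF True, of "y - x"] True mult_left_mono[OF B(2)[OF True, of "y - x"], of "\<bar>f y\<bar>"]
      by (simp add: F_def abs_mult mult_ac)
  qed (simp add: F_def)
  have intF: "integrable (lborel \<Otimes>\<^sub>M lborel) (case_prod F)"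
    by (rule integrable_product_Icc[OF meas fC Fb a(2)])
  have ftc: "(\<integral>\<alpha>. F y \<alpha> \<partial>lborel) = ker b (y - x) * f y - ker a (y - x) * f y" for y
  proof -
    have "(\<integral>\<alpha>. indicator {a..b} \<alpha> *\<^sub>R dker \<alpha> (y - x) \<partial>lborel) = ker b (y - x) - ker a (y - x)"
    proof (rule integral_FTC_atLeastAtMost[OF a(2)])
      show "((\<lambda>a. ker a (y - x)) has_vector_derivative dker \<alpha> (y - x)) (at \<alpha> within {a..b})" for \<alpha>
        using ker_deriv[of "y - x" \<alpha>] has_field_derivative_at_within has_real_derivative_iff_has_vector_derivative by blast
      show "continuous_on {a..b} (\<lambda>\<alpha>. dker \<alpha> (y - x))"
        using continuous_on_compose2[OF cont_dker, of "{a..b}" "\<lambda>\<alpha>. (\<alpha>, y - x)"]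
        by (simp add: continuous_on_Pair)
    qed
    moreover have "(\<integral>\<alpha>. F y \<alpha> \<partial>lborel) = (\<integral>\<alpha>. f y * (indicator {a..b} \<alpha> *\<^sub>R dker \<alpha> (y - x)) \<partial>lborel)"
      by (simp add: F_def mult_ac)
    ultimately show ?thesis by (simp add: left_diff_distrib mult.commute[of "f y"])
  qed
  have "avg b f x - avg a f x = (\<integral>y. ker b (y - x) * f y - ker a (y - x) * f y \<partial>lborel)"
    unfolding avg_def using a f2 by (subst Bochner_Integration.integral_diff) (auto intro!: ker_mult_integrable)
  also have "\<dots> = (\<integral>y. (\<integral>\<alpha>. F y \<alpha> \<partial>lborel) \<partial>lborel)" by (simp add: ftc)
  also have "\<dots> = (\<integral>\<alpha>. (\<integral>y. F y \<alpha> \<partial>lborel) \<partial>lborel)"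
    by (rule lborel_pair.Fubini_integral[symmetric, OF intF])
  finally have eq: "avg b f x - avg a f x = (\<integral>\<alpha>. (\<integral>y. F y \<alpha> \<partial>lborel) \<partial>lborel)" .
  have inner: "ennreal \<bar>(\<integral>y. F y \<alpha> \<partial>lborel)\<bar> \<le>
      ennreal (R * indicator {a..b} \<alpha> / \<alpha>\<^sup>2) * navg \<alpha> (\<lambda>y. ennreal (norm (g y))) x" for \<alpha>
  proof (cases "\<alpha> \<in> {a..b}")
    case True
    then have \<alpha>: "0 < \<alpha>" using a by simp
    define G where "G y = \<alpha> ^ (CARD('n) - 1) * \<rho> (\<alpha> *\<^sub>R (y - x)) * ((y - x) \<bullet> g y)" for y
    have [measurable]: "G \<in> borel_measurable borel" unfolding G_def by measurable
    have "(\<integral>y. F y \<alpha> \<partial>lborel) = - (\<integral>y. G y \<partial>lborel)"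
      using weak_identity[OF H \<alpha> cone] True by (simp add: F_def G_def)
    then have "ennreal \<bar>(\<integral>y. F y \<alpha> \<partial>lborel)\<bar> \<le> (\<integral>\<^sup>+y. ennreal (norm (G y)) \<partial>lborel)"
      using integral_norm_bound_ennreal[of lborel G]
      by (cases "integrable lborel G") (auto simp: not_integrable_integral_eq)
    also have "\<dots> \<le> (\<integral>\<^sup>+y. ennreal (R / \<alpha>\<^sup>2) * (ennreal (ker \<alpha> (y - x)) * ennreal (norm (g y))) \<partial>lborel)"
    proof (rule nn_integral_mono)
      fix y
      have an: "\<alpha> ^ CARD('n) = \<alpha> ^ (CARD('n) - 1) * \<alpha>"
        using power_minus_mult[of "CARD('n)" \<alpha>] by simp
      have "norm (G y) \<le> (R / \<alpha>\<^sup>2) * (ker \<alpha> (y - x) * norm (g y))"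
      proof (cases "\<rho> (\<alpha> *\<^sub>R (y - x)) = 0")
        case False
        have kn: "ker \<alpha> (y - x) \<noteq> 0" using False \<alpha> by (simp add: ker_def)
        have "\<bar>(y - x) \<bullet> g y\<bar> \<le> norm (y - x) * norm (g y)" by (rule Cauchy_Schwarz_ineq2)
        also have "\<dots> \<le> R / \<alpha> * norm (g y)" using ker_supp[OF \<alpha> kn] by (intro mult_right_mono) auto
        finally have "\<bar>G y\<bar> \<le> \<alpha> ^ (CARD('n) - 1) * \<rho> (\<alpha> *\<^sub>R (y - x)) * (R / \<alpha> * norm (g y))"
          unfolding G_def abs_mult using \<alpha> nonneg[of "\<alpha> *\<^sub>R (y - x)"]
          by (simp only: abs_of_nonneg zero_le_power less_imp_le) (intro mult_left_mono mult_nonneg_nonneg zero_le_power, auto)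
        also have "\<dots> = (R / \<alpha>\<^sup>2) * (ker \<alpha> (y - x) * norm (g y))"
          using \<alpha> by (simp add: ker_def an power2_eq_square field_simps)
        finally show ?thesis by simp
      qed (simp add: G_def ker_def)
      then show "ennreal (norm (G y)) \<le> ennreal (R / \<alpha>\<^sup>2) * (ennreal (ker \<alpha> (y - x)) * ennreal (norm (g y)))"
        using R_nonneg ker_nonneg[of \<alpha> "y - x"] \<alpha> by (simp add: ennreal_leI flip: ennreal_mult)
    qed
    also have "\<dots> = ennreal (R / \<alpha>\<^sup>2) * navg \<alpha> (\<lambda>y. ennreal (norm (g y))) x"
      unfolding navg_def by (rule nn_integral_cmult) measurable
    finally show ?thesis using True by simp
  qed (simp add: F_def)
  have "ennreal \<bar>avg b f x - avg a f x\<bar> \<le> (\<integral>\<^sup>+\<alpha>. ennreal (norm (\<integral>y. F y \<alpha> \<partial>lborel)) \<partial>lborel)"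
    unfolding eq using integral_norm_bound_ennreal[of lborel "\<lambda>\<alpha>. \<integral>y. F y \<alpha> \<partial>lborel"]
    by (cases "integrable lborel (\<lambda>\<alpha>. \<integral>y. F y \<alpha> \<partial>lborel)") (auto simp: not_integrable_integral_eq)
  also have "\<dots> \<le> (\<integral>\<^sup>+\<alpha>. ennreal (R * indicator {a..b} \<alpha> / \<alpha>\<^sup>2) * navg \<alpha> (\<lambda>y. ennreal (norm (g y))) x \<partial>lborel)"
    using inner by (intro nn_integral_mono) simp
  finally show ?thesis .
qed

text \<open>The exact value is R / a - R / b. Dropping the second term gives a bound uniform in b,
  which later allows b to tend to infinity.\<close>

lemma nn_integral_inverse_square_le:
  assumes "0 < a" "a \<le> b"
  shows "(\<integral>\<^sup>+\<alpha>. ennreal (R * indicator {a..b} \<alpha> / \<alpha>\<^sup>2) \<partial>lborel) \<le> ennreal (R / a)"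
proof -
  have "(\<integral>\<^sup>+\<alpha>. ennreal (R / \<alpha>\<^sup>2) * indicator {a..b} \<alpha> \<partial>lborel) = ennreal (- R / b - - R / a)"
  proof (rule nn_integral_FTC_Icc)
    fix \<alpha> assume "\<alpha> \<in> {a..b}"
    then have \<alpha>: "a \<le> \<alpha>" "\<alpha> \<le> b" by auto
    show "((\<lambda>\<alpha>. - R / \<alpha>) has_real_derivative R / \<alpha>\<^sup>2) (at \<alpha>)"
      using \<alpha> assms by (auto intro!: derivative_eq_intros simp: power2_eq_square)
  qed (use assms R_nonneg in auto)
  moreover have "(\<lambda>\<alpha>. ennreal (R / \<alpha>\<^sup>2) * indicator {a..b} \<alpha>) = (\<lambda>\<alpha>. ennreal (R * indicator {a..b} \<alpha> / \<alpha>\<^sup>2))"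
    by (auto split: split_indicator)
  ultimately show ?thesis using R_nonneg assms by (auto intro!: ennreal_leI)
qed

lemma avg_diff_square:
  assumes H: "borel_H1 \<Omega> f g" and a: "0 < a" "a \<le> b"
    and cone: "\<And>z \<alpha>. z \<in> S \<Longrightarrow> a \<le> \<alpha> \<Longrightarrow> x + (1 / \<alpha>) *\<^sub>R z \<in> \<Omega>"
  shows "ennreal ((avg b f x - avg a f x)\<^sup>2) \<le> (\<integral>\<^sup>+\<alpha>. ennreal (R * indicator {a..b} \<alpha> / \<alpha>\<^sup>2) \<partial>lborel) *
    (\<integral>\<^sup>+\<alpha>. ennreal (R * indicator {a..b} \<alpha> / \<alpha>\<^sup>2) * (navg \<alpha> (\<lambda>y. ennreal (norm (g y))) x)\<^sup>2 \<partial>lborel)"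
proof -
  have [measurable]: "g \<in> borel_measurable borel" using H by (auto simp: borel_H1_def)
  have "ennreal ((avg b f x - avg a f x)\<^sup>2) = (ennreal \<bar>avg b f x - avg a f x\<bar>)\<^sup>2" by (simp add: ennreal_power)
  also have "\<dots> \<le> (\<integral>\<^sup>+\<alpha>. ennreal (R * indicator {a..b} \<alpha> / \<alpha>\<^sup>2) * navg \<alpha> (\<lambda>y. ennreal (norm (g y))) x \<partial>lborel)\<^sup>2"
    by (intro power_mono avg_diff_le[OF H a cone]) auto
  also have "\<dots> \<le> (\<integral>\<^sup>+\<alpha>. ennreal (R * indicator {a..b} \<alpha> / \<alpha>\<^sup>2) \<partial>lborel) *
    (\<integral>\<^sup>+\<alpha>. ennreal (R * indicator {a..b} \<alpha> / \<alpha>\<^sup>2) * (navg \<alpha> (\<lambda>y. ennreal (norm (g y))) x)\<^sup>2 \<partial>lborel)"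
    using R_nonneg by (intro nn_weighted_square_le) auto
  finally show ?thesis .
qed

text \<open>Each average of the gradient in [a, b] is bounded pointwise through the kernel height,
  at most K b^n. The bound deteriorates with b and is meant for b comparable to a, namely one dyadic
  step.\<close>

lemma avg_diff_sup:
  assumes H: "borel_H1 \<Omega> f g" and a: "0 < a" "a \<le> b"
    and cone: "\<And>z \<alpha>. z \<in> S \<Longrightarrow> a \<le> \<alpha> \<Longrightarrow> x + (1 / \<alpha>) *\<^sub>R z \<in> \<Omega>"
  shows "ennreal ((avg b f x - avg a f x)\<^sup>2) \<le>
    ennreal (R / a)^2 * (ennreal (K * b ^ CARD('n)) * (\<integral>\<^sup>+y. ennreal ((norm (g y))\<^sup>2) \<partial>lborel))"
proof -
  have [measurable]: "g \<in> borel_measurable borel"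
    using H by (auto simp: borel_H1_def)
  define Q where "Q = ennreal (K * b ^ CARD('n)) * (\<integral>\<^sup>+y. ennreal ((norm (g y))\<^sup>2) \<partial>lborel)"
  define N where "N \<alpha> = navg \<alpha> (\<lambda>y. ennreal (norm (g y))) x" for \<alpha>
  define W where "W \<alpha> = ennreal (R * indicator {a..b} \<alpha> / \<alpha>\<^sup>2)" for \<alpha> :: real
  have [measurable]: "N \<in> borel_measurable borel" unfolding N_def by measurable
  have [measurable]: "W \<in> borel_measurable borel" unfolding W_def by measurable
  have NQ: "(N \<alpha>)\<^sup>2 \<le> Q" if "\<alpha> \<in> {a..b}" for \<alpha>
  proof -
    have "(N \<alpha>)\<^sup>2 \<le> ennreal (K * \<alpha> ^ CARD('n)) * (\<integral>\<^sup>+y. (ennreal (norm (g y)))\<^sup>2 \<partial>lborel)"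
      unfolding N_def using that a by (intro navg_square_sup) auto
    also have "\<dots> \<le> Q" unfolding Q_def using that a K_nonneg
      by (auto intro!: mult_mono ennreal_leI mult_left_mono power_mono simp: ennreal_power)
    finally show ?thesis .
  qed
  have "ennreal ((avg b f x - avg a f x)\<^sup>2) \<le> (\<integral>\<^sup>+\<alpha>. W \<alpha> \<partial>lborel) * (\<integral>\<^sup>+\<alpha>. W \<alpha> * (N \<alpha>)\<^sup>2 \<partial>lborel)"
    unfolding W_def N_def by (rule avg_diff_square[OF H a cone])
  also have "\<dots> \<le> (\<integral>\<^sup>+\<alpha>. W \<alpha> \<partial>lborel) * (\<integral>\<^sup>+\<alpha>. W \<alpha> * Q \<partial>lborel)"
    proof (rule mult_left_mono[OF nn_integral_mono])
    show "W \<alpha> * (N \<alpha>)\<^sup>2 \<le> W \<alpha> * Q" for \<alpha>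
    proof (cases "\<alpha> \<in> {a..b}")
      case True
      then show ?thesis by (intro mult_left_mono NQ) auto
    qed (simp add: W_def)
  qed auto
  also have "\<dots> = (\<integral>\<^sup>+\<alpha>. W \<alpha> \<partial>lborel)\<^sup>2 * Q"
    by (subst nn_integral_multc) (auto simp: power2_eq_square mult_ac)
  also have "\<dots> \<le> (ennreal (R / a))\<^sup>2 * Q"
    unfolding W_def by (intro mult_right_mono power_mono nn_integral_inverse_square_le a) auto
  finally show ?thesis unfolding Q_def .
qed

text \<open>In L_2 every average is a contraction, so after exchanging the integrals over x and over
  the scales nothing depends on b. The restriction to \<open>P\<close> reflects that the cone
  condition is available only there.\<close>

lemma avg_diff_L2:
  assumes H: "borel_H1 \<Omega> f g" and a: "0 < a" "a \<le> b" and [measurable]: "P \<in> sets borel"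
    and cone: "\<And>x z \<alpha>. x \<in> P \<Longrightarrow> z \<in> S \<Longrightarrow> a \<le> \<alpha> \<Longrightarrow> x + (1 / \<alpha>) *\<^sub>R z \<in> \<Omega>"
  shows "(\<integral>\<^sup>+x\<in>P. ennreal ((avg b f x - avg a f x)\<^sup>2) \<partial>lborel) \<le>
    (ennreal (R / a))\<^sup>2 * (\<integral>\<^sup>+y. ennreal ((norm (g y))\<^sup>2) \<partial>lborel)"
proof -
  have [measurable]: "g \<in> borel_measurable borel"
    using H by (auto simp: borel_H1_def)
  define N where "N \<alpha> x = navg \<alpha> (\<lambda>y. ennreal (norm (g y))) x" for \<alpha> x
  define W where "W \<alpha> = ennreal (R * indicator {a..b} \<alpha> / \<alpha>\<^sup>2)" for \<alpha> :: real
  define I where "I = (\<integral>\<^sup>+y. ennreal ((norm (g y))\<^sup>2) \<partial>lborel)"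
  have [measurable]: "N \<alpha> \<in> borel_measurable borel" "(\<lambda>\<alpha>. N \<alpha> x) \<in> borel_measurable borel"
    "(\<lambda>p. N (snd p) (fst p)) \<in> borel_measurable (borel \<Otimes>\<^sub>M borel)"  for \<alpha> x
    unfolding N_def by measurable
  have [measurable]: "W \<in> borel_measurable borel" unfolding W_def by measurable
  have 1: "ennreal ((avg b f x - avg a f x)\<^sup>2) * indicator P x \<le>
      (\<integral>\<^sup>+\<alpha>. W \<alpha> \<partial>lborel) * (\<integral>\<^sup>+\<alpha>. W \<alpha> * (N \<alpha> x)\<^sup>2 \<partial>lborel)" for x
  proof (cases "x \<in> P")
    case True
    then show ?thesis unfolding W_def N_def using avg_diff_square[OF H a cone] by simp
  qed simp
  have "(\<integral>\<^sup>+x\<in>P. ennreal ((avg b f x - avg a f x)\<^sup>2) \<partial>lborel) \<le>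
     (\<integral>\<^sup>+x. (\<integral>\<^sup>+\<alpha>. W \<alpha> \<partial>lborel) * (\<integral>\<^sup>+\<alpha>. W \<alpha> * (N \<alpha> x)\<^sup>2 \<partial>lborel) \<partial>lborel)"
    by (intro nn_integral_mono 1)
  also have "\<dots> = (\<integral>\<^sup>+\<alpha>. W \<alpha> \<partial>lborel) * (\<integral>\<^sup>+x. (\<integral>\<^sup>+\<alpha>. W \<alpha> * (N \<alpha> x)\<^sup>2 \<partial>lborel) \<partial>lborel)"
    by (rule nn_integral_cmult) measurable
  finally have A: "(\<integral>\<^sup>+x\<in>P. ennreal ((avg b f x - avg a f x)\<^sup>2) \<partial>lborel) \<le>
     (\<integral>\<^sup>+\<alpha>. W \<alpha> \<partial>lborel) * (\<integral>\<^sup>+x. (\<integral>\<^sup>+\<alpha>. W \<alpha> * (N \<alpha> x)\<^sup>2 \<partial>lborel) \<partial>lborel)" .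
  have "(\<integral>\<^sup>+x. (\<integral>\<^sup>+\<alpha>. W \<alpha> * (N \<alpha> x)\<^sup>2 \<partial>lborel) \<partial>lborel) =
     (\<integral>\<^sup>+\<alpha>. (\<integral>\<^sup>+x. W \<alpha> * (N \<alpha> x)\<^sup>2 \<partial>lborel) \<partial>lborel)"
    by (rule lborel_pair.Fubini'[symmetric]) measurable
  also have "\<dots> = (\<integral>\<^sup>+\<alpha>. W \<alpha> * (\<integral>\<^sup>+x. (N \<alpha> x)\<^sup>2 \<partial>lborel) \<partial>lborel)"
    by (intro nn_integral_cong nn_integral_cmult) measurable
  also have "\<dots> \<le> (\<integral>\<^sup>+\<alpha>. W \<alpha> * I \<partial>lborel)"
  proof (rule nn_integral_mono)
    fix \<alpha> :: real
    show "W \<alpha> * (\<integral>\<^sup>+x. (N \<alpha> x)\<^sup>2 \<partial>lborel) \<le> W \<alpha> * I"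
    proof (cases "\<alpha> \<in> {a..b}")
      case True
      then show ?thesis using navg_square_L2[of \<alpha> "\<lambda>y. ennreal (norm (g y))"] a
        by (intro mult_left_mono) (auto simp: N_def I_def ennreal_power)
    qed (simp add: W_def)
  qed
  also have "\<dots> = (\<integral>\<^sup>+\<alpha>. W \<alpha> \<partial>lborel) * I" by (rule nn_integral_multc) measurable
  finally have "(\<integral>\<^sup>+x. (\<integral>\<^sup>+\<alpha>. W \<alpha> * (N \<alpha> x)\<^sup>2 \<partial>lborel) \<partial>lborel) \<le> (\<integral>\<^sup>+\<alpha>. W \<alpha> \<partial>lborel) * I" .
  from mult_left_mono[OF this, of "\<integral>\<^sup>+\<alpha>. W \<alpha> \<partial>lborel"] A
  have "(\<integral>\<^sup>+x\<in>P. ennreal ((avg b f x - avg a f x)\<^sup>2) \<partial>lborel) \<le>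
     (\<integral>\<^sup>+\<alpha>. W \<alpha> \<partial>lborel) * ((\<integral>\<^sup>+\<alpha>. W \<alpha> \<partial>lborel) * I)"
    by (auto intro: order_trans)
  also have "\<dots> \<le> ennreal (R / a) * (ennreal (R / a) * I)"
    unfolding W_def by (intro mult_mono nn_integral_inverse_square_le a) auto
  finally show ?thesis by (simp add: I_def power2_eq_square[of "ennreal (R / a)"] mult.assoc)
qed

section \<open>Averages as an approximation of the identity in L_1\<close>

lemma ker_mult_integrable_L1:
  assumes "0 < a" and f: "integrable lborel f"
  shows "integrable lborel (\<lambda>y. ker a (y - x) * f y)"
proof (rule Bochner_Integration.integrable_bound)
  have [measurable]: "f \<in> borel_measurable borel" using f by auto
  show "(\<lambda>y. ker a (y - x) * f y) \<in> borel_measurable lborel" by measurable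
  show "integrable lborel (\<lambda>y. (K * a ^ CARD('n)) * f y)" using f by simp
  have "\<bar>ker a (y - x)\<bar> \<le> \<bar>K * a ^ CARD('n)\<bar>" for y
    using ker_nonneg[of a "y - x"] ker_le[of a "y - x"] assms by simp
  then show "AE y in lborel. norm (ker a (y - x) * f y) \<le> norm ((K * a ^ CARD('n)) * f y)"
    unfolding real_norm_def abs_mult[of _ "f _"] by (intro AE_I2 mult_right_mono) auto
qed

lemma avg_add_L1:
  assumes "0 < a" "integrable lborel f" "integrable lborel g"
  shows "avg a (\<lambda>y. f y + g y) x = avg a f x + avg a g x"
  unfolding avg_def using ker_mult_integrable_L1[OF assms(1,2)] ker_mult_integrable_L1[OF assms(1,3)]
  by (simp add: distrib_left)

lemma avg_cmult: "avg a (\<lambda>y. c * f y) x = c * avg a f x"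
  by (simp add: avg_def mult.left_commute)

lemma avg_L1:
  assumes "0 < a" and [measurable]: "f \<in> borel_measurable borel"
  shows "(\<integral>\<^sup>+x. ennreal \<bar>avg a f x\<bar> \<partial>lborel) \<le> (\<integral>\<^sup>+x. ennreal \<bar>f x\<bar> \<partial>lborel)"
proof -
  have "(\<integral>\<^sup>+x. ennreal \<bar>avg a f x\<bar> \<partial>lborel) \<le> (\<integral>\<^sup>+x. navg a (\<lambda>y. ennreal \<bar>f y\<bar>) x \<partial>lborel)"
    by (intro nn_integral_mono avg_abs_le assms)
  also have "\<dots> = (\<integral>\<^sup>+x. ennreal \<bar>f x\<bar> \<partial>lborel)"
    by (intro nn_integral_navg assms) auto
  finally show ?thesis .
qed

lemma avg_integrable:
  assumes "0 < a" and f: "integrable lborel f"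
  shows "integrable lborel (avg a f)"
proof (rule integrableI_bounded)
  have [measurable]: "f \<in> borel_measurable borel" using f by auto
  show "avg a f \<in> borel_measurable lborel" by measurable
  show "(\<integral>\<^sup>+x. ennreal (norm (avg a f x)) \<partial>lborel) < \<infinity>"
    using avg_L1[OF assms(1), of f] f by (simp add: integrable_iff_bounded order_le_less_trans)
qed

definition approximates :: "(real ^ 'n \<Rightarrow> real) \<Rightarrow> bool" where
  "approximates f \<longleftrightarrow> integrable lborel f \<and>
     (\<lambda>k::nat. \<integral>\<^sup>+x. ennreal \<bar>avg (2 ^ k) f x - f x\<bar> \<partial>lborel) \<longlonglongrightarrow> 0"

text \<open>Averaging contracts L_1, so the property passes to L_1 limits. Of the three error terms
  two are at most |f - h|_1 and the third is the error of h; three quarters of e leave room for the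
  strict inequality.\<close>

lemma approximatesI:
  assumes f: "integrable lborel f"
    and h: "\<And>e. 0 < e \<Longrightarrow> \<exists>h. approximates h \<and> (\<integral>\<^sup>+x. ennreal \<bar>f x - h x\<bar> \<partial>lborel) \<le> ennreal e"
  shows "approximates f"
proof -
  have "(\<lambda>k::nat. \<integral>\<^sup>+x. ennreal \<bar>avg (2 ^ k) f x - f x\<bar> \<partial>lborel) \<longlonglongrightarrow> 0"
  proof (rule tendsto_zero_ennreal)
    fix e :: real assume e: "0 < e"
    obtain h where h: "approximates h" "(\<integral>\<^sup>+x. ennreal \<bar>f x - h x\<bar> \<partial>lborel) \<le> ennreal (e / 4)"
      using h[of "e / 4"] e by auto
    have hi: "integrable lborel h" using h by (simp add: approximates_def)
    have [measurable]: "f \<in> borel_measurable borel" "h \<in> borel_measurable borel" using f hi by auto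
    have "eventually (\<lambda>k::nat. (\<integral>\<^sup>+x. ennreal \<bar>avg (2 ^ k) h x - h x\<bar> \<partial>lborel) < ennreal (e / 4)) sequentially"
      using h(1) e by (auto simp: approximates_def intro: order_tendstoD)
    then show "eventually (\<lambda>k::nat. (\<integral>\<^sup>+x. ennreal \<bar>avg (2 ^ k) f x - f x\<bar> \<partial>lborel) < ennreal e) sequentially"
    proof eventually_elim
      case (elim k)
      let ?d = "\<lambda>y. f y - h y"
      have di: "integrable lborel ?d" using f hi by simp
      have split: "avg (2 ^ k) f x = avg (2 ^ k) ?d x + avg (2 ^ k) h x" for x
        using avg_add_L1[of "2 ^ k" ?d h x] di hi by simp
      have "(\<integral>\<^sup>+x. ennreal \<bar>avg (2 ^ k) f x - f x\<bar> \<partial>lborel)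
         \<le> (\<integral>\<^sup>+x. ennreal \<bar>avg (2 ^ k) ?d x\<bar> + (ennreal \<bar>avg (2 ^ k) h x - h x\<bar> + ennreal \<bar>?d x\<bar>) \<partial>lborel)"
        by (rule nn_integral_mono) (auto simp: split simp flip: ennreal_plus intro!: ennreal_leI)
      also have "\<dots> = (\<integral>\<^sup>+x. ennreal \<bar>avg (2 ^ k) ?d x\<bar> \<partial>lborel) +
           ((\<integral>\<^sup>+x. ennreal \<bar>avg (2 ^ k) h x - h x\<bar> \<partial>lborel) + (\<integral>\<^sup>+x. ennreal \<bar>?d x\<bar> \<partial>lborel))"
        by (simp add: nn_integral_add)
      also have "\<dots> \<le> ennreal (e / 4) + (ennreal (e / 4) + ennreal (e / 4))"
        using avg_L1[of "2 ^ k" ?d] h(2) elim by (intro add_mono) (auto intro: order_trans)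
      also have "\<dots> < ennreal e" using e by (simp flip: ennreal_plus add: ennreal_less_iff)
      finally show ?case .
    qed
  qed
  with f show ?thesis by (simp add: approximates_def)
qed

text \<open>At a point of U the average \<open>A k\<close> equals 1 as soon as the kernel support
  fits into U. Outside U nothing is known pointwise, but \<open>A k\<close> lies between 0 and 1 and
  has the total mass of U, so the L_1 error equals 2 |U| minus twice the integral of
  \<open>A k\<close> over U.\<close>

lemma approximates_open:
  assumes U: "open U" "emeasure lborel U < \<infinity>"
  shows "approximates (indicator U)"
proof -
  have [measurable]: "U \<in> sets borel" using U by simp
  have iU: "integrable lborel (indicator U :: _ \<Rightarrow> real)" using U by (intro integrable_real_indicator) auto
  define A where "A k x = avg (2 ^ k) (indicator U) x" for k :: nat and x
  have A0: "0 \<le> A k x" for k x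
    unfolding A_def avg_def using ker_nonneg by (intro Bochner_Integration.integral_nonneg) auto
  have one: "(\<integral>y. ker a (y - x) \<partial>lborel) = 1" if "0 < a" for a x
    using nn_integral_ker[OF that, of x] ker_nonneg[of a] that
    by (intro nn_integral_eq_integral[OF ker_integrable, THEN trans[OF sym], THEN ennreal_inj[THEN iffD1, rotated 2, of _ 1]] | simp add: integral_eq_nn_integral)+
  have A1: "A k x \<le> 1" for k x
  proof -
    have "A k x \<le> (\<integral>y. ker (2 ^ k) (y - x) \<partial>lborel)"
      unfolding A_def avg_def using ker_nonneg[of "2 ^ k"] iU
      by (intro Bochner_Integration.integral_mono ker_mult_integrable_L1 ker_integrable) (auto split: split_indicator)
    then show ?thesis using one[of "2 ^ k" x] by simp
  qed
  have iA: "integrable lborel (A k)" for k unfolding A_def by (intro avg_integrable iU) auto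
  have [measurable]: "A k \<in> borel_measurable borel" for k using iA[of k] by auto
  have intA: "(\<integral>x. A k x \<partial>lborel) = measure lborel U" for k
  proof -
    have eq: "ennreal (A k x) = navg (2 ^ k) (\<lambda>y. ennreal (indicator U y)) x" for x
      unfolding A_def avg_def navg_def using iU ker_nonneg[of "2 ^ k"]
      by (subst nn_integral_eq_integral[symmetric])
        (auto intro!: ker_mult_integrable_L1 simp: ennreal_mult)
    have "(\<integral>\<^sup>+x. ennreal (A k x) \<partial>lborel) = emeasure lborel U"
      unfolding eq by (subst nn_integral_navg) (auto simp: ennreal_indicator)
    then show ?thesis using A0 by (subst integral_eq_nn_integral) (auto simp: measure_def)
  qed
  have lim: "(\<lambda>k. \<integral>x. indicator U x * A k x \<partial>lborel) \<longlonglongrightarrow> (\<integral>x. indicator U x * 1 \<partial>lborel)"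
  proof (rule integral_dominated_convergence[where w="indicator U"])
    show "AE x in lborel. (\<lambda>k. indicator U x * A k x) \<longlonglongrightarrow> indicator U x * 1"
    proof (intro AE_I2)
      fix x
      show "(\<lambda>k. indicator U x * A k x) \<longlonglongrightarrow> indicator U x * 1"
      proof (cases "x \<in> U")
        case True
        then obtain e where e: "0 < e" "cball x e \<subseteq> U" using U(1) open_contains_cball by blast
        have "(\<lambda>k. R * (1/2) ^ k) \<longlonglongrightarrow> R * 0" by (intro tendsto_intros) auto
        then have "eventually (\<lambda>k. R * (1/2) ^ k < e) sequentially" using e by (auto dest: order_tendstoD)
        then have "eventually (\<lambda>k. A k x = 1) sequentially"
        proof eventually_elim
          case (elim k)
          have "ker (2 ^ k) (y - x) * indicator U y = ker (2 ^ k) (y - x)" for y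
          proof (cases "ker (2 ^ k) (y - x) = 0")
            case False
            then have "norm (y - x) \<le> e" using ker_supp[of "2 ^ k" "y - x"] elim by (simp add: power_divide)
            then have "y \<in> U" using e by (auto simp: dist_norm norm_minus_commute subset_iff)
            then show ?thesis by simp
          qed simp
          then show ?case unfolding A_def avg_def using one[of "2 ^ k" x] by (simp only:) simp
        qed
        then show ?thesis using True by (simp add: tendsto_eventually)
      qed simp
    qed
  qed (use iU A0 A1 in \<open>auto split: split_indicator\<close>)
  have "(\<lambda>k. 2 * measure lborel U - 2 * (\<integral>x. indicator U x * A k x \<partial>lborel)) \<longlonglongrightarrow>
     2 * measure lborel U - 2 * (\<integral>x. indicator U x * 1 \<partial>lborel)"
    by (intro tendsto_intros lim)
  then have "(\<lambda>k. 2 * measure lborel U - 2 * (\<integral>x. indicator U x * A k x \<partial>lborel)) \<longlonglongrightarrow> 0" by simp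
  moreover have "(\<integral>\<^sup>+x. ennreal \<bar>A k x - indicator U x\<bar> \<partial>lborel) =
    ennreal (2 * measure lborel U - 2 * (\<integral>x. indicator U x * A k x \<partial>lborel))" for k
  proof -
    have iUA: "integrable lborel (\<lambda>x. indicator U x * A k x)"
      using integrable_real_mult_indicator[OF _ iA[of k], of U] by (simp add: mult.commute)
    have "(\<integral>\<^sup>+x. ennreal \<bar>A k x - indicator U x\<bar> \<partial>lborel) = ennreal (\<integral>x. \<bar>A k x - indicator U x\<bar> \<partial>lborel)"
      using iA iU by (intro nn_integral_eq_integral) auto
    also have "(\<integral>x. \<bar>A k x - indicator U x\<bar> \<partial>lborel) = (\<integral>x. A k x + indicator U x - 2 * (indicator U x * A k x) \<partial>lborel)"
      using A0[of k] A1[of k] by (intro Bochner_Integration.integral_cong) (auto split: split_indicator)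
    also have "(\<integral>x. A k x + indicator U x - 2 * (indicator U x * A k x) \<partial>lborel) =
       2 * measure lborel U - 2 * (\<integral>x. indicator U x * A k x \<partial>lborel)"
      using iA iU iUA by (simp add: intA)
    finally show ?thesis .
  qed
  ultimately have "(\<lambda>k. \<integral>\<^sup>+x. ennreal \<bar>A k x - indicator U x\<bar> \<partial>lborel) \<longlonglongrightarrow> ennreal 0"
    by (simp only: tendsto_ennrealI)
  then show ?thesis
    using iU unfolding approximates_def A_def by simp
qed

text \<open>Outer regularity carries the case of open sets to Borel sets of finite measure;
  linearity and closedness under L_1 limits do the rest.\<close>

lemma approximates_integrable:
  assumes "integrable lborel f"
  shows "approximates f"
  using assms
proof (induction rule: integrable_induct)
  case (base A c)
  then have [measurable]: "A \<in> sets borel" by simp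
  have ind: "approximates (indicator A)"
  proof (rule approximatesI)
    show "integrable lborel (indicator A :: _ \<Rightarrow> real)" using base by (intro integrable_real_indicator) auto
    fix e :: real assume e: "0 < e"
    obtain U where U: "open U" "A \<subseteq> U" "emeasure lborel (U - A) < ennreal e"
      using outer_regular_lborel[of A e] e by auto
    have [measurable]: "U \<in> sets borel" using U by simp
    have "emeasure lborel U \<le> emeasure lborel A + emeasure lborel (U - A)"
      using emeasure_subadditive[of A lborel "U - A"] U(2) by (simp add: Un_absorb1)
    also have "\<dots> < \<infinity>" using base U by (simp add: less_top[symmetric]) (metis ennreal_less_top order_less_trans less_top)
    finally have "approximates (indicator U)" by (intro approximates_open U)
    moreover have "(\<integral>\<^sup>+x. ennreal \<bar>indicator A x - indicator U x\<bar> \<partial>lborel) = (\<integral>\<^sup>+x. indicator (U - A) x \<partial>lborel)"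
      using U(2) by (intro nn_integral_cong) (auto split: split_indicator)
    ultimately show "\<exists>h. approximates h \<and> (\<integral>\<^sup>+x. ennreal \<bar>indicator A x - h x\<bar> \<partial>lborel) \<le> ennreal e"
      using U(3) by (intro exI[of _ "indicator U"]) (auto simp: nn_integral_indicator)
  qed
  have "ennreal \<bar>avg (2 ^ k) (\<lambda>x. c * indicator A x) x - c * indicator A x\<bar> =
      ennreal \<bar>c\<bar> * ennreal \<bar>avg (2 ^ k) (indicator A) x - indicator A x\<bar>" for k :: nat and x
    by (simp add: avg_cmult abs_mult flip: ennreal_mult right_diff_distrib)
  then have "(\<integral>\<^sup>+x. ennreal \<bar>avg (2 ^ k) (\<lambda>x. c * indicator A x) x - c * indicator A x\<bar> \<partial>lborel) =
     ennreal \<bar>c\<bar> * (\<integral>\<^sup>+x. ennreal \<bar>avg (2 ^ k) (indicator A) x - indicator A x\<bar> \<partial>lborel)" for k :: nat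
    by (simp add: nn_integral_cmult)
  moreover have "(\<lambda>k::nat. ennreal \<bar>c\<bar> * (\<integral>\<^sup>+x. ennreal \<bar>avg (2 ^ k) (indicator A) x - indicator A x\<bar> \<partial>lborel)) \<longlonglongrightarrow> ennreal \<bar>c\<bar> * 0"
    using ind by (intro ennreal_tendsto_cmult) (auto simp: approximates_def)
  moreover have "(\<lambda>x. indicator A x *\<^sub>R c) = (\<lambda>x. c * indicator A x)" by (simp add: mult.commute)
  ultimately show ?case using ind by (simp add: approximates_def)
next
  case (add f g)
  have [measurable]: "f \<in> borel_measurable borel" "g \<in> borel_measurable borel" using add by auto
  have lim: "(\<lambda>k::nat. (\<integral>\<^sup>+x. ennreal \<bar>avg (2 ^ k) f x - f x\<bar> \<partial>lborel) + (\<integral>\<^sup>+x. ennreal \<bar>avg (2 ^ k) g x - g x\<bar> \<partial>lborel)) \<longlonglongrightarrow> 0 + 0"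
    using add by (intro tendsto_intros) (auto simp: approximates_def)
  have "(\<integral>\<^sup>+x. ennreal \<bar>avg (2 ^ k) (\<lambda>x. f x + g x) x - (f x + g x)\<bar> \<partial>lborel) \<le>
     (\<integral>\<^sup>+x. ennreal \<bar>avg (2 ^ k) f x - f x\<bar> \<partial>lborel) + (\<integral>\<^sup>+x. ennreal \<bar>avg (2 ^ k) g x - g x\<bar> \<partial>lborel)" for k :: nat
  proof -
    have "(\<integral>\<^sup>+x. ennreal \<bar>avg (2 ^ k) (\<lambda>x. f x + g x) x - (f x + g x)\<bar> \<partial>lborel) \<le>
       (\<integral>\<^sup>+x. ennreal \<bar>avg (2 ^ k) f x - f x\<bar> + ennreal \<bar>avg (2 ^ k) g x - g x\<bar> \<partial>lborel)"
    proof (rule nn_integral_mono)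
      fix x
      have "\<bar>avg (2 ^ k) (\<lambda>x. f x + g x) x - (f x + g x)\<bar> \<le> \<bar>avg (2 ^ k) f x - f x\<bar> + \<bar>avg (2 ^ k) g x - g x\<bar>"
        using avg_add_L1[of "2 ^ k" f g x] add by simp
      then show "ennreal \<bar>avg (2 ^ k) (\<lambda>x. f x + g x) x - (f x + g x)\<bar> \<le> ennreal \<bar>avg (2 ^ k) f x - f x\<bar> + ennreal \<bar>avg (2 ^ k) g x - g x\<bar>"
        by (simp add: ennreal_leI flip: ennreal_plus)
    qed
    also have "\<dots> = (\<integral>\<^sup>+x. ennreal \<bar>avg (2 ^ k) f x - f x\<bar> \<partial>lborel) + (\<integral>\<^sup>+x. ennreal \<bar>avg (2 ^ k) g x - g x\<bar> \<partial>lborel)"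
      by (intro nn_integral_add) measurable
    finally show ?thesis .
  qed
  then have "(\<lambda>k::nat. \<integral>\<^sup>+x. ennreal \<bar>avg (2 ^ k) (\<lambda>x. f x + g x) x - (f x + g x)\<bar> \<partial>lborel) \<longlonglongrightarrow> 0"
    by (intro tendsto_sandwich[OF _ _ tendsto_const lim[simplified add_0]] always_eventually allI) (rule zero_le)
  then show ?case using add by (simp add: approximates_def)
next
  case (lim f s)
  show ?case
  proof (rule approximatesI)
    show "integrable lborel f" by fact
    fix e :: real assume e: "0 < e"
    have [measurable]: "f \<in> borel_measurable borel" "s i \<in> borel_measurable borel" for i using lim by auto
    have "(\<lambda>i. \<integral>\<^sup>+x. ennreal (norm (f x - s i x)) \<partial>lborel) \<longlonglongrightarrow> 0"
    proof (rule nn_integral_dominated_convergence_norm[where w="\<lambda>x. 2 * norm (f x)"])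
      have "(\<integral>\<^sup>+x. ennreal (2 * norm (f x)) \<partial>lborel) = 2 * (\<integral>\<^sup>+x. ennreal (norm (f x)) \<partial>lborel)"
        by (subst nn_integral_cmult[symmetric]) (auto simp: ennreal_mult)
      then show "(\<integral>\<^sup>+x. ennreal (2 * norm (f x)) \<partial>lborel) < \<infinity>"
        using \<open>integrable lborel f\<close> by (auto simp: integrable_iff_bounded ennreal_mult_less_top)
    qed (use lim in auto)
    then have "eventually (\<lambda>i. (\<integral>\<^sup>+x. ennreal (norm (f x - s i x)) \<partial>lborel) < ennreal e) sequentially"
      by (rule order_tendstoD(2)) (use e in simp)
    then obtain i where "(\<integral>\<^sup>+x. ennreal (norm (f x - s i x)) \<partial>lborel) < ennreal e"
      by (auto dest: eventually_happens)
    then show "\<exists>h. approximates h \<and> (\<integral>\<^sup>+x. ennreal \<bar>f x - h x\<bar> \<partial>lborel) \<le> ennreal e"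
      using lim by (intro exI[of _ "s i"]) auto
  qed
qed

text \<open>The limit b \<rightarrow> \<infinity> of the L_2 estimate for differences. Convergence
  in L_1 yields a sequence of scales along which the averages converge to f almost everywhere, and
  Fatou's lemma preserves the bound because it is uniform in b.\<close>

lemma avg_error_L2:
  assumes H: "borel_H1 \<Omega> f g" and a: "0 < a" and [measurable]: "P \<in> sets borel"
    and f1: "integrable lborel f"
    and cone: "\<And>x z \<alpha>. x \<in> P \<Longrightarrow> z \<in> S \<Longrightarrow> a \<le> \<alpha> \<Longrightarrow> x + (1 / \<alpha>) *\<^sub>R z \<in> \<Omega>"
  shows "(\<integral>\<^sup>+x\<in>P. ennreal ((f x - avg a f x)\<^sup>2) \<partial>lborel) \<le>
    (ennreal (R / a))\<^sup>2 * (\<integral>\<^sup>+y. ennreal ((norm (g y))\<^sup>2) \<partial>lborel)"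
proof -
  have [measurable]: "f \<in> borel_measurable borel" using f1 by auto
  define d where "d k x = avg (2 ^ k) f x - f x" for k :: nat and x
  have id: "integrable lborel (d k)" for k
    unfolding d_def using f1 by (intro Bochner_Integration.integrable_diff avg_integrable) auto
  have "(\<lambda>k. \<integral>\<^sup>+x. ennreal \<bar>d k x\<bar> \<partial>lborel) \<longlonglongrightarrow> ennreal 0"
    using approximates_integrable[OF f1] by (simp add: approximates_def d_def)
  moreover have "(\<integral>\<^sup>+x. ennreal \<bar>d k x\<bar> \<partial>lborel) = ennreal (\<integral>x. norm (d k x) \<partial>lborel)" for k
    using id[of k] by (subst nn_integral_eq_integral) auto
  ultimately have "(\<lambda>k. ennreal (\<integral>x. norm (d k x) \<partial>lborel)) \<longlonglongrightarrow> ennreal 0" by simp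
  then have "(\<lambda>k. \<integral>x. norm (d k x) \<partial>lborel) \<longlonglongrightarrow> 0"
    by (subst (asm) tendsto_ennreal_iff) auto
  from tendsto_L1_AE_subseq[OF id this] obtain r where r: "strict_mono r"
    "AE x in lborel. (\<lambda>n. d (r n) x) \<longlonglongrightarrow> 0" by blast
  define u where "u n x = ennreal ((avg (2 ^ r n) f x - avg a f x)\<^sup>2) * indicator P x" for n x
  have [measurable]: "u n \<in> borel_measurable lborel" for n unfolding u_def by measurable
  have "(\<integral>\<^sup>+x\<in>P. ennreal ((f x - avg a f x)\<^sup>2) \<partial>lborel) \<le> (\<integral>\<^sup>+x. liminf (\<lambda>n. u n x) \<partial>lborel)"
  proof (rule nn_integral_mono_AE, use r(2) in eventually_elim)
    case (elim x)
    then have "(\<lambda>n. d (r n) x + f x) \<longlonglongrightarrow> 0 + f x" by (intro tendsto_intros)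
    then have "(\<lambda>n. avg (2 ^ r n) f x) \<longlonglongrightarrow> f x" by (simp add: d_def)
    then have "(\<lambda>n. ennreal ((avg (2 ^ r n) f x - avg a f x)\<^sup>2)) \<longlonglongrightarrow> ennreal ((f x - avg a f x)\<^sup>2)"
      by (intro tendsto_ennrealI tendsto_intros)
    then have "(\<lambda>n. u n x) \<longlonglongrightarrow> ennreal ((f x - avg a f x)\<^sup>2) * indicator P x"
      by (cases "x \<in> P") (auto simp: u_def)
    then show ?case by (metis lim_imp_Liminf order_refl trivial_limit_sequentially)
  qed
  also have "\<dots> \<le> liminf (\<lambda>n. \<integral>\<^sup>+x. u n x \<partial>lborel)"
    by (rule nn_integral_liminf) measurable
  also have "\<dots> \<le> (ennreal (R / a))\<^sup>2 * (\<integral>\<^sup>+y. ennreal ((norm (g y))\<^sup>2) \<partial>lborel)"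
  proof -
    have "filterlim (\<lambda>n. (2::real) ^ n) at_top sequentially"
      using filterlim_realpow_sequentially_gt1[of "2::real"] by (simp add: filterlim_at_infinity_imp_filterlim_at_top)
    then have "filterlim (\<lambda>n. (2::real) ^ r n) at_top sequentially"
      by (rule filterlim_compose[OF _ filterlim_subseq[OF r(1)]])
    then have "eventually (\<lambda>n. a \<le> 2 ^ r n) sequentially"
      by (simp add: filterlim_at_top)
    then have "eventually (\<lambda>n. (\<integral>\<^sup>+x. u n x \<partial>lborel) \<le> (ennreal (R / a))\<^sup>2 * (\<integral>\<^sup>+y. ennreal ((norm (g y))\<^sup>2) \<partial>lborel)) sequentially"
      unfolding u_def by eventually_elim (intro avg_diff_L2[OF H a(1)] cone, auto)
    then show ?thesis
      by (intro order_trans[OF Liminf_mono Liminf_le_Limsup[THEN order_trans, OF _ Limsup_bounded]]) auto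
  qed
  finally show ?thesis .
qed

end

section \<open>Cones in Lipschitz domains\<close>

text \<open>Squaring the positive part makes it continuously differentiable, so a paraboloid can be
  cut off at level 0 without losing the derivative.\<close>

lemma DERIV_max0_square: "((\<lambda>t::real. (max 0 t)\<^sup>2) has_real_derivative 2 * max 0 t) (at t)"
proof -
  consider "t < 0" | "t = 0" | "0 < t" by linarith
  then show ?thesis
  proof cases
    case 1
    have "((\<lambda>_. 0) has_real_derivative 2 * max 0 t) (at t)" using 1 by simp
    then show ?thesis
      by (rule has_field_derivative_transform_within_open[of _ _ _ "{..<0}"]) (use 1 in auto)
  next
    case 2
    have "((\<lambda>h. (max 0 h)\<^sup>2 / h) \<longlongrightarrow> 0) (at (0::real))"
    proof (rule Lim_null_comparison[where g="\<lambda>h. \<bar>h\<bar>"])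
      show "eventually (\<lambda>h::real. norm ((max 0 h)\<^sup>2 / h) \<le> \<bar>h\<bar>) (at 0)"
        by (intro always_eventually allI) (auto simp: max_def power2_eq_square)
      show "((\<lambda>h. \<bar>h\<bar>) \<longlongrightarrow> 0) (at (0::real))" by (rule tendsto_eq_intros | simp)+
    qed
    then show ?thesis using 2 by (simp add: DERIV_def)
  next
    case 3
    have "((\<lambda>t. t\<^sup>2) has_real_derivative 2 * max 0 t) (at t)" using 3 by (auto intro!: derivative_eq_intros)
    then show ?thesis
      by (rule has_field_derivative_transform_within_open[of _ _ _ "{0<..}"]) (use 3 in auto)
  qed
qed

text \<open>The bump is the squared positive part of r^2 - |z - z0|^2, divided by its integral. It
  is only C^1, which matches the class of test functions in the definition of weak
  gradients.\<close>

lemma ex_averaging_kernel: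
  fixes z0 :: "real ^ 'n"
  assumes r: "0 < r"
  shows "\<exists>\<rho> d\<rho> R K. averaging_kernel \<rho> d\<rho> (cball z0 r) R K"
proof -
  define b where "b z = (max 0 (r\<^sup>2 - (z - z0) \<bullet> (z - z0)))\<^sup>2" for z
  define db where "db z = (2 * max 0 (r\<^sup>2 - (z - z0) \<bullet> (z - z0))) *\<^sub>R (- 2 *\<^sub>R (z - z0))" for z
  have gd: "GDERIV b z :> db z" for z
    unfolding b_def db_def
  proof (rule GDERIV_DERIV_compose[OF _ DERIV_max0_square])
    show "GDERIV (\<lambda>z. r\<^sup>2 - (z - z0) \<bullet> (z - z0)) z :> - 2 *\<^sub>R (z - z0)"
      unfolding gderiv_def by (auto intro!: derivative_eq_intros simp: inner_commute algebra_simps)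
  qed
  have cb: "continuous_on UNIV b" and cd: "continuous_on UNIV db"
    unfolding b_def db_def by (intro continuous_intros)+
  have [measurable]: "b \<in> borel_measurable borel" by (rule borel_measurable_continuous_onI[OF cb])
  have nn: "0 \<le> b z" for z by (simp add: b_def)
  have sup: "z \<in> cball z0 r" if "b z \<noteq> 0" for z
  proof -
    have "0 < r\<^sup>2 - (z - z0) \<bullet> (z - z0)" using that by (auto simp: b_def max_def split: if_splits)
    then have "(norm (z - z0))\<^sup>2 < r\<^sup>2" by (simp add: power2_norm_eq_inner)
    then have "norm (z - z0) < r" using r power_less_imp_less_base[of "norm (z - z0)" 2 r] by simp
    then show ?thesis by (simp add: dist_norm norm_minus_commute)
  qed
  have ble: "b z \<le> (r\<^sup>2)\<^sup>2" for z
    unfolding b_def by (intro power_mono) auto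
  define I where "I = (\<integral>\<^sup>+z. ennreal (b z) \<partial>lborel)"
  have "I \<le> (\<integral>\<^sup>+z. ennreal ((r\<^sup>2)\<^sup>2) * indicator (cball z0 r) z \<partial>lborel)"
    unfolding I_def
  proof (rule nn_integral_mono)
    show "ennreal (b z) \<le> ennreal ((r\<^sup>2)\<^sup>2) * indicator (cball z0 r) z" for z
      using ennreal_leI[OF ble[of z]] sup[of z] by (cases "b z = 0") auto
  qed
  also have "\<dots> = ennreal ((r\<^sup>2)\<^sup>2) * emeasure lborel (cball z0 r)"
    by (subst nn_integral_cmult_indicator) auto
  also have "\<dots> < \<infinity>" using emeasure_lborel_cball_finite[of z0 r] by (auto simp: ennreal_mult_less_top)
  finally have Ifin: "I < \<infinity>" .
  have Ipos: "I \<noteq> 0"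
  proof
    assume "I = 0"
    then have "AE z in lborel. b z = 0" unfolding I_def using nn
      by (subst (asm) nn_integral_0_iff_AE) (auto simp: ennreal_eq_0_iff order_antisym_conv)
    then have "AE z in lborel. z \<notin> ball z0 r"
    proof eventually_elim
      case (elim z)
      show ?case
      proof
        assume "z \<in> ball z0 r"
        then have "(norm (z - z0))\<^sup>2 < r\<^sup>2"
          by (intro power_strict_mono) (auto simp: dist_norm norm_minus_commute)
        then show False using elim by (simp add: b_def power2_norm_eq_inner)
      qed
    qed
    then have "emeasure lborel (ball z0 r) = 0"
      by (subst (asm) AE_iff_measurable[of "ball z0 r"]) auto
    then have "measure lborel (ball z0 r) = 0" by (simp add: measure_def)
    then show False using content_ball_pos[OF r, of z0] by simp
  qed
  define i where "i = enn2real I"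
  have i: "0 < i" "I = ennreal i" using Ifin Ipos by (auto simp: i_def enn2real_positive_iff less_top[symmetric] zero_less_iff_neq_zero)
  have "averaging_kernel (\<lambda>z. b z / i) (\<lambda>z. (1 / i) *\<^sub>R db z) (cball z0 r) (norm z0 + r) ((r\<^sup>2)\<^sup>2 / i)"
  proof
    fix z
    have "GDERIV (\<lambda>z. b z * (1 / i)) z :> b z *\<^sub>R 0 + (1 / i) *\<^sub>R db z"
      by (rule GDERIV_mult[OF gd GDERIV_const])
    then show "GDERIV (\<lambda>z. b z / i) z :> (1 / i) *\<^sub>R db z" by simp
    show "continuous_on UNIV (\<lambda>z. (1 / i) *\<^sub>R db z)" by (intro continuous_intros cd)
    show "0 \<le> b z / i" "b z / i \<le> (r\<^sup>2)\<^sup>2 / i" using nn ble i by (auto intro: divide_right_mono)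
    show "compact (cball z0 r)" by simp
    show "b z / i \<noteq> 0 \<Longrightarrow> z \<in> cball z0 r" using sup by auto
    show "z \<in> cball z0 r \<Longrightarrow> norm z \<le> norm z0 + r"
      using norm_triangle_sub[of z z0] by (simp add: dist_norm norm_minus_commute)
    have "(\<integral>\<^sup>+z. ennreal (b z / i) \<partial>lborel) = (\<integral>\<^sup>+z. ennreal (1 / i) * ennreal (b z) \<partial>lborel)"
      using i nn by (simp flip: ennreal_mult)
    also have "\<dots> = ennreal (1 / i) * I" unfolding I_def by (rule nn_integral_cmult) measurable
    also have "\<dots> = 1" using i by (simp flip: ennreal_mult)
    finally show "(\<integral>\<^sup>+z. ennreal (b z / i) \<partial>lborel) = 1" .
  qed
  then show ?thesis by blast
qed

text \<open>Near a boundary point the domain is the strict epigraph of a Lipschitz function, hence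
  stable under moving upwards within a cone around e whose opening depends on the Lipschitz
  constant. Near an interior point any short direction will do.\<close>

lemma lipschitz_domain_cone:
  fixes \<Omega> :: "(real ^ 'n) set"
  assumes L: "lipschitz_domain \<Omega>" and x0: "x0 \<in> closure \<Omega>"
  shows "\<exists>\<delta>>0. \<exists>z0. \<exists>r>0. \<forall>x\<in>\<Omega> \<inter> ball x0 \<delta>. \<forall>z\<in>cball z0 r. \<forall>t. 0 < t \<and> t \<le> 1 \<longrightarrow> x + t *\<^sub>R z \<in> \<Omega>"
proof (cases "x0 \<in> \<Omega>")
  case True
  have "open \<Omega>" using L by (simp add: lipschitz_domain_def)
  then obtain e where e: "0 < e" "ball x0 e \<subseteq> \<Omega>" using True open_contains_ball by blast
  have "x + t *\<^sub>R z \<in> \<Omega>" if "x \<in> ball x0 (e / 2)" "z \<in> cball 0 (e / 2)" "0 < t" "t \<le> 1" for x z t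
  proof -
    have "norm (t *\<^sub>R z) \<le> 1 * (e / 2)" using that unfolding norm_scaleR by (intro mult_mono) auto
    moreover have "norm (x - x0) < e / 2" using that by (simp add: dist_norm norm_minus_commute)
    moreover have "norm (x + t *\<^sub>R z - x0) \<le> norm (x - x0) + norm (t *\<^sub>R z)"
      using norm_triangle_ineq[of "x - x0" "t *\<^sub>R z"] by (simp add: algebra_simps)
    ultimately have "x + t *\<^sub>R z \<in> ball x0 e" by (simp add: dist_norm norm_minus_commute)
    then show ?thesis using e by auto
  qed
  then have "\<forall>x\<in>\<Omega> \<inter> ball x0 (e / 2). \<forall>z\<in>cball 0 (e / 2). \<forall>t. 0 < t \<and> t \<le> 1 \<longrightarrow> x + t *\<^sub>R z \<in> \<Omega>" by blast
  moreover have "0 < e / 2" using e by simp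
  ultimately show ?thesis by blast
next
  case False
  have "open \<Omega>" using L by (simp add: lipschitz_domain_def)
  then have "x0 \<in> frontier \<Omega>" using False x0 by (simp add: frontier_def interior_open)
  with L have "\<exists>r>0. \<exists>e \<gamma> L. norm e = 1 \<and> L-lipschitz_on {y. y \<bullet> e = 0} \<gamma> \<and>
        \<Omega> \<inter> ball x0 r = {y \<in> ball x0 r. \<gamma> (y - (y \<bullet> e) *\<^sub>R e) < y \<bullet> e}"
    unfolding lipschitz_domain_def by (elim conjE) (rule bspec)
  then obtain r0 e \<gamma> C where r0: "0 < r0" and e: "norm e = 1"
    and lip: "C-lipschitz_on {y. y \<bullet> e = 0} \<gamma>"
    and eq: "\<Omega> \<inter> ball x0 r0 = {y \<in> ball x0 r0. \<gamma> (y - (y \<bullet> e) *\<^sub>R e) < y \<bullet> e}"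
    by (elim exE conjE) (rule that)
  have C: "0 \<le> C" using lip lipschitz_on_nonneg by blast
  have ee: "e \<bullet> e = 1" using e by (simp add: norm_eq_1)
  \<comment> \<open>A direction within r of (r0/4) e gains at least r0/4 - r in height, while its
    tangential part, at most 2 r, raises the graph by at most 2 C r. The choice r (1 + 2 C) = r0/8
    makes the gain win and keeps |z| < r0/2.\<close>
  define r where "r = r0 / (8 * (1 + 2 * C))"
  have C8: "0 < 8 * (1 + 2 * C)" using C by simp
  then have r: "0 < r" using r0 by (simp add: r_def)
  have "r * (8 * (1 + 2 * C)) = r0"
    unfolding r_def using C8 by (intro nonzero_eq_divide_eq[THEN iffD1] refl) linarith
  then have r: "0 < r" "r * (1 + 2 * C) = r0 / 8" using r by (simp_all add: algebra_simps)
  have "r * 1 \<le> r * (1 + 2 * C)" using r C by (intro mult_left_mono) auto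
  then have r8: "r \<le> r0 / 8" using r by simp
  define z0 where "z0 = (r0 / 4) *\<^sub>R e"
  have "x + t *\<^sub>R z \<in> \<Omega>" if x: "x \<in> \<Omega>" "x \<in> ball x0 (r0 / 2)" and z: "z \<in> cball z0 r" and t: "0 < t" "t \<le> 1" for x z t
  proof -
    define d where "d = z - z0"
    have nd: "norm d \<le> r" using z by (simp add: d_def dist_norm norm_minus_commute)
    have zd: "z = (r0 / 4) *\<^sub>R e + d" by (simp add: d_def z0_def)
    define p where "p v = v - (v \<bullet> e) *\<^sub>R e" for v
    have pe: "p v \<bullet> e = 0" for v by (simp add: p_def inner_diff_left ee)
    have de: "\<bar>d \<bullet> e\<bar> \<le> r" using Cauchy_Schwarz_ineq2[of d e] e nd by simp
    have ze: "r0 / 4 - r \<le> z \<bullet> e" using de by (simp add: zd inner_add_left ee)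
    have "p z = d - (d \<bullet> e) *\<^sub>R e" by (simp add: p_def zd inner_add_left ee algebra_simps)
    then have "norm (p z) \<le> norm d + \<bar>d \<bullet> e\<bar> * norm e" using norm_triangle_ineq4[of d "(d \<bullet> e) *\<^sub>R e"] by simp
    then have pz: "norm (p z) \<le> 2 * r" using nd de e by simp
    have nz: "norm z < r0 / 2"
      using norm_triangle_ineq[of "(r0 / 4) *\<^sub>R e" d] nd r8 e r0 by (simp add: zd)
    have "norm (t *\<^sub>R z) \<le> 1 * norm z" using t unfolding norm_scaleR by (intro mult_right_mono) auto
    moreover have "norm (x - x0) < r0 / 2" using x by (simp add: dist_norm norm_minus_commute)
    moreover have "norm (x + t *\<^sub>R z - x0) \<le> norm (x - x0) + norm (t *\<^sub>R z)"
      using norm_triangle_ineq[of "x - x0" "t *\<^sub>R z"] by (simp add: algebra_simps)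
    ultimately have inb: "x + t *\<^sub>R z \<in> ball x0 r0" using nz by (simp add: dist_norm norm_minus_commute)
    have xb: "x \<in> ball x0 r0" using x r0 by simp
    then have gx: "\<gamma> (p x) < x \<bullet> e" using eq x(1) unfolding p_def by blast
    have pp: "p (x + t *\<^sub>R z) = p x + t *\<^sub>R p z"
      by (simp add: p_def inner_add_left scaleR_add_left scaleR_diff_right)
    have "dist (\<gamma> (p (x + t *\<^sub>R z))) (\<gamma> (p x)) \<le> C * dist (p (x + t *\<^sub>R z)) (p x)"
      using lip by (rule lipschitz_onD) (auto simp: pe)
    also have "dist (p (x + t *\<^sub>R z)) (p x) = t * norm (p z)" using t by (simp add: pp dist_norm)
    also have "C * (t * norm (p z)) \<le> C * (t * (2 * r))" using C t pz by (intro mult_left_mono) auto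
    finally have "\<gamma> (p (x + t *\<^sub>R z)) \<le> \<gamma> (p x) + t * (2 * C * r)" by (simp add: dist_real_def algebra_simps)
    also have "\<dots> < x \<bullet> e + t * (2 * C * r)" using gx by simp
    also have "\<dots> \<le> x \<bullet> e + t * (z \<bullet> e)"
    proof -
      have "2 * C * r = r0 / 8 - r" using r(2) by (simp add: algebra_simps)
      then have "2 * C * r \<le> z \<bullet> e" using ze r0 by simp
      then show ?thesis using t by (intro add_left_mono mult_left_mono) auto
    qed
    also have "\<dots> = (x + t *\<^sub>R z) \<bullet> e" by (simp add: inner_add_left)
    finally have "x + t *\<^sub>R z \<in> {y \<in> ball x0 r0. \<gamma> (y - (y \<bullet> e) *\<^sub>R e) < y \<bullet> e}"
      using inb by (simp add: p_def)
    then show ?thesis using eq by blast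
  qed
  then have "\<forall>x\<in>\<Omega> \<inter> ball x0 (r0 / 2). \<forall>z\<in>cball z0 r. \<forall>t. 0 < t \<and> t \<le> 1 \<longrightarrow> x + t *\<^sub>R z \<in> \<Omega>" by blast
  moreover have "0 < r0 / 2" using r0 by simp
  ultimately show ?thesis using r(1) by blast
qed

text \<open>Compactness is that of the closure, so centres on the boundary are needed as well; the
  pieces are then cut down to \<Omega>.\<close>

lemma lipschitz_domain_finite_cover:
  fixes \<Omega> :: "(real ^ 'n) set"
  assumes L: "lipschitz_domain \<Omega>" and b: "bounded \<Omega>"
  obtains \<P> where "finite \<P>" "\<Omega> = \<Union>\<P>" "\<And>P. P \<in> \<P> \<Longrightarrow> P \<in> sets borel \<and>
    (\<exists>z0. \<exists>r>0. \<forall>x\<in>P. \<forall>z\<in>cball z0 r. \<forall>t. 0 < t \<and> t \<le> 1 \<longrightarrow> x + t *\<^sub>R z \<in> \<Omega>)"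
proof -
  have op: "open \<Omega>" using L by (simp add: lipschitz_domain_def)
  obtain \<delta> where \<delta>: "\<And>x0. x0 \<in> closure \<Omega> \<Longrightarrow> 0 < \<delta> x0 \<and>
     (\<exists>z0. \<exists>r>0. \<forall>x\<in>\<Omega> \<inter> ball x0 (\<delta> x0). \<forall>z\<in>cball z0 r. \<forall>t. 0 < t \<and> t \<le> 1 \<longrightarrow> x + t *\<^sub>R z \<in> \<Omega>)"
    using lipschitz_domain_cone[OF L] by metis
  have "compact (closure \<Omega>)" using b by (simp add: compact_closure)
  moreover have "closure \<Omega> \<subseteq> \<Union>((\<lambda>x. ball x (\<delta> x)) ` closure \<Omega>)" using \<delta> by force
  ultimately obtain F where F: "F \<subseteq> closure \<Omega>" "finite F" "closure \<Omega> \<subseteq> \<Union>((\<lambda>x. ball x (\<delta> x)) ` F)"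
    using compactE_image[of "closure \<Omega>" "closure \<Omega>" "\<lambda>x. ball x (\<delta> x)"] by auto
  show thesis
  proof (rule that[of "(\<lambda>x. \<Omega> \<inter> ball x (\<delta> x)) ` F"])
    show "\<Omega> = \<Union>((\<lambda>x. \<Omega> \<inter> ball x (\<delta> x)) ` F)" using F(3) closure_subset[of \<Omega>] by blast
    fix P assume "P \<in> (\<lambda>x. \<Omega> \<inter> ball x (\<delta> x)) ` F"
    then obtain x0 where x0: "x0 \<in> F" "P = \<Omega> \<inter> ball x0 (\<delta> x0)" by auto
    then show "P \<in> sets borel \<and> (\<exists>z0. \<exists>r>0. \<forall>x\<in>P. \<forall>z\<in>cball z0 r. \<forall>t. 0 < t \<and> t \<le> 1 \<longrightarrow> x + t *\<^sub>R z \<in> \<Omega>)"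
      using \<delta>[of x0] F(1) op by (auto intro!: borel_open)
  qed (use F in auto)
qed

section \<open>A local Sobolev embedding\<close>

text \<open>
  At each dyadic scale \<open>2\<^sup>l\<close>, \<open>u\<close> splits into a part \<open>v\<^sub>l\<close> that is small in \<open>L\<^sub>2\<close> and a part \<open>w\<^sub>l\<close> with controlled
  gradient \<open>g\<^sub>l\<close>; this is the K-functional description of \<open>H\<^sup>s\<close> as an interpolation space between \<open>L\<^sub>2\<close> and \<open>H\<^sup>1\<close>.
\<close>

definition multiscale :: "(real ^ 'n) set \<Rightarrow> real \<Rightarrow> real \<Rightarrow> (real ^ 'n \<Rightarrow> real) \<Rightarrow> bool" where
  "multiscale \<Omega> s T u \<longleftrightarrow> u \<in> borel_measurable borel \<and> (\<integral>\<^sup>+x. ennreal ((u x)\<^sup>2) \<partial>lborel) \<le> ennreal (T\<^sup>2) \<and>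
     (\<exists>v w g V G. (\<forall>l::nat. v l \<in> borel_measurable borel \<and> borel_H1 \<Omega> (w l) (g l) \<and>
          (\<forall>x. x \<notin> \<Omega> \<longrightarrow> w l x = 0) \<and> (\<forall>x. u x = v l x + w l x) \<and> 0 \<le> V l \<and> 0 \<le> G l \<and>
          (\<integral>\<^sup>+x. ennreal ((v l x)\<^sup>2) \<partial>lborel) \<le> ennreal (V l) \<and>
          (\<integral>\<^sup>+x. ennreal ((norm (g l x))\<^sup>2) \<partial>lborel) \<le> ennreal (G l)) \<and>
        (\<forall>N. (\<Sum>l<N. 4 powr (real l * s) * (V l + (1/4) ^ l * G l)) \<le> T\<^sup>2))"

context averaging_kernel begin

lemma avg_square_le:
  assumes "0 < a" and [measurable]: "f \<in> borel_measurable borel"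
    and F: "(\<integral>\<^sup>+x. ennreal ((f x)\<^sup>2) \<partial>lborel) \<le> ennreal F" "0 \<le> F"
  shows "(avg a f x)\<^sup>2 \<le> K * a ^ CARD('n) * F"
proof -
  have "ennreal ((avg a f x)\<^sup>2) = (ennreal \<bar>avg a f x\<bar>)\<^sup>2" by (simp add: ennreal_power)
  also have "\<dots> \<le> (navg a (\<lambda>y. ennreal \<bar>f y\<bar>) x)\<^sup>2" by (intro power_mono avg_abs_le assms) auto
  also have "\<dots> \<le> ennreal (K * a ^ CARD('n)) * (\<integral>\<^sup>+y. (ennreal \<bar>f y\<bar>)\<^sup>2 \<partial>lborel)"
    by (intro navg_square_sup assms) auto
  also have "\<dots> \<le> ennreal (K * a ^ CARD('n)) * ennreal F"
    using F by (intro mult_left_mono) (auto simp: ennreal_power)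
  also have "\<dots> = ennreal (K * a ^ CARD('n) * F)"
    using K_nonneg assms by (intro ennreal_mult[symmetric]) auto
  finally show ?thesis using K_nonneg assms by (subst (asm) ennreal_le_iff) auto
qed

lemma avg_diff_square_le:
  assumes H: "borel_H1 \<Omega> f g" and a: "0 < a" "a \<le> b"
    and cone: "\<And>z \<alpha>. z \<in> S \<Longrightarrow> a \<le> \<alpha> \<Longrightarrow> x + (1 / \<alpha>) *\<^sub>R z \<in> \<Omega>"
    and G: "(\<integral>\<^sup>+x. ennreal ((norm (g x))\<^sup>2) \<partial>lborel) \<le> ennreal G" "0 \<le> G"
  shows "(avg b f x - avg a f x)\<^sup>2 \<le> (R / a)\<^sup>2 * (K * b ^ CARD('n) * G)"
proof -
  have "ennreal ((avg b f x - avg a f x)\<^sup>2) \<le> (ennreal (R / a))\<^sup>2 * (ennreal (K * b ^ CARD('n)) * (\<integral>\<^sup>+y. ennreal ((norm (g y))\<^sup>2) \<partial>lborel))"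
    by (rule avg_diff_sup[OF H a cone])
  also have "\<dots> \<le> (ennreal (R / a))\<^sup>2 * (ennreal (K * b ^ CARD('n)) * ennreal G)"
    by (intro mult_left_mono G) auto
  also have "\<dots> = ennreal ((R / a)\<^sup>2 * (K * b ^ CARD('n) * G))"
    using K_nonneg R_nonneg a G by (simp add: ennreal_mult ennreal_power)
  finally show ?thesis using K_nonneg R_nonneg a G by (subst (asm) ennreal_le_iff) auto
qed

text \<open>The critical exponent is the one for which two weights agree: since (q - 2) \<kappa> = 2
  s, the factor |u|^(q - 2) at level l is of size 4^(l s), up to constants and powers of T, and this
  is exactly the weight with which the squared errors of the averages can be summed.\<close>

lemma local_embedding:
  assumes bnd: "bounded \<Omega>" and [measurable]: "\<Omega> \<in> sets borel" "P \<in> sets borel"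
    and cone: "\<And>x z t. x \<in> P \<Longrightarrow> z \<in> S \<Longrightarrow> 0 < t \<Longrightarrow> t \<le> 1 \<Longrightarrow> x + t *\<^sub>R z \<in> \<Omega>"
    and s: "0 < s" "2 * s < real CARD('n)" and q: "q = 2 * real CARD('n) / (real CARD('n) - 2 * s)"
  shows "\<exists>C\<ge>0. \<forall>u T. 0 \<le> T \<longrightarrow> multiscale \<Omega> s T u \<longrightarrow>
     (\<integral>\<^sup>+x\<in>P. ennreal (\<bar>u x\<bar> powr q) \<partial>lborel) \<le> ennreal (C * T powr q)"
proof -
  define n where "n = real CARD('n)"
  define \<kappa> where "\<kappa> = n / 2 - s"
  define \<beta> where "\<beta> l = 2 powr (real l * \<kappa>)" for l :: nat
  \<comment> \<open>The factor 2^n is there because an increment between the scales l and l + 1 is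
    measured with the kernel height of the finer one. In \<open>C1\<close> below, 2 stands for the
    rough part at both scales and \<open>R\<close> for the gradient part.\<close>
  define C0 where "C0 = sqrt (K * 2 ^ CARD('n))"
  define C1 where "C1 = C0 * (2 + R)"
  \<comment> \<open>Chosen for the induction that bounds the averages: \<open>sqrt K\<close> starts
    it at l = 0, and the middle term absorbs an increment C1 \<beta>_l into the growth of \<beta>
    from l to l + 1. The last summand makes B positive.\<close>
  define B where "B = sqrt K + C1 / (2 powr \<kappa> - 1) + 1"
  \<comment> \<open>The squared error is at most three times the sum of three squares: V and V from
    the rough part and its average, R^2 4^(-l) G from the smooth part.\<close>
  define C2 where "C2 = 6 + 3 * R\<^sup>2"
  define C where "C = (2 * B) powr (q - 2) * (1 + 4 powr (1 + s) * C2)"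
  have n: "2 * s < n" using s by (simp add: n_def)
  have \<kappa>: "0 < \<kappa>" using n by (simp add: \<kappa>_def)
  have q2: "q - 2 = 2 * s / \<kappa>" using n by (simp add: q \<kappa>_def flip: n_def) (simp add: field_simps)
  have q3: "2 < q" using q2 \<kappa> s by (metis diff_gt_0_iff_gt divide_pos_pos mult_pos_pos zero_less_numeral)
  have twok: "1 < 2 powr \<kappa>" using \<kappa> by simp
  have C0: "0 \<le> C0" "C0\<^sup>2 = K * 2 ^ CARD('n)" using K_nonneg by (auto simp: C0_def)
  have C1: "0 \<le> C1" using C0 R_nonneg by (simp add: C1_def)
  have B: "sqrt K \<le> B" "C1 \<le> B * (2 powr \<kappa> - 1)" "0 < B"
  proof -
    have h: "0 \<le> C1 / (2 powr \<kappa> - 1)" using C1 twok by simp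
    then show "sqrt K \<le> B" "0 < B" using K_nonneg by (auto simp: B_def add_nonneg_pos)
    have "C1 = (C1 / (2 powr \<kappa> - 1)) * (2 powr \<kappa> - 1)" using twok \<kappa> by simp
    also have "\<dots> \<le> B * (2 powr \<kappa> - 1)" using twok K_nonneg by (intro mult_right_mono) (auto simp: B_def)
    finally show "C1 \<le> B * (2 powr \<kappa> - 1)" .
  qed
  have \<beta>pos: "0 < \<beta> l" for l by (simp add: \<beta>_def)
  have \<beta>0: "\<beta> 0 = 1" by (simp add: \<beta>_def)
  have \<beta>Suc: "\<beta> (Suc l) = 2 powr \<kappa> * \<beta> l" for l by (simp add: \<beta>_def distrib_right powr_add)
  have \<beta>2: "(\<beta> l)\<^sup>2 * 4 powr (real l * s) = (2 ^ l) ^ CARD('n)" for l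
  proof -
    have "(\<beta> l)\<^sup>2 = 2 powr (2 * (real l * \<kappa>))" by (simp add: \<beta>_def power2_eq_square mult.commute flip: powr_add)
    moreover have "4 powr (real l * s) = 2 powr (2 * (real l * s))"
      using powr_powr[of 2 2 "real l * s"] by simp
    ultimately have "(\<beta> l)\<^sup>2 * 4 powr (real l * s) = 2 powr (real l * n)"
      by (simp add: \<kappa>_def algebra_simps flip: powr_add)
    also have "\<dots> = 2 powr real (l * CARD('n))" by (simp add: n_def)
    also have "\<dots> = (2 ^ l) ^ CARD('n)" by (subst powr_realpow) (auto simp: power_mult)
    finally show ?thesis .
  qed
  have \<beta>q: "\<beta> (Suc l) powr (q - 2) = 4 powr s * 4 powr (real l * s)" for l
  proof -
    have "real (Suc l) * \<kappa> * (q - 2) = 2 * (s + real l * s)"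
      unfolding q2 using \<kappa> by (simp add: field_simps)
    then have "\<beta> (Suc l) powr (q - 2) = 2 powr (2 * (s + real l * s))"
      by (simp only: \<beta>_def powr_powr)
    also have "\<dots> = 4 powr (s + real l * s)" using powr_powr[of 2 2 "s + real l * s"] by simp
    finally show ?thesis by (simp add: powr_add)
  qed
  have \<beta>lim: "filterlim \<beta> at_top sequentially"
  proof -
    have "filterlim (\<lambda>l::nat. (2 powr \<kappa>) ^ l) at_top sequentially"
      using filterlim_realpow_sequentially_gt1[of "2 powr \<kappa>"] twok by (simp add: filterlim_at_infinity_imp_filterlim_at_top)
    moreover have "(2 powr \<kappa>) ^ l = \<beta> l" for l by (simp add: \<beta>_def powr_realpow[symmetric] powr_powr mult.commute)
    ultimately show ?thesis by simp
  qed
  show ?thesis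
  proof (intro exI[of _ C] conjI allI impI)
    show "0 \<le> C" using R_nonneg by (auto simp: C_def C2_def)
    fix u T assume T: "0 \<le> T" and M: "multiscale \<Omega> s T u"
    have [measurable]: "u \<in> borel_measurable borel" and u2: "(\<integral>\<^sup>+x. ennreal ((u x)\<^sup>2) \<partial>lborel) \<le> ennreal (T\<^sup>2)"
      using M by (auto simp: multiscale_def)
    obtain v w g V G where vw: "\<And>l::nat. v l \<in> borel_measurable borel \<and> borel_H1 \<Omega> (w l) (g l) \<and>
          (\<forall>x. x \<notin> \<Omega> \<longrightarrow> w l x = 0) \<and> (\<forall>x. u x = v l x + w l x) \<and> 0 \<le> V l \<and> 0 \<le> G l \<and>
          (\<integral>\<^sup>+x. ennreal ((v l x)\<^sup>2) \<partial>lborel) \<le> ennreal (V l) \<and>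
          (\<integral>\<^sup>+x. ennreal ((norm (g l x))\<^sup>2) \<partial>lborel) \<le> ennreal (G l)"
      and sumT: "\<And>N. (\<Sum>l<N. 4 powr (real l * s) * (V l + (1/4) ^ l * G l)) \<le> T\<^sup>2"
      using M unfolding multiscale_def by (elim conjE exE) (rule that, erule spec, erule spec)
    have [measurable]: "v l \<in> borel_measurable borel" "w l \<in> borel_measurable borel" "g l \<in> borel_measurable borel" for l
      using vw[of l] by (auto simp: borel_H1_def)
    have H: "borel_H1 \<Omega> (w l) (g l)" and w0: "x \<notin> \<Omega> \<Longrightarrow> w l x = 0" and uvw: "u = (\<lambda>x. v l x + w l x)"
      and VG: "0 \<le> V l" "0 \<le> G l" and v2: "(\<integral>\<^sup>+x. ennreal ((v l x)\<^sup>2) \<partial>lborel) \<le> ennreal (V l)"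
      and g2: "(\<integral>\<^sup>+x. ennreal ((norm (g l x))\<^sup>2) \<partial>lborel) \<le> ennreal (G l)" for l x
      using vw[of l] by auto
    have vi: "integrable lborel (\<lambda>x. (v l x)\<^sup>2)" for l
      using v2[of l] by (intro integrableI_bounded) (auto intro: order_le_less_trans)
    have wi: "integrable lborel (\<lambda>x. (w l x)\<^sup>2)" for l
      using H[of l] by (simp add: borel_H1_def)
    \<comment> \<open>Boundedness of the domain, together with w_l vanishing outside it, puts w_l
      into L_1, where the averages are known to converge.\<close>
    have wL1: "integrable lborel (w l)" for l
      by (rule integrable_bounded_support_mult[where f="w l" and B=1 and C=\<Omega>])
        (use w0 wi emeasure_bounded_finite[OF bnd] in auto)
    define D where "D l = avg (2 ^ l) u" for l :: nat
    have [measurable]: "D l \<in> borel_measurable borel" for l unfolding D_def by measurable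
    have single: "4 powr (real l * s) * (V l + (1/4) ^ l * G l) \<le> T\<^sup>2" for l
    proof -
      have "4 powr (real l * s) * (V l + (1/4) ^ l * G l) \<le> (\<Sum>l<Suc l. 4 powr (real l * s) * (V l + (1/4) ^ l * G l))"
        using VG by (intro member_le_sum) auto
      also have "\<dots> \<le> T\<^sup>2" by (rule sumT)
      finally show ?thesis .
    qed
    \<comment> \<open>To be used with X = V_l and X = 4^(-l) G_l; the identity
      \<open>\<beta>2\<close> splits the kernel height 2^(l n) into \<beta>_l^2 and the weight 4^(l
      s).\<close>
    have bnd1: "K * (2 ^ Suc l) ^ CARD('n) * X \<le> (C0 * \<beta> l * T)\<^sup>2" if "4 powr (real l * s) * X \<le> T\<^sup>2" for l X
    proof -
      have "K * (2 ^ Suc l) ^ CARD('n) * X = C0\<^sup>2 * ((2 ^ l) ^ CARD('n)) * X"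
        by (simp add: C0 power_mult_distrib mult_ac)
      also have "\<dots> = C0\<^sup>2 * (\<beta> l)\<^sup>2 * (4 powr (real l * s) * X)" by (simp flip: \<beta>2)
      also have "\<dots> \<le> C0\<^sup>2 * (\<beta> l)\<^sup>2 * T\<^sup>2" using that by (intro mult_left_mono) auto
      finally show ?thesis by (simp add: power_mult_distrib)
    qed
    have V4: "4 powr (real l * s) * V l \<le> T\<^sup>2" "4 powr (real l * s) * ((1/4) ^ l * G l) \<le> T\<^sup>2" for l
      using single[of l] VG[of l] by (auto simp: distrib_left intro: order_trans[rotated])
    have CbT: "0 \<le> C0 * \<beta> l * T" for l using C0 \<beta>pos[of l] T by simp
    have coneP: "x + (1 / \<alpha>) *\<^sub>R z \<in> \<Omega>" if "x \<in> P" "z \<in> S" "2 ^ l \<le> \<alpha>" for x z \<alpha> and l :: nat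
    proof -
      have "(1::real) \<le> 2 ^ l" by simp
      then have "1 \<le> \<alpha>" using that by linarith
      then show ?thesis using cone[OF that(1,2), of "1 / \<alpha>"] by simp
    qed
    \<comment> \<open>The rough part v_l is bounded at both scales separately, since nothing is
      gained from the difference; for w_l the difference is what lets the gradient enter.\<close>
    have step: "\<bar>D (Suc l) x - D l x\<bar> \<le> C1 * \<beta> l * T" if x: "x \<in> P" for l x
    proof -
      have Dl: "D k x = avg (2 ^ k) (v l) x + avg (2 ^ k) (w l) x" for k
        unfolding D_def by (subst uvw[of l], rule avg_add) (use vi wi in auto)
      have 1: "\<bar>avg (2 ^ Suc l) (v l) x\<bar> \<le> C0 * \<beta> l * T"
      proof (rule abs_le_square_iff[THEN iffD2, of _ "C0 * \<beta> l * T", simplified abs_of_nonneg[OF CbT]])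
        show "(avg (2 ^ Suc l) (v l) x)\<^sup>2 \<le> (C0 * \<beta> l * T)\<^sup>2"
          by (rule order_trans[OF avg_square_le[OF _ _ v2 VG(1)] bnd1[OF V4(1)]]) auto
      qed
      have 2: "\<bar>avg (2 ^ l) (v l) x\<bar> \<le> C0 * \<beta> l * T"
      proof (rule abs_le_square_iff[THEN iffD2, of _ "C0 * \<beta> l * T", simplified abs_of_nonneg[OF CbT]])
        have "(avg (2 ^ l) (v l) x)\<^sup>2 \<le> K * (2 ^ l) ^ CARD('n) * V l"
          by (rule avg_square_le[OF _ _ v2 VG(1)]) auto
        also have "\<dots> \<le> K * (2 ^ Suc l) ^ CARD('n) * V l"
          using VG[of l] K_nonneg by (intro mult_right_mono mult_left_mono power_mono) auto
        also have "\<dots> \<le> (C0 * \<beta> l * T)\<^sup>2" by (rule bnd1[OF V4(1)])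
        finally show "(avg (2 ^ l) (v l) x)\<^sup>2 \<le> (C0 * \<beta> l * T)\<^sup>2" .
      qed
      have 3: "\<bar>avg (2 ^ Suc l) (w l) x - avg (2 ^ l) (w l) x\<bar> \<le> R * (C0 * \<beta> l * T)"
      proof (rule abs_le_square_iff[THEN iffD2, of _ "R * (C0 * \<beta> l * T)", simplified abs_of_nonneg[OF mult_nonneg_nonneg[OF R_nonneg CbT]]])
        have "(avg (2 ^ Suc l) (w l) x - avg (2 ^ l) (w l) x)\<^sup>2 \<le> (R / 2 ^ l)\<^sup>2 * (K * (2 ^ Suc l) ^ CARD('n) * G l)"
          by (rule avg_diff_square_le[OF H _ _ coneP[OF x] g2 VG(2)]) auto
        also have "\<dots> = R\<^sup>2 * (K * (2 ^ Suc l) ^ CARD('n) * ((1/4) ^ l * G l))"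
        proof -
          have "((2::real) ^ l)\<^sup>2 = 4 ^ l" by (simp add: power2_eq_square flip: power_mult_distrib)
          then show ?thesis by (simp add: power_divide)
        qed
        also have "\<dots> \<le> R\<^sup>2 * (C0 * \<beta> l * T)\<^sup>2" by (intro mult_left_mono bnd1[OF V4(2)]) auto
        finally show "(avg (2 ^ Suc l) (w l) x - avg (2 ^ l) (w l) x)\<^sup>2 \<le> (R * (C0 * \<beta> l * T))\<^sup>2"
          by (simp add: power_mult_distrib)
      qed
      have "C1 * \<beta> l * T = 2 * (C0 * \<beta> l * T) + R * (C0 * \<beta> l * T)" by (simp add: C1_def algebra_simps)
      then show ?thesis using 1 2 3 Dl[of l] Dl[of "Suc l"] by linarith
    qed
    have Dbd: "\<bar>D l x\<bar> \<le> B * \<beta> l * T" if x: "x \<in> P" for l x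
    proof (induction l)
      case 0
      have "(avg (2 ^ 0) u x)\<^sup>2 \<le> K * (2 ^ 0) ^ CARD('n) * T\<^sup>2" by (rule avg_square_le[OF _ _ u2]) auto
      then have "(D 0 x)\<^sup>2 \<le> (sqrt K * T)\<^sup>2" using K_nonneg by (simp add: D_def power_mult_distrib)
      then have "\<bar>D 0 x\<bar> \<le> sqrt K * T" using K_nonneg T by (simp flip: abs_le_square_iff add: abs_mult)
      also have "\<dots> \<le> B * T" using B T by (intro mult_right_mono) auto
      finally show ?case by (simp add: \<beta>0)
    next
      case (Suc l)
      have "\<bar>D (Suc l) x\<bar> \<le> B * \<beta> l * T + C1 * \<beta> l * T" using Suc step[OF x, of l] by linarith
      also have "\<dots> \<le> B * \<beta> l * T + B * (2 powr \<kappa> - 1) * \<beta> l * T"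
        using B T \<beta>pos[of l] by (intro add_left_mono mult_right_mono) auto
      also have "\<dots> = B * \<beta> (Suc l) * T" by (simp add: \<beta>Suc algebra_simps)
      finally show ?case .
    qed
    define E where "E l = (\<integral>\<^sup>+x\<in>P. ennreal ((u x - D l x)\<^sup>2) \<partial>lborel)" for l
    have E: "E l \<le> ennreal (C2 * (V l + (1/4) ^ l * G l))" for l
    proof -
      have pt: "ennreal ((u x - D l x)\<^sup>2) * indicator P x \<le> 3 * (ennreal ((v l x)\<^sup>2) + (ennreal ((avg (2 ^ l) (v l) x)\<^sup>2) +
          ennreal ((w l x - avg (2 ^ l) (w l) x)\<^sup>2) * indicator P x))" for x
      proof (cases "x \<in> P")
        case True
        have Dl: "D l x = avg (2 ^ l) (v l) x + avg (2 ^ l) (w l) x"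
          unfolding D_def by (subst uvw[of l], rule avg_add) (use vi wi in auto)
        have ineq: "(a - b + c)\<^sup>2 \<le> 3 * (a\<^sup>2 + (b\<^sup>2 + c\<^sup>2))" for a b c :: real
          using sum_squares_bound[of a "-b"] sum_squares_bound[of a c] sum_squares_bound[of "-b" c]
          by (simp add: power2_eq_square algebra_simps)
        have ux: "u x = v l x + w l x" using uvw[of l] by (rule fun_cong)
        have "(u x - D l x)\<^sup>2 \<le> 3 * ((v l x)\<^sup>2 + ((avg (2 ^ l) (v l) x)\<^sup>2 + (w l x - avg (2 ^ l) (w l) x)\<^sup>2))"
          using ineq[of "v l x" "avg (2 ^ l) (v l) x" "w l x - avg (2 ^ l) (w l) x"] Dl ux by (simp add: algebra_simps)
        then have "ennreal ((u x - D l x)\<^sup>2) \<le> ennreal (3 * ((v l x)\<^sup>2 + ((avg (2 ^ l) (v l) x)\<^sup>2 + (w l x - avg (2 ^ l) (w l) x)\<^sup>2)))"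
          by (rule ennreal_leI)
        then show ?thesis using True by (simp add: ennreal_mult)
      qed simp
      have "E l \<le> (\<integral>\<^sup>+x. 3 * (ennreal ((v l x)\<^sup>2) + (ennreal ((avg (2 ^ l) (v l) x)\<^sup>2) +
          ennreal ((w l x - avg (2 ^ l) (w l) x)\<^sup>2) * indicator P x)) \<partial>lborel)"
        unfolding E_def by (intro nn_integral_mono pt)
      also have "\<dots> = 3 * ((\<integral>\<^sup>+x. ennreal ((v l x)\<^sup>2) \<partial>lborel) + ((\<integral>\<^sup>+x. ennreal ((avg (2 ^ l) (v l) x)\<^sup>2) \<partial>lborel) +
          (\<integral>\<^sup>+x\<in>P. ennreal ((w l x - avg (2 ^ l) (w l) x)\<^sup>2) \<partial>lborel)))"
        by (simp add: nn_integral_cmult nn_integral_add)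
      also have "\<dots> \<le> 3 * (ennreal (V l) + (ennreal (V l) + (ennreal (R / 2 ^ l))\<^sup>2 * ennreal (G l)))"
      proof (intro mult_left_mono add_mono v2)
        have "(\<integral>\<^sup>+x. ennreal ((avg (2 ^ l) (v l) x)\<^sup>2) \<partial>lborel) \<le> (\<integral>\<^sup>+x. (navg (2 ^ l) (\<lambda>y. ennreal \<bar>v l y\<bar>) x)\<^sup>2 \<partial>lborel)"
        proof (rule nn_integral_mono)
          fix x
          have "ennreal ((avg (2 ^ l) (v l) x)\<^sup>2) = (ennreal \<bar>avg (2 ^ l) (v l) x\<bar>)\<^sup>2" by (simp add: ennreal_power)
          also have "\<dots> \<le> (navg (2 ^ l) (\<lambda>y. ennreal \<bar>v l y\<bar>) x)\<^sup>2" by (intro power_mono avg_abs_le) auto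
          finally show "ennreal ((avg (2 ^ l) (v l) x)\<^sup>2) \<le> (navg (2 ^ l) (\<lambda>y. ennreal \<bar>v l y\<bar>) x)\<^sup>2" .
        qed
        also have "\<dots> \<le> (\<integral>\<^sup>+y. (ennreal \<bar>v l y\<bar>)\<^sup>2 \<partial>lborel)" by (intro navg_square_L2) auto
        also have "\<dots> \<le> ennreal (V l)" using v2[of l] by (simp add: ennreal_power)
        finally show "(\<integral>\<^sup>+x. ennreal ((avg (2 ^ l) (v l) x)\<^sup>2) \<partial>lborel) \<le> ennreal (V l)" .
        have "(\<integral>\<^sup>+x\<in>P. ennreal ((w l x - avg (2 ^ l) (w l) x)\<^sup>2) \<partial>lborel) \<le>
           (ennreal (R / 2 ^ l))\<^sup>2 * (\<integral>\<^sup>+y. ennreal ((norm (g l y))\<^sup>2) \<partial>lborel)"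
          by (rule avg_error_L2[OF H _ _ wL1 coneP]) auto
        also have "\<dots> \<le> (ennreal (R / 2 ^ l))\<^sup>2 * ennreal (G l)" by (intro mult_left_mono g2) auto
        finally show "(\<integral>\<^sup>+x\<in>P. ennreal ((w l x - avg (2 ^ l) (w l) x)\<^sup>2) \<partial>lborel) \<le> (ennreal (R / 2 ^ l))\<^sup>2 * ennreal (G l)" .
      qed auto
      also have "\<dots> = ennreal (3 * (V l + (V l + (R / 2 ^ l)\<^sup>2 * G l)))"
        using VG[of l] R_nonneg 
        by (simp add: ennreal_mult ennreal_power del: distrib_left_numeral) (simp add: mult_2 add.assoc del: distrib_left_numeral)
      also have "\<dots> \<le> ennreal (C2 * (V l + (1/4) ^ l * G l))"
      proof (rule ennreal_leI)
        have "((2::real) ^ l)\<^sup>2 = 4 ^ l" by (simp add: power2_eq_square flip: power_mult_distrib)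
        then have "(R / 2 ^ l)\<^sup>2 = R\<^sup>2 * (1/4) ^ l" by (simp add: power_divide)
        then have "C2 * (V l + (1/4) ^ l * G l) - 3 * (V l + (V l + (R / 2 ^ l)\<^sup>2 * G l)) = 6 * ((1/4) ^ l * G l) + 3 * R\<^sup>2 * V l"
          by (simp add: C2_def algebra_simps)
        also have "\<dots> \<ge> 0" using VG[of l] by (intro add_nonneg_nonneg mult_nonneg_nonneg) auto
        finally show "3 * (V l + (V l + (R / 2 ^ l)\<^sup>2 * G l)) \<le> C2 * (V l + (1/4) ^ l * G l)" by simp
      qed
      finally show ?thesis .
    qed
    show "(\<integral>\<^sup>+x\<in>P. ennreal (\<bar>u x\<bar> powr q) \<partial>lborel) \<le> ennreal (C * T powr q)"
    proof (cases "T = 0")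
      case True
      \<comment> \<open>T = 0 is treated apart because the choice of the level below divides by
        T.\<close>
      then have "(\<integral>\<^sup>+x. ennreal ((u x)\<^sup>2) \<partial>lborel) = 0" using u2 by simp
      then have "AE x in lborel. u x = 0" by (subst (asm) nn_integral_0_iff_AE) auto
      then have "AE x in lborel. ennreal (\<bar>u x\<bar> powr q) * indicator P x = 0" by eventually_elim simp
      then have "(\<integral>\<^sup>+x\<in>P. ennreal (\<bar>u x\<bar> powr q) \<partial>lborel) = 0" by (subst nn_integral_0_iff_AE) auto
      then show ?thesis by simp
    next
      case False
      then have T: "0 < T" using T by simp
      define A where "A = (2 * B * T) powr (q - 2)"
      have split2: "r powr q = r powr (q - 2) * r\<^sup>2" if "0 \<le> r" for r :: real
        using that by (cases "r = 0") (auto simp: powr_diff powr_numeral)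
      have point: "ennreal (\<bar>u x\<bar> powr q) * indicator P x \<le>
         ennreal A * (ennreal ((u x)\<^sup>2) + (\<Sum>l. ennreal (4 powr (1 + s) * 4 powr (real l * s)) * (ennreal ((u x - D l x)\<^sup>2) * indicator P x)))"
        (is "_ \<le> _ * (_ + (\<Sum>l. ?f l))") for x
      proof (cases "x \<in> P")
        case x: True
        show ?thesis
        proof (cases "\<bar>u x\<bar> \<le> 2 * B * T")
          case True
          \<comment> \<open>Level 0 has no preceding average to compare with; there |u|^(q - 2) is
            bounded by A, and the L_2 norm of u pays for the rest.\<close>
          have "\<bar>u x\<bar> powr q \<le> A * (u x)\<^sup>2"
            using split2[of "\<bar>u x\<bar>"] True q3 unfolding A_def
            by (simp add: mult_right_mono powr_mono2)
          then have "ennreal (\<bar>u x\<bar> powr q) \<le> ennreal A * ennreal ((u x)\<^sup>2)"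
            by (simp add: A_def ennreal_leI flip: ennreal_mult)
          also have "\<dots> \<le> ennreal A * (ennreal ((u x)\<^sup>2) + (\<Sum>l. ?f l))" by (intro mult_left_mono) auto
          finally show ?thesis using x by simp
        next
          case False
          have "eventually (\<lambda>l. \<bar>u x\<bar> / (2 * B * T) \<le> \<beta> l) sequentially" using \<beta>lim by (simp add: filterlim_at_top)
          then obtain l0 where "\<bar>u x\<bar> / (2 * B * T) \<le> \<beta> l0" by (auto dest: eventually_happens)
          then have ex: "\<exists>l. \<bar>u x\<bar> \<le> 2 * B * T * \<beta> l" using B T by (auto simp: divide_le_eq mult_ac)
          define l where "l = (LEAST l. \<bar>u x\<bar> \<le> 2 * B * T * \<beta> l)"
          have l: "\<bar>u x\<bar> \<le> 2 * B * T * \<beta> l" unfolding l_def by (rule LeastI_ex[OF ex])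
          have "l \<noteq> 0" using l False \<beta>0 by (metis mult.right_neutral)
          then obtain m where m: "l = Suc m" by (cases l) auto
          have "\<not> \<bar>u x\<bar> \<le> 2 * (B * T * \<beta> m)" using m not_less_Least[of m "\<lambda>l. \<bar>u x\<bar> \<le> 2 * B * T * \<beta> l"] by (simp add: l_def mult.assoc)
          moreover have "\<bar>D m x\<bar> \<le> B * T * \<beta> m" using Dbd[OF x, of m] by (simp add: mult_ac)
          moreover have "a \<le> 2 * b" if "\<not> a \<le> 2 * c" "d \<le> c" "a - d \<le> b" for a b c d :: real
            using that by linarith
          ultimately have "\<bar>u x\<bar> \<le> 2 * \<bar>u x - D m x\<bar>" using abs_triangle_ineq2[of "u x" "D m x"] by blast
          then have "\<bar>u x\<bar>\<^sup>2 \<le> (2 * \<bar>u x - D m x\<bar>)\<^sup>2" by (intro power_mono) auto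
          then have u4: "\<bar>u x\<bar>\<^sup>2 \<le> 4 * (u x - D m x)\<^sup>2" by (simp add: power_mult_distrib)
          have "\<bar>u x\<bar> powr q = \<bar>u x\<bar> powr (q - 2) * \<bar>u x\<bar>\<^sup>2" by (rule split2) simp
          also have "\<dots> \<le> (2 * B * T * \<beta> (Suc m)) powr (q - 2) * (4 * (u x - D m x)\<^sup>2)"
            using l m q3 u4 by (intro mult_mono powr_mono2) auto
          also have "\<dots> = A * (4 powr (1 + s) * 4 powr (real m * s) * (u x - D m x)\<^sup>2)"
            using B T \<beta>pos[of "Suc m"] \<beta>q[of m] by (simp add: A_def powr_mult powr_add mult_ac)
          finally have "ennreal (\<bar>u x\<bar> powr q) \<le> ennreal (A * (4 powr (1 + s) * 4 powr (real m * s) * (u x - D m x)\<^sup>2))"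
            by (rule ennreal_leI)
          also have "\<dots> = ennreal A * ?f m" using x by (simp add: A_def ennreal_mult)
          \<comment> \<open>The level m depends on x. Passing to the full series removes this
            dependence and allows termwise integration.\<close>
          also have "\<dots> \<le> ennreal A * (\<Sum>l. ?f l)" using sum_le_suminf[of ?f "{m}"] by (intro mult_left_mono) auto
          also have "\<dots> \<le> ennreal A * (ennreal ((u x)\<^sup>2) + (\<Sum>l. ?f l))" by (intro mult_left_mono) auto
          finally show ?thesis using x by simp
        qed
      qed simp
      have "(\<integral>\<^sup>+x\<in>P. ennreal (\<bar>u x\<bar> powr q) \<partial>lborel) \<le>
        (\<integral>\<^sup>+x. ennreal A * (ennreal ((u x)\<^sup>2) + (\<Sum>l. ennreal (4 powr (1 + s) * 4 powr (real l * s)) * (ennreal ((u x - D l x)\<^sup>2) * indicator P x))) \<partial>lborel)"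
        by (intro nn_integral_mono point)
      also have "\<dots> = ennreal A * ((\<integral>\<^sup>+x. ennreal ((u x)\<^sup>2) \<partial>lborel) + (\<Sum>l. ennreal (4 powr (1 + s) * 4 powr (real l * s)) * E l))"
        by (simp add: nn_integral_cmult nn_integral_add nn_integral_suminf E_def)
      also have "\<dots> \<le> ennreal A * (ennreal (T\<^sup>2) + ennreal (4 powr (1 + s) * C2 * T\<^sup>2))"
      proof (intro mult_left_mono add_mono u2)
        have "(\<Sum>l. ennreal (4 powr (1 + s) * 4 powr (real l * s)) * E l) \<le>
          (\<Sum>l. ennreal (4 powr (1 + s) * C2 * (4 powr (real l * s) * (V l + (1/4) ^ l * G l))))"
        proof (intro suminf_le allI summableI)
          fix l
          have "ennreal (4 powr (1 + s) * 4 powr (real l * s)) * E l \<le> ennreal (4 powr (1 + s) * 4 powr (real l * s)) * ennreal (C2 * (V l + (1/4) ^ l * G l))"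
            by (intro mult_left_mono E) auto
          also have "\<dots> = ennreal (4 powr (1 + s) * C2 * (4 powr (real l * s) * (V l + (1/4) ^ l * G l)))"
            by (subst ennreal_mult[symmetric]) (use VG[of l] in \<open>auto simp: C2_def mult_ac\<close>)
          finally show "ennreal (4 powr (1 + s) * 4 powr (real l * s)) * E l \<le> ennreal (4 powr (1 + s) * C2 * (4 powr (real l * s) * (V l + (1/4) ^ l * G l)))" .
        qed
        also have "\<dots> \<le> ennreal (4 powr (1 + s) * C2 * T\<^sup>2)"
        proof (rule suminf_le_const[OF summableI])
          fix N
          have "(\<Sum>l<N. ennreal (4 powr (1 + s) * C2 * (4 powr (real l * s) * (V l + (1/4) ^ l * G l)))) =
            ennreal (4 powr (1 + s) * C2 * (\<Sum>l<N. 4 powr (real l * s) * (V l + (1/4) ^ l * G l)))"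
            using VG by (subst sum_ennreal) (auto simp: C2_def sum_distrib_left)
          also have "\<dots> \<le> ennreal (4 powr (1 + s) * C2 * T\<^sup>2)"
            by (intro ennreal_leI mult_left_mono sumT) (auto simp: C2_def)
          finally show "(\<Sum>l<N. ennreal (4 powr (1 + s) * C2 * (4 powr (real l * s) * (V l + (1/4) ^ l * G l)))) \<le> \<dots>" .
        qed
        finally show "(\<Sum>l. ennreal (4 powr (1 + s) * 4 powr (real l * s)) * E l) \<le> ennreal (4 powr (1 + s) * C2 * T\<^sup>2)" .
      qed auto
      also have "\<dots> = ennreal (A * (T\<^sup>2 + 4 powr (1 + s) * C2 * T\<^sup>2))"
        by (subst ennreal_plus[symmetric], simp, simp add: C2_def, subst ennreal_mult[symmetric]) (auto simp: A_def C2_def)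
      also have "A * (T\<^sup>2 + 4 powr (1 + s) * C2 * T\<^sup>2) = C * T powr q"
        using split2[of T] T B by (simp add: A_def C_def powr_mult algebra_simps)
      finally show ?thesis .
    qed
  qed
qed

end

section \<open>Spectral decomposition\<close>

lemma integral_lebesgue_on_borel:
  fixes F :: "'a::euclidean_space \<Rightarrow> 'b::{banach, second_countable_topology}"
  assumes "\<Omega> \<in> sets borel" "F \<in> borel_measurable borel"
  shows "integral\<^sup>L (lebesgue_on \<Omega>) F = (\<integral>x. indicator \<Omega> x *\<^sub>R F x \<partial>lborel)"
  using assms by (subst integral_restrict_space) (auto intro!: integral_completion)

lemma integrable_lebesgue_on_borel:
  fixes F :: "'a::euclidean_space \<Rightarrow> 'b::{banach, second_countable_topology}"
  assumes "\<Omega> \<in> sets borel" "F \<in> borel_measurable borel"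
  shows "integrable (lebesgue_on \<Omega>) F \<longleftrightarrow> integrable lborel (\<lambda>x. indicator \<Omega> x *\<^sub>R F x)"
  using assms by (subst integrable_restrict_space) (auto intro!: integrable_completion)

lemma nn_integral_lebesgue_on_borel:
  assumes "\<Omega> \<in> sets borel"
  shows "(\<integral>\<^sup>+x. F x \<partial>lebesgue_on \<Omega>) = (\<integral>\<^sup>+x\<in>\<Omega>. F x \<partial>lborel)"
  using assms by (subst nn_integral_restrict_space) (auto simp: nn_integral_completion)

lemma borel_measurable_lebesgue_on:
  assumes "F \<in> borel_measurable borel"
  shows "F \<in> borel_measurable (lebesgue_on \<Omega>)"
  using assms by (intro measurable_restrict_space1 measurable_completion) auto

lemma borel_version_real:
  fixes u :: "'a::euclidean_space \<Rightarrow> real"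
  assumes \<Omega>: "\<Omega> \<in> sets borel" and u: "u \<in> borel_measurable (lebesgue_on \<Omega>)"
  obtains u' where "u' \<in> borel_measurable borel" "\<And>x. x \<notin> \<Omega> \<Longrightarrow> u' x = 0" "AE x in lebesgue_on \<Omega>. u x = u' x"
proof -
  have "(\<lambda>x. indicator \<Omega> x *\<^sub>R u x) \<in> borel_measurable lebesgue"
    using u \<Omega> by (subst (asm) borel_measurable_restrict_space_iff) auto
  then obtain u0 where u0: "u0 \<in> borel_measurable lborel" "AE x in lborel. indicator \<Omega> x *\<^sub>R u x = u0 x"
    using completion_ex_borel_measurable_real by blast
  have [measurable]: "u0 \<in> borel_measurable borel" "\<Omega> \<in> sets borel" using u0 \<Omega> by auto
  show thesis
  proof (rule that[of "\<lambda>x. indicator \<Omega> x * u0 x"])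
    have "AE x in lebesgue. indicator \<Omega> x *\<^sub>R u x = u0 x" using u0(2) by (rule AE_completion)
    then have "AE x in lebesgue. x \<in> \<Omega> \<longrightarrow> u x = indicator \<Omega> x * u0 x" by eventually_elim auto
    then show "AE x in lebesgue_on \<Omega>. u x = indicator \<Omega> x * u0 x"
      using \<Omega> by (subst AE_restrict_space_iff) auto
  qed auto
qed

lemma borel_version:
  fixes u :: "'a::euclidean_space \<Rightarrow> 'b::euclidean_space"
  assumes \<Omega>: "\<Omega> \<in> sets borel" and u: "u \<in> borel_measurable (lebesgue_on \<Omega>)"
  obtains u' where "u' \<in> borel_measurable borel" "\<And>x. x \<notin> \<Omega> \<Longrightarrow> u' x = 0" "AE x in lebesgue_on \<Omega>. u x = u' x"
proof -
  have "\<exists>u'. u' \<in> borel_measurable borel \<and> (\<forall>x. x \<notin> \<Omega> \<longrightarrow> u' x = 0) \<and> (AE x in lebesgue_on \<Omega>. u x \<bullet> i = u' x)" for i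
  proof -
    have "(\<lambda>x. u x \<bullet> i) \<in> borel_measurable (lebesgue_on \<Omega>)" using u by measurable
    from borel_version_real[OF \<Omega> this] show ?thesis by blast
  qed
  then obtain c where c: "\<And>i. c i \<in> borel_measurable borel" "\<And>i x. x \<notin> \<Omega> \<Longrightarrow> c i x = 0"
    "\<And>i. AE x in lebesgue_on \<Omega>. u x \<bullet> i = c i x"
    by metis
  note [measurable] = c(1)
  show thesis
  proof (rule that[of "\<lambda>x. \<Sum>i\<in>Basis. c i x *\<^sub>R i"])
    have "AE x in lebesgue_on \<Omega>. \<forall>i\<in>Basis. u x \<bullet> i = c i x"
      using c(3) by (intro AE_finite_allI) auto
    then show "AE x in lebesgue_on \<Omega>. u x = (\<Sum>i\<in>Basis. c i x *\<^sub>R i)"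
    proof eventually_elim
      case (elim x)
      then have "(\<Sum>i\<in>Basis. c i x *\<^sub>R i) = (\<Sum>i\<in>Basis. (u x \<bullet> i) *\<^sub>R i)" by (intro sum.cong) auto
      then show ?case by (simp add: euclidean_representation)
    qed
  qed (auto simp: c(2))
qed

text \<open>The extension by zero may jump at the boundary, but it is tested only with functions
  supported inside \<Omega>, so the weak identity survives.\<close>

lemma H1_borel_version:
  assumes op: "open \<Omega>" and H: "H1_with_gradient \<Omega> u g"
  obtains u' g' where "borel_H1 \<Omega> u' g'" "\<And>x. x \<notin> \<Omega> \<Longrightarrow> u' x = 0" "\<And>x. x \<notin> \<Omega> \<Longrightarrow> g' x = 0"
    "AE x in lebesgue_on \<Omega>. u x = u' x" "AE x in lebesgue_on \<Omega>. g x = g' x"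
proof -
  have \<Omega>[measurable]: "\<Omega> \<in> sets borel" using op by simp
  have um: "u \<in> borel_measurable (lebesgue_on \<Omega>)" and gm: "g \<in> borel_measurable (lebesgue_on \<Omega>)"
    and ui: "integrable (lebesgue_on \<Omega>) (\<lambda>x. (norm (u x))\<^sup>2)" and gi: "integrable (lebesgue_on \<Omega>) (\<lambda>x. (norm (g x))\<^sup>2)"
    using H by (auto simp: H1_with_gradient_def in_L2_def)
  obtain u' where u'[measurable]: "u' \<in> borel_measurable borel" and u0: "\<And>x. x \<notin> \<Omega> \<Longrightarrow> u' x = 0" and uA: "AE x in lebesgue_on \<Omega>. u x = u' x"
    using borel_version[OF \<Omega> um] by blast
  obtain g' where g'[measurable]: "g' \<in> borel_measurable borel" and g0: "\<And>x. x \<notin> \<Omega> \<Longrightarrow> g' x = 0" and gA: "AE x in lebesgue_on \<Omega>. g x = g' x"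
    using borel_version[OF \<Omega> gm] by blast
  note L = borel_measurable_lebesgue_on[of _ \<Omega>]
  have "borel_H1 \<Omega> u' g'"
    unfolding borel_H1_def
  proof (intro conjI allI impI)
    have "integrable (lebesgue_on \<Omega>) (\<lambda>x. (norm (u' x))\<^sup>2)"
      using ui uA by (subst integrable_cong_AE[of _ _ "\<lambda>x. (norm (u x))\<^sup>2"]) (auto intro!: L borel_measurable_power borel_measurable_norm um)
    then have "integrable lborel (\<lambda>x. indicator \<Omega> x *\<^sub>R (norm (u' x))\<^sup>2)"
      by (subst (asm) integrable_lebesgue_on_borel) auto
    moreover have "(\<lambda>x. indicator \<Omega> x *\<^sub>R (norm (u' x))\<^sup>2) = (\<lambda>x. (u' x)\<^sup>2)"
      using u0 by (intro ext) (auto split: split_indicator)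
    ultimately show "integrable lborel (\<lambda>x. (u' x)\<^sup>2)" by simp
    have "integrable (lebesgue_on \<Omega>) (\<lambda>x. (norm (g' x))\<^sup>2)"
      using gi gA by (subst integrable_cong_AE[of _ _ "\<lambda>x. (norm (g x))\<^sup>2"]) (auto intro!: L borel_measurable_power borel_measurable_norm gm)
    then have "integrable lborel (\<lambda>x. indicator \<Omega> x *\<^sub>R (norm (g' x))\<^sup>2)"
      by (subst (asm) integrable_lebesgue_on_borel) auto
    moreover have "(\<lambda>x. indicator \<Omega> x *\<^sub>R (norm (g' x))\<^sup>2) = (\<lambda>x. (norm (g' x))\<^sup>2)"
      using g0 by (intro ext) (auto split: split_indicator)
    ultimately show "integrable lborel (\<lambda>x. (norm (g' x))\<^sup>2)" by simp
    fix \<psi> d\<psi> assume C: "C1c_with_gradient \<Omega> \<psi> d\<psi>"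
    have [measurable]: "\<psi> \<in> borel_measurable borel" "d\<psi> \<in> borel_measurable borel"
      using C1c_facts[OF C] by metis+
    note [measurable] = um gm L[OF u'] L[OF g']
    have [measurable]: "\<psi> \<in> borel_measurable (lebesgue_on \<Omega>)" "d\<psi> \<in> borel_measurable (lebesgue_on \<Omega>)" by (auto intro!: L)
    have "(\<integral>x. u x *\<^sub>R d\<psi> x \<partial>lebesgue_on \<Omega>) = (\<integral>x. u' x *\<^sub>R d\<psi> x \<partial>lebesgue_on \<Omega>)"
      using uA by (intro integral_cong_AE) (auto elim!: eventually_mono)
    also have "\<dots> = (\<integral>x. indicator \<Omega> x *\<^sub>R (u' x *\<^sub>R d\<psi> x) \<partial>lborel)"
      by (rule integral_lebesgue_on_borel) auto
    also have "\<dots> = (\<integral>x. u' x *\<^sub>R d\<psi> x \<partial>lborel)"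
      using u0 by (intro Bochner_Integration.integral_cong) (auto simp: indicator_def)
    finally have 1: "(\<integral>x. u x *\<^sub>R d\<psi> x \<partial>lebesgue_on \<Omega>) = (\<integral>x. u' x *\<^sub>R d\<psi> x \<partial>lborel)" .
    have "(\<integral>x. \<psi> x *\<^sub>R g x \<partial>lebesgue_on \<Omega>) = (\<integral>x. \<psi> x *\<^sub>R g' x \<partial>lebesgue_on \<Omega>)"
      using gA by (intro integral_cong_AE) (auto elim!: eventually_mono)
    also have "\<dots> = (\<integral>x. indicator \<Omega> x *\<^sub>R (\<psi> x *\<^sub>R g' x) \<partial>lborel)"
      by (rule integral_lebesgue_on_borel) auto
    also have "\<dots> = (\<integral>x. \<psi> x *\<^sub>R g' x \<partial>lborel)"
      using g0 by (intro Bochner_Integration.integral_cong) (auto simp: indicator_def)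
    finally have 2: "(\<integral>x. \<psi> x *\<^sub>R g x \<partial>lebesgue_on \<Omega>) = (\<integral>x. \<psi> x *\<^sub>R g' x \<partial>lborel)" .
    have "(\<integral>x. u x *\<^sub>R d\<psi> x \<partial>lebesgue_on \<Omega>) = - (\<integral>x. \<psi> x *\<^sub>R g x \<partial>lebesgue_on \<Omega>)"
      using H C by (simp add: H1_with_gradient_def)
    then show "(\<integral>x. u' x *\<^sub>R d\<psi> x \<partial>lborel) = - (\<integral>x. \<psi> x *\<^sub>R g' x \<partial>lborel)" by (simp add: 1 2)
  qed auto
  then show thesis using that u0 g0 uA gA by blast
qed

section \<open>Orthogonal sums and dyadic sums over frequencies\<close>

text \<open>Pythagoras, stated with general squared norms \<mu> because it is applied to the
  eigenfunctions, where they are 1, and to their gradients, where they are the eigenvalues.\<close>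

lemma nn_integral_orthogonal_sum:
  fixes h :: "nat \<Rightarrow> 'a \<Rightarrow> 'b::euclidean_space"
  assumes m[measurable]: "\<And>j. h j \<in> borel_measurable M"
    and i: "\<And>j. integrable M (\<lambda>x. (norm (h j x))\<^sup>2)"
    and o: "\<And>i j. (\<integral>x. h i x \<bullet> h j x \<partial>M) = (if i = j then \<mu> j else 0)"
    and J: "finite J"
  shows "(\<integral>\<^sup>+x. ennreal ((norm (\<Sum>j\<in>J. a j *\<^sub>R h j x))\<^sup>2) \<partial>M) = ennreal (\<Sum>j\<in>J. (a j)\<^sup>2 * \<mu> j)"
proof -
  have ii: "integrable M (\<lambda>x. h i x \<bullet> h j x)" for i j
  proof (rule Bochner_Integration.integrable_bound)
    show "integrable M (\<lambda>x. (norm (h i x))\<^sup>2 + (norm (h j x))\<^sup>2)" using i by simp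
    have "\<bar>h i x \<bullet> h j x\<bar> \<le> (norm (h i x))\<^sup>2 + (norm (h j x))\<^sup>2" for x
    proof -
      have "\<bar>h i x \<bullet> h j x\<bar> \<le> norm (h i x) * norm (h j x)" by (rule Cauchy_Schwarz_ineq2)
      also have "\<dots> \<le> (norm (h i x))\<^sup>2 + (norm (h j x))\<^sup>2"
        proof -
        have "0 \<le> norm (h i x) * norm (h j x)" by simp
        then show ?thesis using sum_squares_bound[of "norm (h i x)" "norm (h j x)"] unfolding mult.assoc by linarith
      qed
      finally show ?thesis .
    qed
    then show "AE x in M. norm (h i x \<bullet> h j x) \<le> norm ((norm (h i x))\<^sup>2 + (norm (h j x))\<^sup>2)" by simp
  qed measurable
  have eq: "(norm (\<Sum>j\<in>J. a j *\<^sub>R h j x))\<^sup>2 = (\<Sum>i\<in>J. \<Sum>j\<in>J. a i * a j * (h i x \<bullet> h j x))" for x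
    by (simp add: power2_norm_eq_inner inner_sum_left inner_sum_right sum_distrib_left mult_ac inner_commute)
  have int: "integrable M (\<lambda>x. (norm (\<Sum>j\<in>J. a j *\<^sub>R h j x))\<^sup>2)"
    unfolding eq using ii by simp
  have "(\<integral>x. (norm (\<Sum>j\<in>J. a j *\<^sub>R h j x))\<^sup>2 \<partial>M) = (\<Sum>i\<in>J. \<Sum>j\<in>J. a i * a j * (\<integral>x. h i x \<bullet> h j x \<partial>M))"
    unfolding eq using ii by (simp add: Bochner_Integration.integral_sum)
  also have "\<dots> = (\<Sum>j\<in>J. (a j)\<^sup>2 * \<mu> j)"
    using J by (simp add: o if_distrib power2_eq_square cong: if_cong)
  finally show ?thesis using int by (subst nn_integral_eq_integral) auto
qed

text \<open>An increasing geometric sum is controlled by its last selected term; c = 1 / (1 - 1/b)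
  is the value of the geometric series in 1/b.\<close>

lemma low_frequency_sum:
  assumes c: "1 + c / b = c" "0 \<le> c" "1 < b" and L: "\<And>l. x l \<Longrightarrow> b ^ l \<le> L" "0 \<le> L"
  shows "(\<Sum>l<M. b ^ l * (if x l then 1 else 0)) \<le> c * (L::real)"
proof -
  define A where "A M = (\<Sum>l<M. b ^ l * (if x l then 1 else 0))" for M
  \<comment> \<open>The exponent M - 1 is written as a quotient, so that M = 0 starts the
    induction.\<close>
  have 1: "A M \<le> c * (b ^ M / b)" for M
  proof (induction M)
    case (Suc M)
    have "A (Suc M) \<le> A M + b ^ M" using c by (simp add: A_def)
    also have "\<dots> \<le> c * (b ^ M / b) + b ^ M" using Suc by simp
    also have "\<dots> = b ^ M * (1 + c / b)" by (simp add: algebra_simps)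
    also have "\<dots> = c * (b ^ Suc M / b)" using c by simp
    finally show ?case .
  qed (use c in \<open>simp add: A_def\<close>)
  have "A M \<le> c * L"
  proof (induction M)
    case (Suc M)
    show ?case
    proof (cases "x M")
      case True
      have "A (Suc M) \<le> c * (b ^ Suc M / b)" by (rule 1)
      also have "\<dots> = c * b ^ M" using c by simp
      also have "\<dots> \<le> c * L" using L(1)[of M] True c by (intro mult_left_mono) auto
      finally show ?thesis .
    next
      case False
      then show ?thesis using Suc by (simp add: A_def)
    qed
  qed (use c L in \<open>simp add: A_def\<close>)
  then show ?thesis by (simp add: A_def)
qed

text \<open>A decreasing geometric sum is controlled by its first selected term. The invariant of
  the induction reserves d r^M, the sum of all terms from index M on; before the first selection the
  sum is 0.\<close>

lemma high_frequency_sum: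
  assumes d: "1 + d * r = d" "0 \<le> d" "0 < r" "r < 1" and L: "\<And>l. x l \<Longrightarrow> r ^ l \<le> L" "0 \<le> L"
  shows "(\<Sum>l<M. r ^ l * (if x l then 1 else 0)) \<le> d * (L::real)"
proof -
  define A where "A M = (\<Sum>l<M. r ^ l * (if x l then 1 else 0))" for M
  have "A M = 0 \<or> A M + d * r ^ M \<le> d * L"
  proof (induction M)
    case (Suc M)
    show ?case
    proof (cases "x M")
      case True
      have dM: "d * r ^ M \<le> d * L" using L(1)[OF True] d by (intro mult_left_mono) auto
      have "A (Suc M) + d * r ^ Suc M = A M + r ^ M * (1 + d * r)" using True by (simp add: A_def algebra_simps)
      also have "\<dots> = A M + d * r ^ M" using d by simp
      finally show ?thesis using Suc dM by auto
    next
      case False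
      have "d * r ^ Suc M \<le> d * r ^ M" using d by (intro mult_left_mono power_decreasing) auto
      then show ?thesis using False Suc by (auto simp: A_def)
    qed
  qed (simp add: A_def)
  moreover have "0 \<le> d * r ^ M" "0 \<le> d * L" using d L by simp_all
  ultimately have "A M \<le> d * L" by linarith
  then show ?thesis by (simp add: A_def)
qed

text \<open>The cost of a single mode with eigenvalue \<mu> over all scales. While 4^l < \<mu> the
  mode belongs to the rough part and costs 4^(l s); afterwards it belongs to the smooth part and
  costs 4^(l (s - 1)) \<mu>. Both geometric sums are dominated by the scale at which 4^l passes
  \<mu>, where they are of size \<mu>^s.\<close>

lemma dyadic_frequency_sum:
  assumes s: "0 < s" "s < 1"
  obtains C where "0 \<le> C" "\<And>\<mu> M. 0 \<le> \<mu> \<Longrightarrow>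
    (\<Sum>l<M. 4 powr (real l * s) * ((if 4 ^ l < \<mu> then 1 else 0) + (1/4) ^ l * (if \<mu> \<le> 4 ^ l then \<mu> else 0))) \<le> C * \<mu> powr s"
proof -
  define b :: real where "b = 4 powr s"
  define r :: real where "r = 4 powr (s - 1)"
  define c where "c = 1 / (1 - 1 / b)"
  define d where "d = 1 / (1 - r)"
  have b: "1 < b" using s by (simp add: b_def)
  have r: "0 < r" "r < 1" using s by (auto simp: r_def powr_less_one)
  have c: "1 + c / b = c" "0 \<le> c" using b by (auto simp: c_def field_simps)
  have d: "1 + d * r = d" "0 \<le> d" using r by (auto simp: d_def field_simps)
  have bl: "4 powr (real l * s) = b ^ l" for l by (simp add: b_def powr_realpow[symmetric] powr_powr mult.commute)
  have rl: "4 powr (real l * (s - 1)) = r ^ l" for l by (simp add: r_def powr_realpow[symmetric] powr_powr mult.commute)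
  have br: "b ^ l * (1/4) ^ l = r ^ l" for l
  proof -
    have "b * (1/4) = r" by (simp add: b_def r_def powr_diff)
    then show ?thesis by (metis power_mult_distrib)
  qed
  show thesis
  proof (rule that[of "c + d"])
    fix \<mu> :: real and M assume \<mu>: "0 \<le> \<mu>"
    show "(\<Sum>l<M. 4 powr (real l * s) * ((if 4 ^ l < \<mu> then 1 else 0) + (1/4) ^ l * (if \<mu> \<le> 4 ^ l then \<mu> else 0))) \<le> (c + d) * \<mu> powr s"
    proof (cases "\<mu> = 0")
      case True
      then show ?thesis by simp
    next
      case False
      then have \<mu>: "0 < \<mu>" using \<mu> by simp
      have "(\<Sum>l<M. 4 powr (real l * s) * ((if 4 ^ l < \<mu> then 1 else 0) + (1/4) ^ l * (if \<mu> \<le> 4 ^ l then \<mu> else 0))) =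
        (\<Sum>l<M. b ^ l * (if 4 ^ l < \<mu> then 1 else 0)) + \<mu> * (\<Sum>l<M. r ^ l * (if \<mu> \<le> 4 ^ l then 1 else 0))"
        unfolding bl br[symmetric] sum_distrib_left sum.distrib[symmetric]
        by (intro sum.cong refl) (auto simp: distrib_left mult_ac)
      also have "\<dots> \<le> c * \<mu> powr s + \<mu> * (d * \<mu> powr (s - 1))"
      proof (intro add_mono mult_left_mono low_frequency_sum[OF c b] high_frequency_sum[OF d r])
        fix l :: nat
        show "b ^ l \<le> \<mu> powr s" if "4 ^ l < \<mu>"
        proof -
          have "(4 ^ l) powr s \<le> \<mu> powr s" using s that by (intro powr_mono2) auto
          then show "b ^ l \<le> \<mu> powr s" by (simp add: powr_realpow[symmetric] powr_powr flip: bl)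
        qed
        show "r ^ l \<le> \<mu> powr (s - 1)" if "\<mu> \<le> 4 ^ l"
        proof -
          have "(4 ^ l) powr (s - 1) \<le> \<mu> powr (s - 1)" using s \<mu> that by (intro powr_mono2') auto
          then show ?thesis by (simp add: powr_realpow[symmetric] powr_powr flip: rl)
        qed
      qed (use \<mu> in auto)
      also have "\<dots> = (c + d) * \<mu> powr s" using \<mu> by (simp add: powr_diff algebra_simps)
      finally show ?thesis .
    qed
  qed (use c d in auto)
qed

locale neumann_domain =
  fixes \<Omega> :: "(real ^ 'n) set" and lam :: "nat \<Rightarrow> real" and \<phi> :: "nat \<Rightarrow> real ^ 'n \<Rightarrow> real"
  assumes bounded: "bounded \<Omega>" and lipschitz: "lipschitz_domain \<Omega>"
    and mass: "emeasure lebesgue \<Omega> = 1" and sys: "neumann_eigensystem \<Omega> lam \<phi>"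
begin

lemma open_domain: "open \<Omega>" using lipschitz by (simp add: lipschitz_domain_def)

lemma meas_\<Omega>[measurable]: "\<Omega> \<in> sets borel" using open_domain by simp

lemma lam_nonneg: "0 \<le> lam j"
  using sys incseqD[of lam 0 j] by (simp add: neumann_eigensystem_def)

lemma lam_pos: "0 < lam (Suc j)"
  using sys incseqD[of lam 1 "Suc j"] by (auto simp: neumann_eigensystem_def)

sublocale M: prob_space "lebesgue_on \<Omega>"
  using mass by (intro prob_spaceI) (simp add: emeasure_restrict_space)

lemma basis_L2: "in_L2 (lebesgue_on \<Omega>) (\<phi> j)"
  using sys by (simp add: neumann_eigensystem_def L2_orthonormal_basis_def)

lemma basis_orth: "L2_inner (lebesgue_on \<Omega>) (\<phi> i) (\<phi> j) = (if i = j then 1 else 0)"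
  using sys by (simp add: neumann_eigensystem_def L2_orthonormal_basis_def)

lemma basis_meas[measurable]: "\<phi> j \<in> borel_measurable (lebesgue_on \<Omega>)"
  using basis_L2 by (simp add: in_L2_def)

text \<open>Testing the weak equation of one eigenfunction with another one shows that the gradients
  are orthogonal too, with squared norms \<open>lam j\<close>.\<close>

lemma borel_system:
  obtains f g where "\<And>j. borel_H1 \<Omega> (f j) (g j)" "\<And>j x. x \<notin> \<Omega> \<Longrightarrow> f j x = 0"
    "\<And>j. AE x in lebesgue_on \<Omega>. \<phi> j x = f j x"
    "\<And>i j. (\<integral>x. f i x * f j x \<partial>lborel) = (if i = j then 1 else 0)"
    "\<And>i j. (\<integral>x. g i x \<bullet> g j x \<partial>lborel) = (if i = j then lam j else 0)"
proof -
  have "\<exists>G. H1_with_gradient \<Omega> (\<phi> j) G \<and> (\<forall>v h. H1_with_gradient \<Omega> v h \<longrightarrow>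
           (\<integral>x. G x \<bullet> h x \<partial>lebesgue_on \<Omega>) = lam j * L2_inner (lebesgue_on \<Omega>) (\<phi> j) v)" for j
    using sys by (auto simp: neumann_eigensystem_def neumann_eigenfunction_def)
  then obtain G where G: "\<And>j. H1_with_gradient \<Omega> (\<phi> j) (G j)"
    "\<And>j v h. H1_with_gradient \<Omega> v h \<Longrightarrow> (\<integral>x. G j x \<bullet> h x \<partial>lebesgue_on \<Omega>) = lam j * L2_inner (lebesgue_on \<Omega>) (\<phi> j) v"
    by metis
  have "\<forall>j. \<exists>f g. borel_H1 \<Omega> f g \<and> (\<forall>x. x \<notin> \<Omega> \<longrightarrow> f x = 0) \<and> (\<forall>x. x \<notin> \<Omega> \<longrightarrow> g x = 0) \<and>
      (AE x in lebesgue_on \<Omega>. \<phi> j x = f x) \<and> (AE x in lebesgue_on \<Omega>. G j x = g x)"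
  proof
    fix j
    show "\<exists>f g. borel_H1 \<Omega> f g \<and> (\<forall>x. x \<notin> \<Omega> \<longrightarrow> f x = 0) \<and> (\<forall>x. x \<notin> \<Omega> \<longrightarrow> g x = 0) \<and>
      (AE x in lebesgue_on \<Omega>. \<phi> j x = f x) \<and> (AE x in lebesgue_on \<Omega>. G j x = g x)"
      by (rule H1_borel_version[OF open_domain G(1)[of j]]) blast
  qed
  then obtain f g where h: "\<forall>j. borel_H1 \<Omega> (f j) (g j) \<and> (\<forall>x. x \<notin> \<Omega> \<longrightarrow> f j x = 0) \<and> (\<forall>x. x \<notin> \<Omega> \<longrightarrow> g j x = 0) \<and>
      (AE x in lebesgue_on \<Omega>. \<phi> j x = f j x) \<and> (AE x in lebesgue_on \<Omega>. G j x = g j x)"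
    unfolding choice_iff by blast
  have fg: "\<And>j. borel_H1 \<Omega> (f j) (g j)" "\<And>j x. x \<notin> \<Omega> \<Longrightarrow> f j x = 0" "\<And>j x. x \<notin> \<Omega> \<Longrightarrow> g j x = 0"
    "\<And>j. AE x in lebesgue_on \<Omega>. \<phi> j x = f j x" "\<And>j. AE x in lebesgue_on \<Omega>. G j x = g j x"
    using h by blast+
  have [measurable]: "f j \<in> borel_measurable borel" "g j \<in> borel_measurable borel" for j
    using fg(1)[of j] by (auto simp: borel_H1_def)
  have [measurable]: "f j \<in> borel_measurable (lebesgue_on \<Omega>)" "g j \<in> borel_measurable (lebesgue_on \<Omega>)" for j
    by (auto intro!: borel_measurable_lebesgue_on)
  have [measurable]: "G j \<in> borel_measurable (lebesgue_on \<Omega>)" for j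
    using G(1)[of j] by (simp add: H1_with_gradient_def in_L2_def)
  show thesis
  proof (rule that[OF fg(1) fg(2) fg(4)])
    fix i j
    have "(\<integral>x. f i x * f j x \<partial>lborel) = (\<integral>x. indicator \<Omega> x *\<^sub>R (f i x * f j x) \<partial>lborel)"
      using fg(2) by (intro Bochner_Integration.integral_cong) (auto split: split_indicator)
    also have "\<dots> = (\<integral>x. f i x * f j x \<partial>lebesgue_on \<Omega>)"
      by (rule integral_lebesgue_on_borel[symmetric]) auto
    also have "\<dots> = (\<integral>x. \<phi> i x * \<phi> j x \<partial>lebesgue_on \<Omega>)"
    proof (rule integral_cong_AE)
      show "AE x in lebesgue_on \<Omega>. f i x * f j x = \<phi> i x * \<phi> j x"
        using fg(4)[of i] fg(4)[of j] by eventually_elim simp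
    qed measurable
    also have "\<dots> = (if i = j then 1 else 0)" using basis_orth[of i j] by (simp add: L2_inner_def)
    finally show "(\<integral>x. f i x * f j x \<partial>lborel) = (if i = j then 1 else 0)" .
    have "(\<integral>x. g i x \<bullet> g j x \<partial>lborel) = (\<integral>x. indicator \<Omega> x *\<^sub>R (g i x \<bullet> g j x) \<partial>lborel)"
      using fg(3) by (intro Bochner_Integration.integral_cong) (auto split: split_indicator)
    also have "\<dots> = (\<integral>x. g i x \<bullet> g j x \<partial>lebesgue_on \<Omega>)"
      by (rule integral_lebesgue_on_borel[symmetric]) auto
    also have "\<dots> = (\<integral>x. G i x \<bullet> G j x \<partial>lebesgue_on \<Omega>)"
    proof (rule integral_cong_AE)
      show "AE x in lebesgue_on \<Omega>. g i x \<bullet> g j x = G i x \<bullet> G j x"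
        using fg(5)[of i] fg(5)[of j] by eventually_elim simp
    qed measurable
    also have "\<dots> = (if i = j then lam j else 0)"
      using G(2)[OF G(1)[of j], of i] basis_orth[of i j] by simp
    finally show "(\<integral>x. g i x \<bullet> g j x \<partial>lborel) = (if i = j then lam j else 0)" .
  qed
qed

text \<open>For finite sums the smooth parts are finite sums as well, so their weak gradients are
  computed term by term and no gradient series has to converge. The constant does not depend on N,
  which allows a later passage to the limit.\<close>

lemma finite_embedding:
  assumes s: "0 < s" "s < 1" "2 * s < real CARD('n)" and q: "q = 2 * real CARD('n) / (real CARD('n) - 2 * s)"
  obtains C where "0 \<le> C" "\<And>a N. (\<integral>\<^sup>+x. ennreal (\<bar>\<Sum>j<N. a j * \<phi> j x\<bar> powr q) \<partial>lebesgue_on \<Omega>) \<le>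
     ennreal (C * (\<Sum>j<N. (1 + lam j powr s) * (a j)\<^sup>2) powr (q / 2))"
proof -
  obtain f g where fg: "\<And>j. borel_H1 \<Omega> (f j) (g j)" "\<And>j x. x \<notin> \<Omega> \<Longrightarrow> f j x = 0"
    "\<And>j. AE x in lebesgue_on \<Omega>. \<phi> j x = f j x"
    "\<And>i j. (\<integral>x. f i x * f j x \<partial>lborel) = (if i = j then 1 else 0)"
    "\<And>i j. (\<integral>x. g i x \<bullet> g j x \<partial>lborel) = (if i = j then lam j else 0)"
    using borel_system by blast
  have [measurable]: "f j \<in> borel_measurable borel" "g j \<in> borel_measurable borel"
    and f2: "integrable lborel (\<lambda>x. (norm (f j x))\<^sup>2)" and g2: "integrable lborel (\<lambda>x. (norm (g j x))\<^sup>2)" for j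
    using fg(1)[of j] by (auto simp: borel_H1_def)
  have [measurable]: "f j \<in> borel_measurable (lebesgue_on \<Omega>)" for j
    by (auto intro!: borel_measurable_lebesgue_on)
  have nf: "(\<integral>\<^sup>+x. ennreal ((\<Sum>j\<in>J. a j * f j x)\<^sup>2) \<partial>lborel) = ennreal (\<Sum>j\<in>J. (a j)\<^sup>2)" if "finite J" for J a
    using nn_integral_orthogonal_sum[of f lborel "\<lambda>_. 1" J a] that f2 fg(4) by simp
  have ng: "(\<integral>\<^sup>+x. ennreal ((norm (\<Sum>j\<in>J. a j *\<^sub>R g j x))\<^sup>2) \<partial>lborel) = ennreal (\<Sum>j\<in>J. (a j)\<^sup>2 * lam j)" if "finite J" for J a
    using nn_integral_orthogonal_sum[of g lborel lam J a] that g2 fg(5) by simp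
  obtain C1 where C1: "0 \<le> C1" "\<And>\<mu> M. 0 \<le> \<mu> \<Longrightarrow>
    (\<Sum>l<M. 4 powr (real l * s) * ((if 4 ^ l < \<mu> then 1 else 0) + (1/4) ^ l * (if \<mu> \<le> 4 ^ l then \<mu> else 0))) \<le> C1 * \<mu> powr s"
    by (rule dyadic_frequency_sum[OF s(1,2)]) (rule that)
  define X where "X a N = (\<Sum>j<N. (1 + lam j powr s) * (a j)\<^sup>2)" for a N
  have X0: "0 \<le> X a N" for a N unfolding X_def by (intro sum_nonneg mult_nonneg_nonneg) auto
  define U where "U a N x = (\<Sum>j<N. a j * f j x)" for a N x
  \<comment> \<open>In 1 + C1 the 1 pays for the L_2 norm of the sum and C1 for the weighted costs
    over all scales.\<close>
  have ms: "multiscale \<Omega> s (sqrt ((1 + C1) * X a N)) (U a N)" for a N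
  proof -
    have T2: "(sqrt ((1 + C1) * X a N))\<^sup>2 = (1 + C1) * X a N" using C1 X0[of a N] by simp
    \<comment> \<open>The modes in \<open>J l\<close> make up the smooth part at scale l, those in
      \<open>J' l\<close> the rough part.\<close>
    define J where "J l = {j \<in> {..<N}. lam j \<le> 4 ^ l}" for l
    define J' where "J' l = {j \<in> {..<N}. 4 ^ l < lam j}" for l
    have fJ: "finite (J l)" "finite (J' l)" and JJ: "J l \<inter> J' l = {}" "J l \<union> J' l = {..<N}" for l
      by (auto simp: J_def J'_def)
    show ?thesis
      unfolding multiscale_def T2
    proof (intro conjI exI allI)
      show "U a N \<in> borel_measurable borel" unfolding U_def by measurable
      have "(\<Sum>j<N. (a j)\<^sup>2) \<le> X a N" unfolding X_def by (intro sum_mono) (simp add: distrib_right)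
      also have "\<dots> \<le> (1 + C1) * X a N" using C1 X0[of a N] by (simp add: distrib_right)
      finally show "(\<integral>\<^sup>+x. ennreal ((U a N x)\<^sup>2) \<partial>lborel) \<le> ennreal ((1 + C1) * X a N)"
        unfolding U_def by (subst nf) (auto intro: ennreal_leI)
      fix l :: nat
      show "(\<lambda>x. \<Sum>j\<in>J' l. a j * f j x) \<in> borel_measurable borel" by measurable
      show "borel_H1 \<Omega> (\<lambda>x. \<Sum>j\<in>J l. a j * f j x) (\<lambda>x. \<Sum>j\<in>J l. a j *\<^sub>R g j x)"
        by (rule borel_H1_sum[OF fJ(1) fg(1)])
      show "x \<notin> \<Omega> \<longrightarrow> (\<Sum>j\<in>J l. a j * f j x) = 0" for x using fg(2) by simp
      show "U a N x = (\<Sum>j\<in>J' l. a j * f j x) + (\<Sum>j\<in>J l. a j * f j x)" for x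
        unfolding U_def JJ(2)[of l, symmetric] by (subst sum.union_disjoint[OF fJ JJ(1)]) simp
      show "0 \<le> (\<Sum>j\<in>J' l. (a j)\<^sup>2)" "0 \<le> (\<Sum>j\<in>J l. (a j)\<^sup>2 * lam j)"
        using lam_nonneg by (auto intro!: sum_nonneg)
      show "(\<integral>\<^sup>+x. ennreal ((\<Sum>j\<in>J' l. a j * f j x)\<^sup>2) \<partial>lborel) \<le> ennreal (\<Sum>j\<in>J' l. (a j)\<^sup>2)"
        by (subst nf[OF fJ(2)]) simp
      show "(\<integral>\<^sup>+x. ennreal ((norm (\<Sum>j\<in>J l. a j *\<^sub>R g j x))\<^sup>2) \<partial>lborel) \<le> ennreal (\<Sum>j\<in>J l. (a j)\<^sup>2 * lam j)"
        by (subst ng[OF fJ(1)]) simp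
    next
      fix M :: nat
      define B where "B j l = (if 4 ^ l < lam j then 1 else 0) + (1/4) ^ l * (if lam j \<le> 4 ^ l then lam j else 0)" for j l
      have inner: "(\<Sum>j\<in>J' l. (a j)\<^sup>2) + (1/4) ^ l * (\<Sum>j\<in>J l. (a j)\<^sup>2 * lam j) =
        (\<Sum>j<N. (a j)\<^sup>2 * B j l)" for l
      proof -
        have "(\<Sum>j\<in>J' l. (a j)\<^sup>2) = (\<Sum>j<N. if 4 ^ l < lam j then (a j)\<^sup>2 else 0)"
          unfolding J'_def by (rule sum.inter_filter) simp
        moreover have "(\<Sum>j\<in>J l. (a j)\<^sup>2 * lam j) = (\<Sum>j<N. if lam j \<le> 4 ^ l then (a j)\<^sup>2 * lam j else 0)"
          unfolding J_def by (rule sum.inter_filter) simp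
        ultimately show ?thesis
          by (simp only: sum_distrib_left sum.distrib[symmetric]) (intro sum.cong refl, auto simp: B_def algebra_simps)
      qed
      have "(\<Sum>l<M. 4 powr (real l * s) * ((\<Sum>j\<in>J' l. (a j)\<^sup>2) + (1/4) ^ l * (\<Sum>j\<in>J l. (a j)\<^sup>2 * lam j))) =
        (\<Sum>l<M. \<Sum>j<N. 4 powr (real l * s) * ((a j)\<^sup>2 * B j l))"
        unfolding inner by (simp only: sum_distrib_left)
      \<comment> \<open>With the sum over scales inside, each mode can be estimated on its
        own.\<close>
      also have "\<dots> = (\<Sum>j<N. \<Sum>l<M. 4 powr (real l * s) * ((a j)\<^sup>2 * B j l))" by (rule sum.swap)
      also have "\<dots> = (\<Sum>j<N. (a j)\<^sup>2 * (\<Sum>l<M. 4 powr (real l * s) * B j l))"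
        by (simp only: sum_distrib_left mult.left_commute)
      also have "\<dots> \<le> (\<Sum>j<N. (a j)\<^sup>2 * (C1 * lam j powr s))"
        unfolding B_def by (intro sum_mono mult_left_mono C1 lam_nonneg) auto
      also have "\<dots> \<le> C1 * X a N"
        unfolding X_def sum_distrib_left using C1 by (intro sum_mono) (simp add: algebra_simps)
      also have "\<dots> \<le> (1 + C1) * X a N" using X0[of a N] by (simp add: distrib_right)
      finally show "(\<Sum>l<M. 4 powr (real l * s) * ((\<Sum>j\<in>J' l. (a j)\<^sup>2) + (1/4) ^ l * (\<Sum>j\<in>J l. (a j)\<^sup>2 * lam j))) \<le> (1 + C1) * X a N" .
    qed
  qed
  obtain \<P> where \<P>: "finite \<P>" "\<Omega> = \<Union>\<P>" "\<And>P. P \<in> \<P> \<Longrightarrow> P \<in> sets borel \<and>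
    (\<exists>z0. \<exists>r>0. \<forall>x\<in>P. \<forall>z\<in>cball z0 r. \<forall>t. 0 < t \<and> t \<le> 1 \<longrightarrow> x + t *\<^sub>R z \<in> \<Omega>)"
    using lipschitz_domain_finite_cover[OF lipschitz bounded] by metis
  have "\<forall>P\<in>\<P>. \<exists>C\<ge>0. \<forall>u T. 0 \<le> T \<longrightarrow> multiscale \<Omega> s T u \<longrightarrow>
     (\<integral>\<^sup>+x\<in>P. ennreal (\<bar>u x\<bar> powr q) \<partial>lborel) \<le> ennreal (C * T powr q)"
  proof
    fix P assume P: "P \<in> \<P>"
    obtain z0 r where r: "0 < r" "\<And>x z t. x \<in> P \<Longrightarrow> z \<in> cball z0 r \<Longrightarrow> 0 < t \<Longrightarrow> t \<le> 1 \<Longrightarrow> x + t *\<^sub>R z \<in> \<Omega>"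
      using \<P>(3)[OF P] by metis
    \<comment> \<open>Each patch has its own ball of inward directions, hence its own kernel and
      constant.\<close>
    obtain \<rho> d\<rho> R K where "averaging_kernel \<rho> d\<rho> (cball z0 r) R K"
      using ex_averaging_kernel[OF r(1), of z0] by metis
    then interpret averaging_kernel \<rho> d\<rho> "cball z0 r" R K .
    show "\<exists>C\<ge>0. \<forall>u T. 0 \<le> T \<longrightarrow> multiscale \<Omega> s T u \<longrightarrow>
     (\<integral>\<^sup>+x\<in>P. ennreal (\<bar>u x\<bar> powr q) \<partial>lborel) \<le> ennreal (C * T powr q)"
      by (rule local_embedding[OF bounded meas_\<Omega> _ r(2) s(1,3) q]) (use \<P>(3)[OF P] in auto)
  qed
  from bchoice[OF this] obtain C where "\<forall>P\<in>\<P>. 0 \<le> C P \<and> (\<forall>u T. 0 \<le> T \<longrightarrow> multiscale \<Omega> s T u \<longrightarrow>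
     (\<integral>\<^sup>+x\<in>P. ennreal (\<bar>u x\<bar> powr q) \<partial>lborel) \<le> ennreal (C P * T powr q))" by blast
  then have C: "\<And>P. P \<in> \<P> \<Longrightarrow> 0 \<le> C P" "\<And>P u T. P \<in> \<P> \<Longrightarrow> 0 \<le> T \<Longrightarrow> multiscale \<Omega> s T u \<Longrightarrow>
     (\<integral>\<^sup>+x\<in>P. ennreal (\<bar>u x\<bar> powr q) \<partial>lborel) \<le> ennreal (C P * T powr q)"
    by blast+
  define C' where "C' = (\<Sum>P\<in>\<P>. C P) * (1 + C1) powr (q / 2)"
  have C'0: "0 \<le> (\<Sum>P\<in>\<P>. C P)" by (intro sum_nonneg C)
  show thesis
  proof (rule that[of C'])
    show "0 \<le> C'" using C'0 by (simp add: C'_def)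
    fix a N
    define T where "T = sqrt ((1 + C1) * X a N)"
    have T: "0 \<le> T" using C1 X0[of a N] by (simp add: T_def)
    have "AE x in lebesgue_on \<Omega>. \<forall>j\<in>{..<N}. \<phi> j x = f j x" using fg(3) by (intro AE_finite_allI) auto
    then have "(\<integral>\<^sup>+x. ennreal (\<bar>\<Sum>j<N. a j * \<phi> j x\<bar> powr q) \<partial>lebesgue_on \<Omega>) = (\<integral>\<^sup>+x. ennreal (\<bar>U a N x\<bar> powr q) \<partial>lebesgue_on \<Omega>)"
      unfolding U_def by (intro nn_integral_cong_AE) (auto elim!: eventually_mono)
    also have "\<dots> = (\<integral>\<^sup>+x\<in>\<Omega>. ennreal (\<bar>U a N x\<bar> powr q) \<partial>lborel)"
      by (rule nn_integral_lebesgue_on_borel) simp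
    \<comment> \<open>The patches may overlap; counting points several times only increases the
      right-hand side.\<close>
    also have "\<dots> \<le> (\<integral>\<^sup>+x. (\<Sum>P\<in>\<P>. ennreal (\<bar>U a N x\<bar> powr q) * indicator P x) \<partial>lborel)"
    proof (rule nn_integral_mono)
      fix x
      show "ennreal (\<bar>U a N x\<bar> powr q) * indicator \<Omega> x \<le> (\<Sum>P\<in>\<P>. ennreal (\<bar>U a N x\<bar> powr q) * indicator P x)"
      proof (cases "x \<in> \<Omega>")
        case True
        then obtain P where P: "P \<in> \<P>" "x \<in> P" using \<P>(2) by auto
        have "ennreal (\<bar>U a N x\<bar> powr q) * indicator P x \<le> (\<Sum>P\<in>\<P>. ennreal (\<bar>U a N x\<bar> powr q) * indicator P x)"
          using P \<P>(1) by (intro member_le_sum) auto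
        then show ?thesis using True P by simp
      qed simp
    qed
    also have "\<dots> = (\<Sum>P\<in>\<P>. \<integral>\<^sup>+x\<in>P. ennreal (\<bar>U a N x\<bar> powr q) \<partial>lborel)"
    proof (rule nn_integral_sum)
      fix P assume "P \<in> \<P>"
      then have [measurable]: "P \<in> sets borel" using \<P>(3) by blast
      show "(\<lambda>x. ennreal (\<bar>U a N x\<bar> powr q) * indicator P x) \<in> borel_measurable lborel" unfolding U_def by measurable
    qed
    also have "\<dots> \<le> (\<Sum>P\<in>\<P>. ennreal (C P * T powr q))"
      by (intro sum_mono C(2) T) (auto simp: T_def intro: ms)
    also have "\<dots> = ennreal ((\<Sum>P\<in>\<P>. C P) * T powr q)"
      using C(1) by (subst sum_ennreal) (auto simp: sum_distrib_right)
    also have "T powr q = (1 + C1) powr (q / 2) * X a N powr (q / 2)"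
      using C1 X0[of a N] by (simp add: T_def powr_half_sqrt[symmetric] powr_powr powr_mult)
    finally show "(\<integral>\<^sup>+x. ennreal (\<bar>\<Sum>j<N. a j * \<phi> j x\<bar> powr q) \<partial>lebesgue_on \<Omega>) \<le>
       ennreal (C' * (\<Sum>j<N. (1 + lam j powr s) * (a j)\<^sup>2) powr (q / 2))"
      by (simp add: C'_def X_def mult.assoc)
  qed
qed

end

section \<open>Constants and mean values in the spectral expansion\<close>

lemma lborel_integral_translate:
  fixes f :: "'a::euclidean_space \<Rightarrow> 'b::{banach, second_countable_topology}"
  assumes [measurable]: "f \<in> borel_measurable borel"
  shows "(\<integral>y. f (y + c) \<partial>lborel) = (\<integral>y. f y \<partial>lborel)"
proof -
  have "(\<integral>y. f y \<partial>lborel) = (\<integral>y. f y \<partial>distr lborel borel ((+) c))" by (simp add: lborel_distr_plus)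
  also have "\<dots> = (\<integral>y. f (c + y) \<partial>lborel)" by (rule integral_distr) measurable
  finally show ?thesis by (simp add: add.commute)
qed

text \<open>The integral of \<psi>(y + i) - \<psi>(y) is 0 by translation invariance. By the
  fundamental theorem and Fubini it is also the integral over t in [0, 1] of the integrated i-th
  derivative, which does not depend on t. The lemma serves to show that constants have weak gradient
  0.\<close>

lemma C1c_gradient_integral:
  fixes \<psi> :: "real ^ 'n \<Rightarrow> real"
  assumes C1: "C1c_with_gradient \<Omega> \<psi> d\<psi>"
  shows "integrable lborel d\<psi>" "(\<integral>x. d\<psi> x \<partial>lborel) = 0"
proof -
  obtain C B where C: "C \<in> sets borel" "emeasure lborel C < \<infinity>" "bounded C" "0 \<le> B"
    and B: "\<And>x. \<bar>\<psi> x\<bar> \<le> B" "\<And>x. norm (d\<psi> x) \<le> B" and z: "\<And>x. x \<notin> C \<Longrightarrow> \<psi> x = 0 \<and> d\<psi> x = 0"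
    and [measurable]: "\<psi> \<in> borel_measurable borel" "d\<psi> \<in> borel_measurable borel"
    by (rule C1c_facts[OF C1]) (rule that)
  have cd: "continuous_on UNIV d\<psi>" and gd: "\<And>x. GDERIV \<psi> x :> d\<psi> x"
    using C1 by (auto simp: C1c_with_gradient_def)
  have iC: "integrable lborel (\<lambda>x. B * indicator C x)" using C by (intro integrable_mult_right integrable_real_indicator) auto
  have BC: "\<bar>\<psi> x\<bar> \<le> norm (B * indicator C x)" "norm (d\<psi> x) \<le> norm (B * indicator C x)" for x
    using B[of x] z[of x] C(4) by (cases "x \<in> C"; simp)+
  show id: "integrable lborel d\<psi>"
    by (rule Bochner_Integration.integrable_bound[OF iC _ AE_I2[OF BC(2)]]) measurable
  have i\<psi>: "integrable lborel \<psi>"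
    by (rule Bochner_Integration.integrable_bound[OF iC _ AE_I2]) (use BC(1) in auto)
  obtain r where r: "\<And>x. x \<in> C \<Longrightarrow> norm x \<le> r" using C(3) unfolding bounded_iff by blast
  \<comment> \<open>Shifting by t i with t in [0, 1] moves the support by at most 1, hence the
    radius r + 1.\<close>
  define C' where "C' = cball (0 :: real^'n) (r + 1)"
  have C': "C' \<in> sets borel" "emeasure lborel C' < \<infinity>"
    using emeasure_bounded_finite[of C'] by (simp_all add: C'_def)
  have iC': "integrable lborel (\<lambda>x. B * indicator C' x)" using C' by (intro integrable_mult_right integrable_real_indicator) auto
  have "(\<integral>x. d\<psi> x \<partial>lborel) \<bullet> i = 0 \<bullet> i" if i: "i \<in> Basis" for i
  proof -
    have ni: "norm i = 1" using i by simp
    define F where "F y t = indicator {0..1} t * (d\<psi> (y + t *\<^sub>R i) \<bullet> i)" for y and t :: real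
    have meas[measurable]: "case_prod F \<in> borel_measurable (lborel \<Otimes>\<^sub>M lborel)"
      unfolding F_def by measurable
    have Fb: "\<bar>F y t\<bar> \<le> (B * indicator C' y) * indicator {0..1} t" for y t
    proof (cases "t \<in> {0..1} \<and> d\<psi> (y + t *\<^sub>R i) \<noteq> 0")
      case True
      then have "norm (y + t *\<^sub>R i) \<le> r" using z r by blast
      moreover have "norm (t *\<^sub>R i) \<le> 1" using True ni by simp
      ultimately have "y \<in> C'" using norm_triangle_ineq4[of "y + t *\<^sub>R i" "t *\<^sub>R i"] by (simp add: C'_def)
      moreover have "\<bar>d\<psi> (y + t *\<^sub>R i) \<bullet> i\<bar> \<le> B" using Cauchy_Schwarz_ineq2[of "d\<psi> (y + t *\<^sub>R i)" i] B(2)[of "y + t *\<^sub>R i"] ni by simp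
      ultimately show ?thesis using True by (simp add: F_def)
    qed (use C in \<open>auto simp: F_def\<close>)
    have intF: "integrable (lborel \<Otimes>\<^sub>M lborel) (case_prod F)"
      by (rule integrable_product_Icc[OF meas iC' Fb]) simp
    have ftc: "(\<integral>t. F y t \<partial>lborel) = \<psi> (y + i) - \<psi> y" for y
    proof -
      have "(\<integral>t. indicator {0..1} t *\<^sub>R (d\<psi> (y + t *\<^sub>R i) \<bullet> i) \<partial>lborel) = \<psi> (y + 1 *\<^sub>R i) - \<psi> (y + 0 *\<^sub>R i)"
      proof (rule integral_FTC_atLeastAtMost)
        fix t :: real
        have "((\<lambda>t. \<psi> (y + t *\<^sub>R i)) has_derivative (\<lambda>h. (h *\<^sub>R i) \<bullet> d\<psi> (y + t *\<^sub>R i))) (at t)"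
        proof (rule has_derivative_compose[of "\<lambda>t. y + t *\<^sub>R i" "\<lambda>h. h *\<^sub>R i"])
          show "((\<lambda>t. y + t *\<^sub>R i) has_derivative (\<lambda>h. h *\<^sub>R i)) (at t)"
            by (auto intro!: derivative_eq_intros)
          show "(\<psi> has_derivative (\<lambda>h. h \<bullet> d\<psi> (y + t *\<^sub>R i))) (at (y + t *\<^sub>R i))"
            using gd by (simp add: gderiv_def)
        qed
        then have "((\<lambda>t. \<psi> (y + t *\<^sub>R i)) has_vector_derivative (d\<psi> (y + t *\<^sub>R i) \<bullet> i)) (at t)"
          by (simp add: has_vector_derivative_def inner_commute)
        then show "((\<lambda>t. \<psi> (y + t *\<^sub>R i)) has_vector_derivative (d\<psi> (y + t *\<^sub>R i) \<bullet> i)) (at t within {0..1})"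
          by (rule has_vector_derivative_at_within)
        show "continuous_on {0..1} (\<lambda>t. d\<psi> (y + t *\<^sub>R i) \<bullet> i)"
          by (intro continuous_intros continuous_on_compose2[OF cd]) auto
      qed simp
      then show ?thesis by (simp add: F_def)
    qed
    have im: "(\<integral>y. \<psi> (y + i) \<partial>lborel) = (\<integral>y. \<psi> y \<partial>lborel)" by (rule lborel_integral_translate) measurable
    have ii: "integrable lborel (\<lambda>y. \<psi> (y + i))"
    proof -
      have "integrable (distr lborel borel ((+) i)) \<psi>" using i\<psi> by (simp add: lborel_distr_plus)
      then have "integrable lborel (\<lambda>y. \<psi> (i + y))" by (subst (asm) integrable_distr_eq) auto
      then show ?thesis by (simp add: add.commute)
    qed
    have "0 = (\<integral>y. (\<integral>t. F y t \<partial>lborel) \<partial>lborel)"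
      using im ii i\<psi> by (simp add: ftc)
    also have "\<dots> = (\<integral>t. (\<integral>y. F y t \<partial>lborel) \<partial>lborel)"
      by (rule lborel_pair.Fubini_integral[symmetric, OF intF])
    also have "\<dots> = (\<integral>t. indicator {0..1::real} t * ((\<integral>x. d\<psi> x \<partial>lborel) \<bullet> i) \<partial>lborel)"
    proof (intro Bochner_Integration.integral_cong refl)
      fix t :: real
      have "(\<integral>y. d\<psi> (y + t *\<^sub>R i) \<bullet> i \<partial>lborel) = (\<integral>y. d\<psi> y \<bullet> i \<partial>lborel)"
        by (rule lborel_integral_translate[of "\<lambda>y. d\<psi> y \<bullet> i"]) measurable
      then show "(\<integral>y. F y t \<partial>lborel) = indicator {0..1} t * ((\<integral>x. d\<psi> x \<partial>lborel) \<bullet> i)"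
        using id by (simp add: F_def)
    qed
    finally show ?thesis by simp
  qed
  then show "(\<integral>x. d\<psi> x \<partial>lborel) = 0" by (rule euclidean_eqI)
qed

context neumann_domain begin

abbreviation \<mu> where "\<mu> \<equiv> lebesgue_on \<Omega>"

definition coef :: "(real ^ 'n \<Rightarrow> real) \<Rightarrow> nat \<Rightarrow> real" where
  "coef u j = L2_inner \<mu> u (\<phi> j)"

lemma prob_\<Omega>: "measure \<mu> \<Omega> = 1"
  using M.prob_space by simp

lemma in_L2_iff: "in_L2 \<mu> u \<longleftrightarrow> u \<in> borel_measurable \<mu> \<and> integrable \<mu> (\<lambda>x. (u x)\<^sup>2)" for u :: "real ^ 'n \<Rightarrow> real"
  by (simp add: in_L2_def)

lemma L2_mult_integrable:
  fixes u v :: "real ^ 'n \<Rightarrow> real"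
  assumes "in_L2 \<mu> u" "in_L2 \<mu> v"
  shows "integrable \<mu> (\<lambda>x. u x * v x)"
proof (rule Bochner_Integration.integrable_bound)
  show "integrable \<mu> (\<lambda>x. (u x)\<^sup>2 + (v x)\<^sup>2)" using assms by (simp add: in_L2_iff)
  have "\<bar>u x * v x\<bar> \<le> (u x)\<^sup>2 + (v x)\<^sup>2" for x
  proof -
    have "0 \<le> \<bar>u x\<bar> * \<bar>v x\<bar>" by simp
    then have "\<bar>u x\<bar> * \<bar>v x\<bar> \<le> \<bar>u x\<bar>\<^sup>2 + \<bar>v x\<bar>\<^sup>2"
      using sum_squares_bound[of "\<bar>u x\<bar>" "\<bar>v x\<bar>"] unfolding mult.assoc by linarith
    then show ?thesis by (simp add: abs_mult)
  qed
  then show "AE x in \<mu>. norm (u x * v x) \<le> norm ((u x)\<^sup>2 + (v x)\<^sup>2)" by simp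
qed (use assms in \<open>auto simp: in_L2_iff\<close>)

lemma in_L2_const: "in_L2 \<mu> (\<lambda>x. c :: real)"
  by (simp add: in_L2_iff)

lemma in_L2_diff_const:
  fixes u :: "real ^ 'n \<Rightarrow> real"
  assumes "in_L2 \<mu> u" shows "in_L2 \<mu> (\<lambda>x. u x - c)"
proof -
  have "integrable \<mu> u" using L2_mult_integrable[OF assms in_L2_const[of 1]] by simp
  then show ?thesis using assms by (simp add: in_L2_iff power2_diff)
qed

lemma L2_integrable:
  fixes u :: "real ^ 'n \<Rightarrow> real"
  assumes "in_L2 \<mu> u" shows "integrable \<mu> u"
  using L2_mult_integrable[OF assms in_L2_const[of 1]] by simp

text \<open>Bessel's identity, by expanding the square and using orthonormality.\<close>

lemma partial_sum_error:
  assumes u: "in_L2 \<mu> u"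
  shows "integrable \<mu> (\<lambda>x. (u x - (\<Sum>j<N. coef u j * \<phi> j x))\<^sup>2)"
    and "(\<integral>x. (u x - (\<Sum>j<N. coef u j * \<phi> j x))\<^sup>2 \<partial>\<mu>) = (\<integral>x. (u x)\<^sup>2 \<partial>\<mu>) - (\<Sum>j<N. (coef u j)\<^sup>2)"
proof -
  have eq: "(u x - (\<Sum>j<N. coef u j * \<phi> j x))\<^sup>2 = (u x)\<^sup>2 - 2 * (\<Sum>j<N. coef u j * (u x * \<phi> j x)) +
      (\<Sum>i<N. \<Sum>j<N. coef u i * coef u j * (\<phi> i x * \<phi> j x))" for x
  proof -
    have "(\<Sum>j<N. coef u j * \<phi> j x)\<^sup>2 = (\<Sum>i<N. \<Sum>j<N. coef u i * coef u j * (\<phi> i x * \<phi> j x))"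
      unfolding power2_eq_square sum_product by (intro sum.cong refl) (simp add: mult_ac)
    moreover have "u x * (\<Sum>j<N. coef u j * \<phi> j x) = (\<Sum>j<N. coef u j * (u x * \<phi> j x))"
      unfolding sum_distrib_left by (intro sum.cong refl) (simp add: mult_ac)
    ultimately show ?thesis by (simp add: power2_diff mult.assoc)
  qed
  have u2: "integrable \<mu> (\<lambda>x. (u x)\<^sup>2)" using u by (simp add: in_L2_iff)
  note i = L2_mult_integrable[OF u basis_L2] L2_mult_integrable[OF basis_L2 basis_L2]
  show "integrable \<mu> (\<lambda>x. (u x - (\<Sum>j<N. coef u j * \<phi> j x))\<^sup>2)"
    unfolding eq using u2 i by simp
  have o: "(\<integral>x. \<phi> i x * \<phi> j x \<partial>\<mu>) = (if i = j then 1 else 0)" for i j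
    using basis_orth[of i j] by (simp add: L2_inner_def)
  have c: "(\<integral>x. u x * \<phi> j x \<partial>\<mu>) = coef u j" for j by (simp add: coef_def L2_inner_def)
  have "(\<integral>x. (u x - (\<Sum>j<N. coef u j * \<phi> j x))\<^sup>2 \<partial>\<mu>) = (\<integral>x. (u x)\<^sup>2 \<partial>\<mu>) - 2 * (\<Sum>j<N. coef u j * coef u j) +
      (\<Sum>i<N. \<Sum>j<N. coef u i * coef u j * (if i = j then 1 else 0))"
    unfolding eq using u2 i by (simp add: Bochner_Integration.integral_sum o c)
  also have "(\<Sum>i<N. \<Sum>j<N. coef u i * coef u j * (if i = j then 1 else 0)) = (\<Sum>j<N. coef u j * coef u j)"
    by (simp add: if_distrib cong: if_cong)
  finally show "(\<integral>x. (u x - (\<Sum>j<N. coef u j * \<phi> j x))\<^sup>2 \<partial>\<mu>) = (\<integral>x. (u x)\<^sup>2 \<partial>\<mu>) - (\<Sum>j<N. (coef u j)\<^sup>2)"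
    by (simp add: power2_eq_square)
qed

lemma partial_sum_converges:
  assumes "in_L2 \<mu> u"
  shows "(\<lambda>N. \<integral>x. (u x - (\<Sum>j<N. coef u j * \<phi> j x))\<^sup>2 \<partial>\<mu>) \<longlonglongrightarrow> 0"
  using sys assms by (simp add: neumann_eigensystem_def L2_orthonormal_basis_def coef_def)

lemma zero_coef:
  assumes u: "in_L2 \<mu> u" and "\<And>j. coef u j = 0"
  shows "AE x in \<mu>. u x = 0"
proof -
  have "(\<lambda>N::nat. \<integral>x. (u x)\<^sup>2 \<partial>\<mu>) \<longlonglongrightarrow> 0" using partial_sum_converges[OF u] assms(2) by simp
  then have "(\<integral>x. (u x)\<^sup>2 \<partial>\<mu>) = 0" by (simp add: LIMSEQ_const_iff)
  then show ?thesis using u by (subst (asm) integral_nonneg_eq_0_iff_AE) (auto simp: in_L2_iff)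
qed

lemma one_H1: "H1_with_gradient \<Omega> (\<lambda>x. 1) (\<lambda>x. 0)"
  unfolding H1_with_gradient_def
proof (intro conjI allI impI)
  show "in_L2 \<mu> (\<lambda>x. 1 :: real)" by (rule in_L2_const)
  show "in_L2 \<mu> (\<lambda>x. 0 :: real ^ 'n)" by (simp add: in_L2_def)
  fix \<psi> d\<psi> assume C1: "C1c_with_gradient \<Omega> \<psi> d\<psi>"
  obtain C where C: "C \<subseteq> \<Omega>" "\<And>x. x \<notin> C \<Longrightarrow> \<psi> x = 0 \<and> d\<psi> x = 0" and m: "d\<psi> \<in> borel_measurable borel"
    by (rule C1c_facts[OF C1]) (rule that)
  have "(\<integral>x. d\<psi> x \<partial>\<mu>) = (\<integral>x. indicator \<Omega> x *\<^sub>R d\<psi> x \<partial>lborel)"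
    by (rule integral_lebesgue_on_borel[OF meas_\<Omega> m])
  also have "\<dots> = (\<integral>x. d\<psi> x \<partial>lborel)"
    using C by (intro Bochner_Integration.integral_cong) (auto split: split_indicator)
  also have "\<dots> = 0" by (rule C1c_gradient_integral[OF C1])
  finally show "(\<integral>x. 1 *\<^sub>R d\<psi> x \<partial>\<mu>) = - (\<integral>x. \<psi> x *\<^sub>R (0 :: real ^ 'n) \<partial>\<mu>)" by simp
qed

text \<open>The weak eigenvalue equation is tested with the constant 1, whose gradient is 0; the
  eigenvalue is positive and can be cancelled.\<close>

lemma integral_basis_Suc: "(\<integral>x. \<phi> (Suc j) x \<partial>\<mu>) = 0"
proof -
  have "neumann_eigenfunction \<Omega> (lam (Suc j)) (\<phi> (Suc j))"
    using sys by (simp add: neumann_eigensystem_def)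
  then obtain g where "\<And>v h. H1_with_gradient \<Omega> v h \<Longrightarrow>
           (\<integral>x. g x \<bullet> h x \<partial>\<mu>) = lam (Suc j) * L2_inner \<mu> (\<phi> (Suc j)) v"
    unfolding neumann_eigenfunction_def by blast
  from this[OF one_H1] have "lam (Suc j) * (\<integral>x. \<phi> (Suc j) x \<partial>\<mu>) = 0" by (simp add: L2_inner_def)
  then show ?thesis using lam_pos[of j] by simp
qed

lemma coef_diff_const: 
  assumes "in_L2 \<mu> u" 
  shows "coef (\<lambda>x. u x - c) j = coef u j - c * (\<integral>x. \<phi> j x \<partial>\<mu>)"
  using L2_mult_integrable[OF assms basis_L2[of j]] L2_integrable[OF basis_L2[of j]]
  by (simp add: coef_def L2_inner_def left_diff_distrib)

text \<open>That the first eigenfunction is constant is not part of the definition of an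
  eigensystem. It follows from completeness: all later eigenfunctions are orthogonal to 1, so the
  expansion of 1 consists of a multiple of \<open>\<phi> 0\<close> alone.\<close>

lemma basis_0_const: "\<exists>c. AE x in \<mu>. \<phi> 0 x = c"
proof -
  define c where "c = (\<integral>x. \<phi> 0 x \<partial>\<mu>)"
  have c1: "coef (\<lambda>x. 1) (Suc j) = 0" for j using integral_basis_Suc[of j] by (simp add: coef_def L2_inner_def)
  have c0: "coef (\<lambda>x. 1) 0 = c" by (simp add: coef_def L2_inner_def c_def)
  have sum: "(\<Sum>j<Suc N. coef (\<lambda>x. 1) j * \<phi> j x) = c * \<phi> 0 x" for N x
    by (subst sum.lessThan_Suc_shift) (simp add: c0 c1)
  have "(\<lambda>N::nat. \<integral>x. (1 - c * \<phi> 0 x)\<^sup>2 \<partial>\<mu>) \<longlonglongrightarrow> 0"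
    using LIMSEQ_Suc[OF partial_sum_converges[OF in_L2_const[of 1]]] by (simp only: sum)
  then have z: "(\<integral>x. (1 - c * \<phi> 0 x)\<^sup>2 \<partial>\<mu>) = 0" by (simp add: LIMSEQ_const_iff)
  have "integrable \<mu> (\<lambda>x. (1 - c * \<phi> 0 x)\<^sup>2)"
    using partial_sum_error(1)[OF in_L2_const[of 1], of "Suc 0"] by (simp only: sum)
  then have "AE x in \<mu>. (1 - c * \<phi> 0 x)\<^sup>2 = 0" using z by (subst (asm) integral_nonneg_eq_0_iff_AE) auto
  then have "AE x in \<mu>. \<phi> 0 x = 1 / c"
  proof eventually_elim
    case (elim x)
    then have "c * \<phi> 0 x = 1" by simp
    then show ?case by (metis mult_zero_left nonzero_mult_div_cancel_left zero_neq_one)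
  qed
  then show ?thesis by blast
qed

lemma mean_zero_coef_0:
  assumes u: "in_L2 \<mu> u" "(\<integral>x. u x \<partial>\<mu>) = 0"
  shows "coef u 0 = 0"
proof -
  obtain c where c: "AE x in \<mu>. \<phi> 0 x = c" using basis_0_const by blast
  have [measurable]: "u \<in> borel_measurable \<mu>" using u by (simp add: in_L2_iff)
  have "coef u 0 = (\<integral>x. u x * c \<partial>\<mu>)"
    unfolding coef_def L2_inner_def using c by (intro integral_cong_AE) (auto elim!: eventually_mono)
  then show ?thesis using u by simp
qed

lemma fractional_form_coef: "fractional_form \<Omega> lam \<phi> s u = (\<Sum>j. lam (Suc j) powr s * (coef u (Suc j))\<^sup>2)"
  by (simp add: fractional_form_def coef_def)

lemma in_Hs_coef: "in_Hs \<Omega> lam \<phi> s u \<longleftrightarrow> in_L2 \<mu> u \<and> summable (\<lambda>j. lam (Suc j) powr s * (coef u (Suc j))\<^sup>2)"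
  by (simp add: in_Hs_def coef_def)

lemma fractional_form_nonneg: "in_Hs \<Omega> lam \<phi> s u \<Longrightarrow> 0 \<le> fractional_form \<Omega> lam \<phi> s u"
  by (auto simp: fractional_form_coef in_Hs_coef intro!: suminf_nonneg)

lemma diff_const_Hs:
  assumes "in_Hs \<Omega> lam \<phi> s u"
  shows "in_Hs \<Omega> lam \<phi> s (\<lambda>x. u x - c)" "fractional_form \<Omega> lam \<phi> s (\<lambda>x. u x - c) = fractional_form \<Omega> lam \<phi> s u"
  using assms coef_diff_const[of u c] integral_basis_Suc
  by (simp_all add: in_Hs_coef fractional_form_coef in_L2_diff_const)

lemma one_Hs: "in_Hs \<Omega> lam \<phi> s (\<lambda>x. 1)" "fractional_form \<Omega> lam \<phi> s (\<lambda>x. 1) = 0"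
proof -
  have "coef (\<lambda>x. 1) (Suc j) = 0" for j using integral_basis_Suc[of j] by (simp add: coef_def L2_inner_def)
  then show "in_Hs \<Omega> lam \<phi> s (\<lambda>x. 1)" "fractional_form \<Omega> lam \<phi> s (\<lambda>x. 1) = 0"
    by (simp_all add: in_Hs_coef fractional_form_coef in_L2_const)
qed

text \<open>The equality case behind uniqueness: a vanishing form kills all modes with positive
  eigenvalue, subtracting the mean kills the remaining one, and completeness concludes.\<close>

lemma zero_form_const:
  assumes u: "in_Hs \<Omega> lam \<phi> s u" and z: "fractional_form \<Omega> lam \<phi> s u = 0"
  shows "AE x in \<mu>. u x = (\<integral>x. u x \<partial>\<mu>)"
proof -
  define m where "m = (\<integral>x. u x \<partial>\<mu>)"
  define v where "v x = u x - m" for x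
  have u2: "in_L2 \<mu> u" using u by (simp add: in_Hs_coef)
  have v2: "in_L2 \<mu> v" unfolding v_def using u2 by (rule in_L2_diff_const)
  have "(\<integral>x. v x \<partial>\<mu>) = 0" unfolding v_def using L2_integrable[OF u2] by (simp add: m_def prob_\<Omega>)
  then have v0: "coef v 0 = 0" by (rule mean_zero_coef_0[OF v2])
  have "lam (Suc j) powr s * (coef u (Suc j))\<^sup>2 = 0" for j
    using u z suminf_eq_zero_iff[of "\<lambda>j. lam (Suc j) powr s * (coef u (Suc j))\<^sup>2"]
    by (auto simp: fractional_form_coef in_Hs_coef)
  then have "coef u (Suc j) = 0" for j using lam_pos[of j] by (metis less_irrefl mult_eq_0_iff power_eq_0_iff powr_gt_zero)
  then have "coef v (Suc j) = 0" for j
    unfolding v_def using coef_diff_const[OF u2] integral_basis_Suc by simp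
  then have "coef v j = 0" for j using v0 by (cases j) auto
  then have "AE x in \<mu>. v x = 0" by (rule zero_coef[OF v2])
  then show ?thesis by (auto simp: v_def m_def elim!: eventually_mono)
qed

section \<open>From finite sums to the norm inequality\<close>

text \<open>For mean zero only modes with eigenvalue at least \<open>lam 1\<close> occur, so the
  spectral gap bounds the full norm of order s' by the fractional form of order s. The order s' =
  n/2 - n/p is chosen so that p is critical for it.\<close>

lemma poincare_sobolev:
  assumes s: "0 < s" "s < 1" and p: "2 < p" "real CARD('n) / 2 - real CARD('n) / p \<le> s"
  obtains C where "0 \<le> C" "\<And>v. in_Hs \<Omega> lam \<phi> s v \<Longrightarrow> (\<integral>x. v x \<partial>\<mu>) = 0 \<Longrightarrow>
     integrable \<mu> (\<lambda>x. \<bar>v x\<bar> powr p) \<and> (\<integral>x. \<bar>v x\<bar> powr p \<partial>\<mu>) powr (2 / p) \<le> C * fractional_form \<Omega> lam \<phi> s v"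
proof -
  define n where "n = real CARD('n)"
  define s' where "s' = n / 2 - n / p"
  have n: "1 \<le> n" by (simp add: n_def Suc_le_eq)
  have "n / p < n / 2" using n p by (intro divide_strict_left_mono) auto
  then have s': "0 < s'" "s' < 1" "s' \<le> s" using s p by (auto simp: s'_def n_def)
  have s'n: "2 * s' < real CARD('n)" using n p by (simp add: s'_def flip: n_def)
  have pq: "p = 2 * real CARD('n) / (real CARD('n) - 2 * s')"
    using n p by (simp add: s'_def flip: n_def)
  obtain C where C: "0 \<le> C" "\<And>a N. (\<integral>\<^sup>+x. ennreal (\<bar>\<Sum>j<N. a j * \<phi> j x\<bar> powr p) \<partial>\<mu>) \<le>
     ennreal (C * (\<Sum>j<N. (1 + lam j powr s') * (a j)\<^sup>2) powr (p / 2))"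
    by (rule finite_embedding[OF s'(1,2) s'n pq]) (rule that)
  \<comment> \<open>The two terms compare 1 and \<open>lam j powr s'\<close> with
    \<open>lam j powr s\<close>. The exponents - s and s' - s are not positive, so the smallest
    positive eigenvalue is the worst case.\<close>
  define D where "D = lam (Suc 0) powr (- s) + lam (Suc 0) powr (s' - s)"
  have D: "0 \<le> D" by (simp add: D_def)
  have lamD: "1 + lam (Suc j) powr s' \<le> D * lam (Suc j) powr s" for j
  proof -
    have l: "lam (Suc 0) \<le> lam (Suc j)" using sys incseqD[of lam "Suc 0" "Suc j"] by (simp add: neumann_eigensystem_def)
    have "1 = lam (Suc j) powr (- s) * lam (Suc j) powr s" using lam_pos[of j] by (simp flip: powr_add)
    also have "\<dots> \<le> lam (Suc 0) powr (- s) * lam (Suc j) powr s"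
      using l lam_pos[of 0] s by (intro mult_right_mono powr_mono2') auto
    finally have 1: "1 \<le> lam (Suc 0) powr (- s) * lam (Suc j) powr s" .
    have "lam (Suc j) powr s' = lam (Suc j) powr (s' - s) * lam (Suc j) powr s" by (simp flip: powr_add)
    also have "\<dots> \<le> lam (Suc 0) powr (s' - s) * lam (Suc j) powr s"
      using l lam_pos[of 0] s' by (intro mult_right_mono powr_mono2') auto
    finally show ?thesis using 1 by (simp add: D_def distrib_right)
  qed
  show thesis
  proof (rule that[of "C powr (2 / p) * D"])
    show "0 \<le> C powr (2 / p) * D" using D by simp
    fix v assume v: "in_Hs \<Omega> lam \<phi> s v" "(\<integral>x. v x \<partial>\<mu>) = 0"
    define Q where "Q = fractional_form \<Omega> lam \<phi> s v"
    have Q: "0 \<le> Q" unfolding Q_def by (rule fractional_form_nonneg[OF v(1)])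
    have v2: "in_L2 \<mu> v" and sm: "summable (\<lambda>j. lam (Suc j) powr s * (coef v (Suc j))\<^sup>2)"
      using v by (auto simp: in_Hs_coef)
    have [measurable]: "v \<in> borel_measurable \<mu>" using v2 by (simp add: in_L2_iff)
    have v0: "coef v 0 = 0" by (rule mean_zero_coef_0[OF v2 v(2)])
    have XN: "(\<Sum>j<N. (1 + lam j powr s') * (coef v j)\<^sup>2) \<le> D * Q" for N
    proof (cases N)
      case 0
      then show ?thesis using D Q by simp
    next
      case (Suc N')
      have "(\<Sum>j<N. (1 + lam j powr s') * (coef v j)\<^sup>2) = (\<Sum>j<N'. (1 + lam (Suc j) powr s') * (coef v (Suc j))\<^sup>2)"
        unfolding Suc by (subst sum.lessThan_Suc_shift) (simp add: v0)
      also have "\<dots> \<le> (\<Sum>j<N'. D * (lam (Suc j) powr s * (coef v (Suc j))\<^sup>2))"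
        using lamD by (intro sum_mono) (simp add: mult.assoc[symmetric] mult_right_mono)
      also have "\<dots> = D * (\<Sum>j<N'. lam (Suc j) powr s * (coef v (Suc j))\<^sup>2)" by (simp add: sum_distrib_left)
      also have "\<dots> \<le> D * Q"
        unfolding Q_def fractional_form_coef using D sm by (intro mult_left_mono sum_le_suminf) auto
      finally show ?thesis .
    qed
    define S where "S N x = (\<Sum>j<N. coef v j * \<phi> j x)" for N x
    have [measurable]: "S N \<in> borel_measurable \<mu>" for N unfolding S_def by measurable
    have lim0: "(\<lambda>N. \<integral>x. norm ((v x - S N x)\<^sup>2) \<partial>\<mu>) \<longlonglongrightarrow> 0"
      using partial_sum_converges[OF v2] by (simp add: S_def)
    \<comment> \<open>The partial sums converge in L_2, hence almost everywhere along a subsequence,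
      and Fatou's lemma transfers the uniform bound for finite sums to v.\<close>
    obtain r where r: "strict_mono r" "AE x in \<mu>. (\<lambda>N. (v x - S (r N) x)\<^sup>2) \<longlonglongrightarrow> 0"
      using tendsto_L1_AE_subseq[of \<mu> "\<lambda>N x. (v x - S N x)\<^sup>2", OF _ lim0] partial_sum_error(1)[OF v2] by (auto simp: S_def)
    have "(\<integral>\<^sup>+x. ennreal (\<bar>v x\<bar> powr p) \<partial>\<mu>) \<le> (\<integral>\<^sup>+x. liminf (\<lambda>N. ennreal (\<bar>S (r N) x\<bar> powr p)) \<partial>\<mu>)"
    proof (rule nn_integral_mono_AE, use r(2) in eventually_elim)
      case (elim x)
      then have "(\<lambda>N. sqrt ((v x - S (r N) x)\<^sup>2)) \<longlonglongrightarrow> sqrt 0" by (rule tendsto_real_sqrt)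
      then have "(\<lambda>N. v x - S (r N) x) \<longlonglongrightarrow> 0" by (simp add: tendsto_rabs_zero_iff)
      then have "(\<lambda>N. v x - (v x - S (r N) x)) \<longlonglongrightarrow> v x - 0" by (intro tendsto_intros)
      then have "(\<lambda>N. S (r N) x) \<longlonglongrightarrow> v x" by simp
      then have "(\<lambda>N. \<bar>S (r N) x\<bar> powr p) \<longlonglongrightarrow> \<bar>v x\<bar> powr p"
        using p by (intro tendsto_powr' tendsto_rabs tendsto_const) auto
      then have "(\<lambda>N. ennreal (\<bar>S (r N) x\<bar> powr p)) \<longlonglongrightarrow> ennreal (\<bar>v x\<bar> powr p)" by (rule tendsto_ennrealI)
      then show ?case by (metis lim_imp_Liminf order_refl trivial_limit_sequentially)
    qed
    also have "\<dots> \<le> liminf (\<lambda>N. \<integral>\<^sup>+x. ennreal (\<bar>S (r N) x\<bar> powr p) \<partial>\<mu>)"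
      by (rule nn_integral_liminf) measurable
    also have "\<dots> \<le> ennreal (C * (D * Q) powr (p / 2))"
    proof (rule order_trans[OF Liminf_le_Limsup Limsup_bounded])
      have "(\<integral>\<^sup>+x. ennreal (\<bar>S N x\<bar> powr p) \<partial>\<mu>) \<le> ennreal (C * (D * Q) powr (p / 2))" for N
      proof -
        have "(\<integral>\<^sup>+x. ennreal (\<bar>S N x\<bar> powr p) \<partial>\<mu>) \<le> ennreal (C * (\<Sum>j<N. (1 + lam j powr s') * (coef v j)\<^sup>2) powr (p / 2))"
          unfolding S_def by (rule C)
        also have "\<dots> \<le> ennreal (C * (D * Q) powr (p / 2))"
          using XN[of N] C p by (intro ennreal_leI mult_left_mono powr_mono2) (auto intro!: sum_nonneg mult_nonneg_nonneg)
        finally show ?thesis .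
      qed
      then show "eventually (\<lambda>N. (\<integral>\<^sup>+x. ennreal (\<bar>S (r N) x\<bar> powr p) \<partial>\<mu>) \<le> ennreal (C * (D * Q) powr (p / 2))) sequentially"
        by simp
    qed simp
    finally have nn: "(\<integral>\<^sup>+x. ennreal (\<bar>v x\<bar> powr p) \<partial>\<mu>) \<le> ennreal (C * (D * Q) powr (p / 2))" .
    have int: "integrable \<mu> (\<lambda>x. \<bar>v x\<bar> powr p)"
      using nn by (intro integrableI_bounded) (auto intro: order_le_less_trans)
    have "ennreal (\<integral>x. \<bar>v x\<bar> powr p \<partial>\<mu>) \<le> ennreal (C * (D * Q) powr (p / 2))"
      using nn by (subst (asm) nn_integral_eq_integral[OF int]) auto
    then have le: "(\<integral>x. \<bar>v x\<bar> powr p \<partial>\<mu>) \<le> C * (D * Q) powr (p / 2)"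
      using C by (subst (asm) ennreal_le_iff) auto
    have "(\<integral>x. \<bar>v x\<bar> powr p \<partial>\<mu>) powr (2 / p) \<le> (C * (D * Q) powr (p / 2)) powr (2 / p)"
      using p le by (intro powr_mono2) (auto intro!: Bochner_Integration.integral_nonneg)
    also have "\<dots> = C powr (2 / p) * D * Q" using C D Q p by (simp add: powr_mult powr_powr)
    finally show "integrable \<mu> (\<lambda>x. \<bar>v x\<bar> powr p) \<and> (\<integral>x. \<bar>v x\<bar> powr p \<partial>\<mu>) powr (2 / p) \<le> C powr (2 / p) * D * fractional_form \<Omega> lam \<phi> s v"
      using int by (simp add: Q_def)
  qed
qed

text \<open>Subtracting the mean leaves the fractional form unchanged. The coefficient 1 in front of
  the squared mean survives in front of the squared L_2 norm, because the variance is
  nonnegative.\<close>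

lemma norm_defect:
  assumes s: "0 < s" "s < 1" and p: "2 < p" "real CARD('n) / 2 - real CARD('n) / p \<le> s"
  obtains K where "0 \<le> K" "\<And>u. in_Hs \<Omega> lam \<phi> s u \<Longrightarrow>
     integrable \<mu> (\<lambda>x. \<bar>u x\<bar> powr p) \<and>
     (\<integral>x. \<bar>u x\<bar> powr p \<partial>\<mu>) powr (2 / p) \<le> (\<integral>x. (u x)\<^sup>2 \<partial>\<mu>) + K * fractional_form \<Omega> lam \<phi> s u"
proof -
  obtain C where C: "0 \<le> C" "\<And>v. in_Hs \<Omega> lam \<phi> s v \<Longrightarrow> (\<integral>x. v x \<partial>\<mu>) = 0 \<Longrightarrow>
     integrable \<mu> (\<lambda>x. \<bar>v x\<bar> powr p) \<and> (\<integral>x. \<bar>v x\<bar> powr p \<partial>\<mu>) powr (2 / p) \<le> C * fractional_form \<Omega> lam \<phi> s v"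
    by (rule poincare_sobolev[OF s p]) (rule that)
  have p2: "2 \<le> p" using p by simp
  obtain K where K: "0 \<le> K" "\<And>(c::real) v. v \<in> borel_measurable \<mu> \<Longrightarrow> integrable \<mu> (\<lambda>x. \<bar>v x\<bar> powr p) \<Longrightarrow> (\<integral>x. v x \<partial>\<mu>) = 0 \<Longrightarrow>
     integrable \<mu> (\<lambda>x. \<bar>c + v x\<bar> powr p) \<and>
     (\<integral>x. \<bar>c + v x\<bar> powr p \<partial>\<mu>) powr (2 / p) \<le> c\<^sup>2 + K * (\<integral>x. \<bar>v x\<bar> powr p \<partial>\<mu>) powr (2 / p)"
    by (rule M.mean_zero_perturbation[OF p2]) (rule that)
  show thesis
  proof (rule that[of "K * C"])
    show "0 \<le> K * C" using K C by simp
    fix u assume u: "in_Hs \<Omega> lam \<phi> s u"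
    define m where "m = (\<integral>x. u x \<partial>\<mu>)"
    define v where "v x = u x - m" for x
    have u2: "in_L2 \<mu> u" using u by (simp add: in_Hs_coef)
    have v: "in_Hs \<Omega> lam \<phi> s v" "fractional_form \<Omega> lam \<phi> s v = fractional_form \<Omega> lam \<phi> s u"
      unfolding v_def by (rule diff_const_Hs[OF u])+
    have v2: "in_L2 \<mu> v" using v by (simp add: in_Hs_coef)
    have v0: "(\<integral>x. v x \<partial>\<mu>) = 0" unfolding v_def using L2_integrable[OF u2] by (simp add: m_def prob_\<Omega>)
    have Cv: "integrable \<mu> (\<lambda>x. \<bar>v x\<bar> powr p)" "(\<integral>x. \<bar>v x\<bar> powr p \<partial>\<mu>) powr (2 / p) \<le> C * fractional_form \<Omega> lam \<phi> s u"
      using C(2)[OF v(1) v0] v(2) by auto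
    have vm: "v \<in> borel_measurable \<mu>" using v2 by (simp add: in_L2_iff)
    have Kv: "integrable \<mu> (\<lambda>x. \<bar>u x\<bar> powr p)" "(\<integral>x. \<bar>u x\<bar> powr p \<partial>\<mu>) powr (2 / p) \<le> m\<^sup>2 + K * (\<integral>x. \<bar>v x\<bar> powr p \<partial>\<mu>) powr (2 / p)"
      using K(2)[OF vm Cv(1) v0, of m] by (auto simp: v_def)
    have m2: "m\<^sup>2 \<le> (\<integral>x. (u x)\<^sup>2 \<partial>\<mu>)"
    proof -
      have "0 \<le> (\<integral>x. (v x)\<^sup>2 \<partial>\<mu>)" by (intro Bochner_Integration.integral_nonneg) auto
      also have "\<dots> = (\<integral>x. (u x)\<^sup>2 \<partial>\<mu>) - m\<^sup>2"
        unfolding v_def using u2 L2_integrable[OF u2]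
        by (simp add: in_L2_iff power2_diff prob_\<Omega> flip: m_def) (simp add: power2_eq_square)
      finally show ?thesis by simp
    qed
    have "K * (\<integral>x. \<bar>v x\<bar> powr p \<partial>\<mu>) powr (2 / p) \<le> K * (C * fractional_form \<Omega> lam \<phi> s u)"
      using Cv(2) K by (intro mult_left_mono) auto
    then show "integrable \<mu> (\<lambda>x. \<bar>u x\<bar> powr p) \<and>
       (\<integral>x. \<bar>u x\<bar> powr p \<partial>\<mu>) powr (2 / p) \<le> (\<integral>x. (u x)\<^sup>2 \<partial>\<mu>) + K * C * fractional_form \<Omega> lam \<phi> s u"
      using Kv m2 by (simp add: mult.assoc)
  qed
qed

end

section \<open>Minimizers\<close>

context prob_space begin

lemma Lq_norm_eq:
  assumes [measurable]: "u \<in> borel_measurable M" and i: "integrable M (\<lambda>x. \<bar>u x\<bar> powr p)" and p: "0 < p"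
  shows "Lq_norm M (ennreal p) u = ennreal ((\<integral>x. \<bar>u x\<bar> powr p \<partial>M) powr (1 / p))"
  using p i by (simp add: Lq_norm_def nn_integral_eq_integral Let_def Bochner_Integration.integral_nonneg)

lemma Lq_norm_square_eq:
  assumes "u \<in> borel_measurable M" "integrable M (\<lambda>x. \<bar>u x\<bar> powr p)" "0 < p"
  shows "(Lq_norm M (ennreal p) u)\<^sup>2 = ennreal ((\<integral>x. \<bar>u x\<bar> powr p \<partial>M) powr (2 / p))"
proof -
  have "((\<integral>x. \<bar>u x\<bar> powr p \<partial>M) powr (1 / p))\<^sup>2 = (\<integral>x. \<bar>u x\<bar> powr p \<partial>M) powr (2 / p)"
    by (simp add: power2_eq_square flip: powr_add)
  then show ?thesis by (simp add: Lq_norm_eq[OF assms] ennreal_power)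
qed

lemma Lq_norm_one:
  assumes "q \<noteq> 0"
  shows "Lq_norm M q (\<lambda>x. 1) = 1"
  using assms by (simp add: Lq_norm_def emeasure_space_1 esssup_const Let_def)

lemma Lq_norm_infinite:
  assumes "(\<integral>\<^sup>+x. ennreal (\<bar>u x\<bar> powr p) \<partial>M) = \<infinity>" "0 < p"
  shows "Lq_norm M (ennreal p) u = \<infinity>"
  using assms by (simp add: Lq_norm_def Let_def)

text \<open>The norm is infinite outside the space, so the inequality holds for every measurable
  function, with q' = \<infinity> included.\<close>

lemma Lq_norm_mono:
  assumes [measurable]: "u \<in> borel_measurable M" and q: "0 < q" "q \<le> q'"
  shows "Lq_norm M q u \<le> Lq_norm M q' u"
proof (cases "q = \<infinity>")
  case True
  then show ?thesis using q by (simp add: top_unique)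
next
  case False
  then obtain p where p: "q = ennreal p" "0 < p"
    using q by (cases q) auto
  show ?thesis
  proof (cases "q' = \<infinity>")
    case True
    define e where "e = esssup M (\<lambda>x. ennreal \<bar>u x\<bar>)"
    have e': "Lq_norm M q' u = e" using True by (simp add: Lq_norm_def e_def)
    show ?thesis
    proof (cases e)
      case (real r)
      have "AE x in M. ennreal \<bar>u x\<bar> \<le> e" unfolding e_def by (rule esssup_AE)
      then have r: "AE x in M. \<bar>u x\<bar> \<le> r" using real by (auto elim!: eventually_mono)
      have pr: "AE x in M. \<bar>u x\<bar> powr p \<le> r powr p" using r p by (auto elim!: eventually_mono intro!: powr_mono2)
      have i: "integrable M (\<lambda>x. \<bar>u x\<bar> powr p)"
        by (rule Bochner_Integration.integrable_bound[of M "\<lambda>x. r powr p"]) (use pr in auto)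
      have "(\<integral>x. \<bar>u x\<bar> powr p \<partial>M) \<le> (\<integral>x. r powr p \<partial>M)"
        by (intro integral_mono_AE i pr) auto
      then have "(\<integral>x. \<bar>u x\<bar> powr p \<partial>M) powr (1 / p) \<le> (r powr p) powr (1 / p)"
        using p by (intro powr_mono2) (auto simp: prob_space intro!: Bochner_Integration.integral_nonneg)
      then have "(\<integral>x. \<bar>u x\<bar> powr p \<partial>M) powr (1 / p) \<le> r" using p real by (simp add: powr_powr)
      then show ?thesis using real by (simp add: e' p Lq_norm_eq[OF _ i] ennreal_leI)
    qed (simp add: e')
  next
    case False
    then obtain p' where p': "q' = ennreal p'" "p \<le> p'"
      using q p by (cases q') auto
    show ?thesis
    proof (cases "integrable M (\<lambda>x. \<bar>u x\<bar> powr p')")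
      case True
      have i: "integrable M (\<lambda>x. \<bar>u x\<bar> powr p)"
        by (rule powr_integral_mono(1)[OF _ True]) (use p p' in auto)
      show ?thesis
        using powr_integral_mono(2)[OF _ True p(2) p'(2)] p p' by (simp add: Lq_norm_eq True i ennreal_leI)
    next
      case False
      then have "(\<integral>\<^sup>+x. ennreal (\<bar>u x\<bar> powr p') \<partial>M) = \<infinity>"
        by (auto simp: integrable_iff_bounded less_top[symmetric])
      then show ?thesis using p p' by (simp add: Lq_norm_infinite)
    qed
  qed
qed

end

section \<open>Real exponents in the admissible range\<close>

text \<open>One inequality replaces the case distinction in the range: for 2 s < N it says that p is
  at most the critical exponent, and for N = 1 and s \<ge> 1/2 it holds for every p > 2.\<close>

lemma exponent_range_real:
  assumes s: "0 < s" and N: "1 \<le> N" and q: "q \<in> exponent_range N s"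
  obtains p where "q = ennreal p" "2 < p" "real N / 2 - real N / p \<le> s"
proof (cases "N = 1 \<and> s \<ge> 1 / 2")
  case True
  then have "2 < q" "q < \<infinity>" using q by (auto simp: exponent_range_def)
  then obtain p where p: "q = ennreal p" "2 < p"
    by (cases q) (auto simp: ennreal_less_iff simp flip: ennreal_numeral)
  have "0 < 1 / p" using p by simp
  then have "1 / 2 - 1 / p \<le> s" using True by linarith
  then show thesis using that p True by simp
next
  case False
  then have ns: "2 * s < real N \<or> \<not> s < 1" using N by (cases "N = 1") auto
  show thesis
  proof (cases "2 * s < real N")
    case True
    have "2 < q" "q \<le> ennreal (2 * real N / (real N - 2 * s))"
      using q False by (auto simp: exponent_range_def critical_exponent_def split: if_splits)
    then obtain p where p: "q = ennreal p" "2 < p" "p \<le> 2 * real N / (real N - 2 * s)"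
      using True N by (cases q) (auto simp flip: ennreal_numeral simp: ennreal_le_iff ennreal_less_iff top_unique)
    have "p * (real N - 2 * s) \<le> 2 * real N" using p True by (simp add: pos_le_divide_eq)
    then have "real N / 2 - real N / p \<le> s" using p by (simp add: field_simps)
    then show thesis using that p by blast
  next
    case n: False
    have "2 < q" "q \<le> ennreal (2 * real N / (real N - 2 * s))"
      using q False by (auto simp: exponent_range_def critical_exponent_def split: if_splits)
    \<comment> \<open>Here the formula for the critical exponent is not positive, with value 0 if
      the denominator vanishes; \<open>ennreal\<close> turns it into 0 and the range is
      empty.\<close>
    moreover have "2 * real N / (real N - 2 * s) \<le> 0" using n by (simp add: divide_le_0_iff)
    ultimately show thesis by (simp add: ennreal_neg)
  qed
qed

lemma exponent_range_nonempty:
  assumes s: "0 < s" "s < 1" and N: "1 \<le> N"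
  obtains q where "q \<in> exponent_range N s"
proof (cases "N = 1 \<and> s \<ge> 1 / 2")
  case True
  have "(2::ennreal) < 3" by simp
  then have "3 \<in> exponent_range N s" using True by (auto simp: exponent_range_def)
  then show thesis by (rule that)
next
  case False
  then have "2 * s < real N" using N s by (cases "N = 1") auto
  then have "2 < 2 * real N / (real N - 2 * s)" using s by (simp add: pos_less_divide_eq)
  then have "ennreal 2 < critical_exponent N s" unfolding critical_exponent_def by (subst ennreal_less_iff) auto
  then have "critical_exponent N s \<in> exponent_range N s" using False by (auto simp: exponent_range_def)
  then show thesis by (rule that)
qed

lemma exponent_range_downward:
  "q \<in> exponent_range N s \<Longrightarrow> 2 < q' \<Longrightarrow> q' \<le> q \<Longrightarrow> q' \<in> exponent_range N s"
  by (auto simp: exponent_range_def split: if_splits)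

section \<open>The quotient and its comparison with the constant\<close>

context neumann_domain begin

lemma nonzero_one: "nonzero_Hs \<Omega> lam \<phi> s (\<lambda>x. 1)"
  using one_Hs(1)[of s] by (simp add: nonzero_Hs_def)

lemma quotient_one:
  assumes "q \<noteq> 0"
  shows "quotient_functional \<Omega> lam \<phi> s q \<epsilon> (\<lambda>x. 1) = ennreal (\<epsilon> powr (2 * s))"
  using assms by (simp add: quotient_functional_def one_Hs(2) M.Lq_norm_one divide_ennreal_def)

lemma L2_norm_square:
  assumes u: "in_L2 \<mu> u"
  shows "(Lq_norm \<mu> 2 u)\<^sup>2 = ennreal (\<integral>x. (u x)\<^sup>2 \<partial>\<mu>)"
proof -
  have eq: "\<bar>u x\<bar> powr 2 = (u x)\<^sup>2" for x by (cases "u x = 0") (auto simp: powr_numeral)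
  show ?thesis using M.Lq_norm_square_eq[of u 2] u
    by (simp add: eq in_L2_iff Bochner_Integration.integral_nonneg)
qed

lemma L2_norm_pos:
  assumes u: "nonzero_Hs \<Omega> lam \<phi> s u"
  shows "0 < (\<integral>x. (u x)\<^sup>2 \<partial>\<mu>)"
proof -
  have u2: "integrable \<mu> (\<lambda>x. (u x)\<^sup>2)" using u by (simp add: nonzero_Hs_def in_Hs_coef in_L2_iff)
  have "(\<integral>x. (u x)\<^sup>2 \<partial>\<mu>) \<noteq> 0"
    using u integral_nonneg_eq_0_iff_AE[OF u2] by (auto simp: nonzero_Hs_def)
  moreover have "0 \<le> (\<integral>x. (u x)\<^sup>2 \<partial>\<mu>)" by (intro Bochner_Integration.integral_nonneg) auto
  ultimately show ?thesis by linarith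
qed

lemma quotient_numerator:
  assumes u: "in_Hs \<Omega> lam \<phi> s u"
  shows "ennreal (fractional_form \<Omega> lam \<phi> s u) + ennreal (\<epsilon> powr (2 * s)) * (Lq_norm \<mu> 2 u)\<^sup>2 =
    ennreal (fractional_form \<Omega> lam \<phi> s u + \<epsilon> powr (2 * s) * (\<integral>x. (u x)\<^sup>2 \<partial>\<mu>))"
  using u fractional_form_nonneg[OF u]
  by (simp add: in_Hs_coef L2_norm_square ennreal_mult ennreal_plus Bochner_Integration.integral_nonneg)

text \<open>The norm inequality multiplied by e = \<epsilon>^(2s) bounds e |u|_p^2 by e |u|_2^2 + e
  K Q, where Q is the form, and e K < 1 makes this at most the numerator of the quotient. For
  another minimizer the same chain leaves (1 - e K) Q \<le> 0, hence Q = 0 and the function is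
  constant.\<close>

lemma unique_minimizer:
  assumes p: "2 < p" and K: "0 \<le> K" "\<epsilon> powr (2 * s) * K < 1" and \<epsilon>: "0 < \<epsilon>"
    and D: "\<And>u. in_Hs \<Omega> lam \<phi> s u \<Longrightarrow> integrable \<mu> (\<lambda>x. \<bar>u x\<bar> powr p) \<and>
     (\<integral>x. \<bar>u x\<bar> powr p \<partial>\<mu>) powr (2 / p) \<le> (\<integral>x. (u x)\<^sup>2 \<partial>\<mu>) + K * fractional_form \<Omega> lam \<phi> s u"
  shows "unique_global_minimizer \<Omega> lam \<phi> s (ennreal p) \<epsilon> (\<lambda>x. 1)"
proof -
  define e where "e = \<epsilon> powr (2 * s)"
  have e: "0 < e" "e * K < 1" using \<epsilon> K by (auto simp: e_def)
  have p0: "ennreal p \<noteq> 0" using p by simp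
  define Q where "Q u = fractional_form \<Omega> lam \<phi> s u" for u
  define N2 where "N2 u = (\<integral>x. (u x)\<^sup>2 \<partial>\<mu>)" for u :: "real ^ 'n \<Rightarrow> real"
  define Np where "Np u = (\<integral>x. \<bar>u x\<bar> powr p \<partial>\<mu>) powr (2 / p)" for u :: "real ^ 'n \<Rightarrow> real"
  have facts: "0 \<le> Q u" "0 < N2 u" "0 < Np u" "e * Np u \<le> e * N2 u + e * K * Q u"
    "quotient_functional \<Omega> lam \<phi> s (ennreal p) \<epsilon> u = ennreal ((Q u + e * N2 u) / Np u)" if u: "nonzero_Hs \<Omega> lam \<phi> s u" for u
  proof -
    have h: "in_Hs \<Omega> lam \<phi> s u" using u by (simp add: nonzero_Hs_def)
    have um: "u \<in> borel_measurable \<mu>" using h by (simp add: in_Hs_coef in_L2_iff)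
    have ip: "integrable \<mu> (\<lambda>x. \<bar>u x\<bar> powr p)" and le: "Np u \<le> N2 u + K * Q u"
      using D[OF h] by (auto simp: Np_def N2_def Q_def)
    show Q: "0 \<le> Q u" unfolding Q_def by (rule fractional_form_nonneg[OF h])
    show N: "0 < N2 u" unfolding N2_def by (rule L2_norm_pos[OF u])
    have "(\<integral>x. \<bar>u x\<bar> powr p \<partial>\<mu>) \<noteq> 0"
      using u integral_nonneg_eq_0_iff_AE[OF ip] by (auto simp: nonzero_Hs_def)
    then show P: "0 < Np u" by (simp add: Np_def)
    show "e * Np u \<le> e * N2 u + e * K * Q u"
      using mult_left_mono[OF le, of e] e by (simp add: distrib_left)
    have "(Lq_norm \<mu> (ennreal p) u)\<^sup>2 = ennreal (Np u)"
      unfolding Np_def by (rule M.Lq_norm_square_eq[OF um ip]) (use p in simp)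
    then have "quotient_functional \<Omega> lam \<phi> s (ennreal p) \<epsilon> u = ennreal (Q u + e * N2 u) / ennreal (Np u)"
      unfolding quotient_functional_def quotient_numerator[OF h] Q_def N2_def e_def by (simp only:)
    also have "\<dots> = ennreal ((Q u + e * N2 u) / Np u)" using Q N P e by (intro divide_ennreal) auto
    finally show "quotient_functional \<Omega> lam \<phi> s (ennreal p) \<epsilon> u = ennreal ((Q u + e * N2 u) / Np u)" .
  qed
  have min: "global_minimizer \<Omega> lam \<phi> s (ennreal p) \<epsilon> (\<lambda>x. 1)"
    unfolding global_minimizer_def
  proof (intro conjI allI impI nonzero_one)
    fix u assume u: "nonzero_Hs \<Omega> lam \<phi> s u"
    have "e * K * Q u \<le> 1 * Q u" using e facts(1)[OF u] by (intro mult_right_mono) auto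
    then have "e * Np u \<le> Q u + e * N2 u" using facts(4)[OF u] by simp
    then have "e \<le> (Q u + e * N2 u) / Np u" using facts(3)[OF u] by (simp add: pos_le_divide_eq)
    then show "quotient_functional \<Omega> lam \<phi> s (ennreal p) \<epsilon> (\<lambda>x. 1) \<le> quotient_functional \<Omega> lam \<phi> s (ennreal p) \<epsilon> u"
      unfolding facts(5)[OF u] quotient_one[OF p0] by (simp add: e_def ennreal_leI)
  qed
  show ?thesis
    unfolding unique_global_minimizer_def
  proof (intro conjI min allI impI)
    fix w assume w: "global_minimizer \<Omega> lam \<phi> s (ennreal p) \<epsilon> w"
    then have nz: "nonzero_Hs \<Omega> lam \<phi> s w"
      and le: "quotient_functional \<Omega> lam \<phi> s (ennreal p) \<epsilon> w \<le> quotient_functional \<Omega> lam \<phi> s (ennreal p) \<epsilon> (\<lambda>x. 1)"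
      using nonzero_one by (auto simp: global_minimizer_def)
    have "ennreal ((Q w + e * N2 w) / Np w) \<le> ennreal e"
      using le unfolding facts(5)[OF nz] quotient_one[OF p0] by (simp add: e_def)
    then have "(Q w + e * N2 w) / Np w \<le> e" using e by (subst (asm) ennreal_le_iff) auto
    then have "Q w + e * N2 w \<le> e * Np w" using facts(3)[OF nz] by (simp add: pos_divide_le_eq)
    then have "(1 - e * K) * Q w \<le> 0" using facts(4)[OF nz] by (simp add: algebra_simps)
    then have "Q w = 0" using e facts(1)[OF nz] by (simp add: mult_le_0_iff)
    then have c: "AE x in \<mu>. w x = (\<integral>x. w x \<partial>\<mu>)"
      using nz by (intro zero_form_const) (auto simp: nonzero_Hs_def Q_def)
    moreover have "(\<integral>x. w x \<partial>\<mu>) \<noteq> 0"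
    proof
      assume "(\<integral>x. w x \<partial>\<mu>) = 0"
      then have "AE x in \<mu>. w x = 0" using c by simp
      then show False using nz by (simp add: nonzero_Hs_def)
    qed
    ultimately show "\<exists>c. c \<noteq> 0 \<and> (AE x in \<mu>. w x = c * 1)" by (intro exI[of _ "\<integral>x. w x \<partial>\<mu>"]) auto
  qed
qed

lemma one_unique_for_small_epsilon:
  assumes s: "0 < s" "s < 1" and q: "q \<in> exponent_range CARD('n) s"
  shows "\<exists>\<epsilon>c>0. \<forall>\<epsilon>. 0 < \<epsilon> \<and> \<epsilon> < \<epsilon>c \<longrightarrow> unique_global_minimizer \<Omega> lam \<phi> s q \<epsilon> (\<lambda>x. 1)"
proof -
  obtain p where p: "q = ennreal p" "2 < p" "real CARD('n) / 2 - real CARD('n) / p \<le> s"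
    by (rule exponent_range_real[OF s(1) _ q]) (use that in \<open>auto simp: Suc_le_eq\<close>)
  obtain K where K: "0 \<le> K" "\<And>u. in_Hs \<Omega> lam \<phi> s u \<Longrightarrow>
     integrable \<mu> (\<lambda>x. \<bar>u x\<bar> powr p) \<and>
     (\<integral>x. \<bar>u x\<bar> powr p \<partial>\<mu>) powr (2 / p) \<le> (\<integral>x. (u x)\<^sup>2 \<partial>\<mu>) + K * fractional_form \<Omega> lam \<phi> s u"
    by (rule norm_defect[OF s p(2,3)]) (rule that)
  \<comment> \<open>K + 1 in place of K keeps the threshold defined when K = 0.\<close>
  define \<epsilon>c where "\<epsilon>c = (1 / (K + 1)) powr (1 / (2 * s))"
  show ?thesis
  proof (intro exI[of _ \<epsilon>c] conjI allI impI)
    show "0 < \<epsilon>c" using K by (simp add: \<epsilon>c_def)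
    fix \<epsilon> :: real assume \<epsilon>: "0 < \<epsilon> \<and> \<epsilon> < \<epsilon>c"
    have "\<epsilon> powr (2 * s) < \<epsilon>c powr (2 * s)" using \<epsilon> s by (intro powr_less_mono2) auto
    also have "\<dots> = 1 / (K + 1)" using s K by (simp add: \<epsilon>c_def powr_powr)
    finally have "\<epsilon> powr (2 * s) * (K + 1) < 1" using K by (simp add: pos_less_divide_eq)
    moreover have "\<epsilon> powr (2 * s) * K \<le> \<epsilon> powr (2 * s) * (K + 1)" by (intro mult_left_mono) auto
    ultimately have "\<epsilon> powr (2 * s) * K < 1" by linarith
    then show "unique_global_minimizer \<Omega> lam \<phi> s q \<epsilon> (\<lambda>x. 1)"
      unfolding p(1) using \<epsilon> by (intro unique_minimizer[OF p(2) K(1) _ _ K(2)]) auto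
  qed
qed

text \<open>The constant K belongs to one fixed exponent p; interpolation multiplies it by \<theta>,
  which beats any given \<epsilon> once q is close to 2.\<close>

lemma one_unique_for_exponent_near_2:
  assumes s: "0 < s" "s < 1" and \<epsilon>: "0 < \<epsilon>"
  shows "\<exists>qc\<in>exponent_range CARD('n) s. \<forall>q. 2 < q \<and> q < qc \<longrightarrow> unique_global_minimizer \<Omega> lam \<phi> s q \<epsilon> (\<lambda>x. 1)"
proof -
  have N: "1 \<le> CARD('n)" by (simp add: Suc_le_eq)
  obtain q0 where q0: "q0 \<in> exponent_range CARD('n) s" by (rule exponent_range_nonempty[OF s N])
  obtain p where p: "q0 = ennreal p" "2 < p" "real CARD('n) / 2 - real CARD('n) / p \<le> s"
    by (rule exponent_range_real[OF s(1) N q0]) (rule that)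
  obtain K where K: "0 \<le> K" "\<And>u. in_Hs \<Omega> lam \<phi> s u \<Longrightarrow>
     integrable \<mu> (\<lambda>x. \<bar>u x\<bar> powr p) \<and>
     (\<integral>x. \<bar>u x\<bar> powr p \<partial>\<mu>) powr (2 / p) \<le> (\<integral>x. (u x)\<^sup>2 \<partial>\<mu>) + K * fractional_form \<Omega> lam \<phi> s u"
    by (rule norm_defect[OF s p(2,3)]) (rule that)
  define e where "e = \<epsilon> powr (2 * s)"
  have e: "0 < e" using \<epsilon> by (simp add: e_def)
  have eK: "0 < e * K + 1" using e K by (simp add: add_nonneg_pos)
  define \<delta> where "\<delta> = 2 * (p - 2) / (p * (e * K + 1))"
  have \<delta>: "0 < \<delta>" using p eK by (simp add: \<delta>_def)
  \<comment> \<open>Below p interpolation applies. Below 2 + \<delta>, replacing the factor r in the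
    denominator of \<theta> by 2 gives \<theta> < p \<delta> / (2 (p - 2)), which by the choice of
    \<delta> equals 1 / (e K + 1).\<close>
  define r0 where "r0 = min p (2 + \<delta>)"
  have r0: "2 < r0" "r0 \<le> p" using p \<delta> by (auto simp: r0_def)
  show ?thesis
  proof (intro bexI[of _ "ennreal r0"] allI impI)
    have "ennreal 2 < ennreal r0" using r0 by (subst ennreal_less_iff) auto
    moreover have "ennreal r0 \<le> q0" unfolding p using r0 by (intro ennreal_leI)
    ultimately show "ennreal r0 \<in> exponent_range CARD('n) s" using exponent_range_downward[OF q0] by simp
    fix q :: ennreal assume q: "2 < q \<and> q < ennreal r0"
    then obtain r where r: "q = ennreal r" "2 < r" "r < r0"
      by (cases q) (auto simp: ennreal_less_iff simp flip: ennreal_numeral)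
    define \<theta> where "\<theta> = p * (r - 2) / (r * (p - 2))"
    have \<theta>0: "0 \<le> \<theta>" using r p by (simp add: \<theta>_def)
    have "\<theta> \<le> p * (r - 2) / (2 * (p - 2))"
      unfolding \<theta>_def using r p by (intro divide_left_mono mult_right_mono mult_pos_pos mult_nonneg_nonneg) auto
    also have "\<dots> < p * \<delta> / (2 * (p - 2))"
      using r p by (intro divide_strict_right_mono mult_strict_left_mono) (auto simp: r0_def)
    also have "\<dots> = 1 / (e * K + 1)" using p eK by (simp add: \<delta>_def)
    finally have "\<theta> * (e * K + 1) < 1" using eK by (simp add: pos_less_divide_eq)
    then have \<theta>1: "e * (\<theta> * K) < 1" using \<theta>0 by (simp add: algebra_simps)
    show "unique_global_minimizer \<Omega> lam \<phi> s q \<epsilon> (\<lambda>x. 1)"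
      unfolding r(1)
    proof (rule unique_minimizer[OF r(2) _ _ \<epsilon>])
      show "0 \<le> \<theta> * K" using \<theta>0 K by simp
      show "\<epsilon> powr (2 * s) * (\<theta> * K) < 1" using \<theta>1 by (simp add: e_def)
      fix u assume u: "in_Hs \<Omega> lam \<phi> s u"
      have um: "u \<in> borel_measurable \<mu>" "integrable \<mu> (\<lambda>x. (u x)\<^sup>2)" using u by (auto simp: in_Hs_coef in_L2_iff)
      have rp: "r < p" using r r0 by simp
      have ip: "integrable \<mu> (\<lambda>x. \<bar>u x\<bar> powr p)" using K(2)[OF u] by simp
      have "(\<integral>x. \<bar>u x\<bar> powr r \<partial>\<mu>) powr (2 / r) \<le> (1 - \<theta>) * (\<integral>x. (u x)\<^sup>2 \<partial>\<mu>) + \<theta> * (\<integral>x. \<bar>u x\<bar> powr p \<partial>\<mu>) powr (2 / p)"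
        unfolding \<theta>_def by (rule interpolation_square(2)[OF um(1) r(2) rp um(2) ip])
      also have "\<dots> \<le> (1 - \<theta>) * (\<integral>x. (u x)\<^sup>2 \<partial>\<mu>) + \<theta> * ((\<integral>x. (u x)\<^sup>2 \<partial>\<mu>) + K * fractional_form \<Omega> lam \<phi> s u)"
        using K(2)[OF u] \<theta>0 by (intro add_left_mono mult_left_mono) auto
      also have "\<dots> = (\<integral>x. (u x)\<^sup>2 \<partial>\<mu>) + \<theta> * K * fractional_form \<Omega> lam \<phi> s u" by (simp add: algebra_simps)
      finally show "integrable \<mu> (\<lambda>x. \<bar>u x\<bar> powr r) \<and>
        (\<integral>x. \<bar>u x\<bar> powr r \<partial>\<mu>) powr (2 / r) \<le> (\<integral>x. (u x)\<^sup>2 \<partial>\<mu>) + \<theta> * K * fractional_form \<Omega> lam \<phi> s u"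
        using interpolation_square(1)[OF um(1) r(2) rp um(2) ip] by simp
    qed
  qed
qed

text \<open>The same u beats the constant for the larger parameters. With Q its form, N its squared
  L_2 norm and D its squared L_q norm, beating the constant means Q < e (D - N). As Q \<ge> 0, the
  difference is positive for the smaller parameters, so the right-hand side grows both with e and
  with D.\<close>

lemma one_not_minimizer_mono:
  assumes s: "0 < s" and \<epsilon>: "0 < \<epsilon>0" "\<epsilon>0 \<le> \<epsilon>" and q: "2 < q0" "q0 \<le> q"
    and n: "\<not> global_minimizer \<Omega> lam \<phi> s q0 \<epsilon>0 (\<lambda>x. 1)"
  shows "\<not> global_minimizer \<Omega> lam \<phi> s q \<epsilon> (\<lambda>x. 1)"
proof -
  have "0 < q0" by (rule order.strict_trans[OF _ q(1)]) simp
  then have q0: "q0 \<noteq> 0" "q \<noteq> 0" "0 < q0" using q by auto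
  define e0 where "e0 = \<epsilon>0 powr (2 * s)"
  define e where "e = \<epsilon> powr (2 * s)"
  have e: "0 < e0" "e0 \<le> e" using \<epsilon> s by (auto simp: e0_def e_def intro!: powr_mono2)
  obtain u where u: "nonzero_Hs \<Omega> lam \<phi> s u"
    and lt: "quotient_functional \<Omega> lam \<phi> s q0 \<epsilon>0 u < ennreal e0"
    using n nonzero_one quotient_one[OF q0(1)] by (auto simp: global_minimizer_def not_le e0_def)
  have h: "in_Hs \<Omega> lam \<phi> s u" using u by (simp add: nonzero_Hs_def)
  have um: "u \<in> borel_measurable \<mu>" using h by (simp add: in_Hs_coef in_L2_iff)
  define Q where "Q = fractional_form \<Omega> lam \<phi> s u"
  define N where "N = (\<integral>x. (u x)\<^sup>2 \<partial>\<mu>)"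
  have Q: "0 \<le> Q" unfolding Q_def by (rule fractional_form_nonneg[OF h])
  have N: "0 < N" unfolding N_def by (rule L2_norm_pos[OF u])
  define D0 where "D0 = (Lq_norm \<mu> q0 u)\<^sup>2"
  define D where "D = (Lq_norm \<mu> q u)\<^sup>2"
  have D0D: "D0 \<le> D" unfolding D0_def D_def by (intro power_mono M.Lq_norm_mono[OF um q0(3) q(2)]) simp
  have lt0: "ennreal (Q + e0 * N) / D0 < ennreal e0"
    using lt unfolding quotient_functional_def quotient_numerator[OF h] by (simp add: Q_def N_def D0_def e0_def)
  have "ennreal (Q + e * N) / D < ennreal e"
  proof (cases D)
    case top
    \<comment> \<open>If u is not in L_q, the quotient is a division by \<infinity> and equals
      0.\<close>
    then show ?thesis using e by simp
  next
    case (real d)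
    then obtain d0 where d0: "D0 = ennreal d0" "0 \<le> d0" "d0 \<le> d"
      using D0D by (cases D0) (auto simp: top_unique)
    have "0 < Q + e0 * N" using Q N e by (simp add: add_nonneg_pos)
    \<comment> \<open>A positive numerator divided by 0 is \<infinity>, which is not below
      e0.\<close>
    then have "d0 \<noteq> 0" using lt0 d0 by (auto simp: ennreal_divide_zero)
    then have d0p: "0 < d0" using d0 by simp
    then have "(Q + e0 * N) / d0 < e0"
      using lt0 d0 Q N e by (subst (asm) d0(1), subst (asm) divide_ennreal) (auto simp: ennreal_less_iff)
    then have "Q + e0 * N < e0 * d0" using d0p by (simp add: pos_divide_less_eq)
    then have 1: "Q < e0 * (d0 - N)" by (simp add: algebra_simps)
    then have "0 < e0 * (d0 - N)" using Q by linarith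
    then have "0 < d0 - N" using e by (simp add: zero_less_mult_iff)
    then have "e0 * (d0 - N) \<le> e * (d - N)" using e d0 by (intro mult_mono) auto
    then have "Q + e * N < e * d" using 1 by (simp add: algebra_simps)
    then have "(Q + e * N) / d < e" using d0p d0 by (simp add: pos_divide_less_eq)
    then show ?thesis using d0p d0 Q N e unfolding real(2) by (subst divide_ennreal) (auto simp: ennreal_less_iff)
  qed
  then have "quotient_functional \<Omega> lam \<phi> s q \<epsilon> u < quotient_functional \<Omega> lam \<phi> s q \<epsilon> (\<lambda>x. 1)"
    unfolding quotient_one[OF q0(2)] unfolding quotient_functional_def quotient_numerator[OF h]
    by (simp add: Q_def N_def D_def e_def)
  then show ?thesis using u by (auto simp: global_minimizer_def not_le)
qed

end

theorem theorem2:
  fixes \<Omega> :: "(real ^ 'n) set"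
    and s :: real
    and lam :: "nat \<Rightarrow> real"
    and \<phi> :: "nat \<Rightarrow> real ^ 'n \<Rightarrow> real"
  assumes "bounded \<Omega>"
    and "lipschitz_domain \<Omega>"
    and "emeasure lebesgue \<Omega> = 1"
    and "0 < s" and "s < 1"
    and "neumann_eigensystem \<Omega> lam \<phi>"
  shows
    "(\<forall>q \<in> exponent_range CARD('n) s. \<exists>\<epsilon>c>0. \<forall>\<epsilon>. 0 < \<epsilon> \<and> \<epsilon> < \<epsilon>c \<longrightarrow>
        unique_global_minimizer \<Omega> lam \<phi> s q \<epsilon> (\<lambda>x. 1)) \<and>
     (\<forall>\<epsilon>>0. \<exists>qc \<in> exponent_range CARD('n) s. \<forall>q. 2 < q \<and> q < qc \<longrightarrow>
        unique_global_minimizer \<Omega> lam \<phi> s q \<epsilon> (\<lambda>x. 1)) \<and>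
     (\<forall>\<epsilon>0>0. \<forall>q0 \<in> admissible_exponents CARD('n) s. q0 > 2 \<longrightarrow>
        \<not> global_minimizer \<Omega> lam \<phi> s q0 \<epsilon>0 (\<lambda>x. 1) \<longrightarrow>
        (\<forall>\<epsilon>\<ge>\<epsilon>0. \<forall>q \<in> admissible_exponents CARD('n) s. q0 \<le> q \<longrightarrow>
           \<not> global_minimizer \<Omega> lam \<phi> s q \<epsilon> (\<lambda>x. 1)))"
proof -
  interpret neumann_domain \<Omega> lam \<phi>
    by (unfold_locales) (use assms in auto)
  show ?thesis
    using one_unique_for_small_epsilon[OF assms(4,5)] one_unique_for_exponent_near_2[OF assms(4,5)]
      one_not_minimizer_mono[OF assms(4)]
    by (intro conjI ballI allI impI) blast+
qed

end
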